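(* Let $X$ be a second-countable locally compact Hausdorff space and $\kappa$ a perfect kernel on $X$. Let $A\subset X$ be a set with $c_*(A)>0$ such that $\mathcal E^+(A)$ is closed in the strong topology, and let $\omega\in\mathfrak M$, $\omega\ne0$, be a signed Radon measure. Assume that: (a) $\omega^+(X)<\infty$; (b) for every compact $K\subset A$ the restriction $U^{\omega^+}|_K$ is upper semicontinuous, and $\sup_{x\in A}U^{|\omega|}(x)<\infty$; (c) $\kappa$ satisfies the $h$-Ugaheri maximum principle for some $h\in[1,\infty)$; (d) $\kappa(x,y)$ is continuous for $x\ne y$; (e) $\kappa(\cdot,y)\to0$ uniformly on compact subsets of $X$ as $y\to\infty_X$; (f) $\omega$ is compactly supported in $X\setminus\overline{A}$. Put $f:=-U^\omega$. Then a solution $\lambda_{A,f}$ to the inner Gauss variational problem (a measure $\lambda_{A,f}\in\breve{\mathcal E}^+_f(A)$ with $I_f(\lambda_{A,f})=w_f(A)$) exists if and only if $$c_*(A)<\infty\quad\text{or}\quad\widehat{\omega}^A(X)\geqslant1.$$ If moreover $\widehat{\omega}^A(X)=1$, then $\lambda_{A,f}=\widehat{\omega}^A$.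
   Context: $\mathfrak M$ is the space of all real-valued (signed) Radon measures on $X$ with the vague topology (pointwise convergence on continuous functions of compact support), and $\mathfrak M^+$ is its cone of positive measures. For $\omega\in\mathfrak M$, $\omega^\pm$ are its positive and negative parts (Hahn--Jordan decomposition) and $|\omega|=\omega^++\omega^-$. $\overline{A}$ is the closure of $A$ in $X$; $\infty_X$ is the Alexandroff point of $X$, so (e) means that for each compact $Q\subset X$ and $\varepsilon>0$ there is a compact $Q'\subset X$ with $\kappa(x,y)<\varepsilon$ for all $x\in Q$, $y\notin Q'$. A kernel is a symmetric lower semicontinuous function $\kappa:X\times X\to[0,\infty]$. For $\mu,\nu\in\mathfrak M$: the mutual energy is $I(\mu,\nu)=\int\kappa\,d(\mu\otimes\nu)$, the potential is $U^\mu(x)=\int\kappa(x,y)\,d\mu(y)$, and the energy is $I(\mu)=I(\mu,\mu)$, each whenever well defined as a finite number or $\pm\infty$. The kernel is perfect if: (1) it is strictly positive definite, i.e. $I(\mu)\geqslant0$ for all signed $\mu\in\mathfrak M$ (for which $I(\mu)$ is well defined), with $I(\mu)=0$ only for $\mu=0$; then the set $\mathcal E$ of all signed measures of finite energy is a pre-Hilbert space with inner product $I(\mu,\nu)$ and norm $\|\mu\|=\sqrt{I(\mu)}$, whose topology is called strong; and (2) it is consistent, i.e. $\mathcal E^+:=\mathcal E\cap\mathfrak M^+$ is complete in the induced strong topology, and the strong topology on $\mathcal E^+$ is finer than the vague topology on $\mathcal E^+$. $h$-Ugaheri's maximum principle: for each $\mu\in\mathcal E^+$ with $U^\mu\leqslant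 c_\mu$ $\mu$-a.e., where $c_\mu\in(0,\infty)$, one has $U^\mu\leqslant hc_\mu$ on all of $X$. For $A\subset X$, $\mathfrak M^+(A)$ is the set of $\mu\in\mathfrak M^+$ concentrated on $A$, i.e. such that $X\setminus A$ is $\mu$-negligible, and $\mathcal E^+(A)=\mathcal E\cap\mathfrak M^+(A)$. With $f=-U^\omega$: $\mathcal E^+_f(A)$ is the set of $\mu\in\mathcal E^+(A)$ for which $f$ is $\mu$-integrable; for these the Gauss functional is $I_f(\mu)=\|\mu\|^2+2\int f\,d\mu=\|\mu\|^2-2\int U^\omega\,d\mu$. Further, $\breve{\mathcal E}^+_f(A)=\{\mu\in\mathcal E^+_f(A):\mu(X)=1\}$ and $w_f(A)=\inf_{\mu\in\breve{\mathcal E}^+_f(A)}I_f(\mu)$, which is finite; a solution $\lambda_{A,f}$ is unique if it exists. The inner pseudo-balayage $\widehat{\omega}^A$ of $\omega$ onto $A$ is the unique measure in $\mathcal E^+_f(A)$ minimizing $I_f$ over $\mathcal E^+_f(A)$ (it exists under the stated assumptions). Capacities: for compact $K$, $c(K)=1/\inf\{I(\mu):\mu\in\mathcal E^+(K),\ \mu(K)=1\}$ (with $c(K)=0$ if there is no such $\mu$); the inner capacity is $c_*(E)=\sup\{c(K): K\subset E\text{ compact}\}$. *)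

theory Defs
  imports "HOL-Analysis.Analysis"
begin

section \<open>Radon measures\<close>

text \<open>The underlying space \<open>X\<close> is the universe of a type of classes \<open>t2_space\<close> and
  \<open>second_countable_topology\<close>; local compactness is a hypothesis of the theorem.\<close>

definition radon_measure :: "'a::topological_space measure \<Rightarrow> bool" where
  "radon_measure M \<longleftrightarrow>
     sets M = sets borel \<and>
     (\<forall>K. compact K \<longrightarrow> emeasure M K < \<infinity>) \<and>
     (\<forall>B\<in>sets borel. emeasure M B = (SUP K\<in>{K. compact K \<and> K \<subseteq> B}. emeasure M K))"

text \<open>A signed Radon measure need not be a set function on all Borel sets, since both its
  positive and its negative part may be infinite. It is represented by the pair of its positive and
  negative parts; mutual singularity makes this pair the Hahn--Jordan decomposition, so equality of
  pairs satisfying \<open>signed_radon\<close> is equality of signed measures.\<close>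

datatype 'a signed_measure = Signed (pos_part: "'a measure") (neg_part: "'a measure")

definition mutually_singular :: "'a::topological_space measure \<Rightarrow> 'a measure \<Rightarrow> bool" where
  "mutually_singular P N \<longleftrightarrow> (\<exists>S\<in>sets borel. emeasure P S = 0 \<and> emeasure N (- S) = 0)"

definition signed_radon :: "'a::topological_space signed_measure \<Rightarrow> bool" where
  "signed_radon \<mu> \<longleftrightarrow>
     radon_measure (pos_part \<mu>) \<and> radon_measure (neg_part \<mu>) \<and>
     mutually_singular (pos_part \<mu>) (neg_part \<mu>)"

definition of_positive :: "'a::topological_space measure \<Rightarrow> 'a signed_measure" where
  "of_positive M = Signed M (null_measure borel)"

definition zero_signed :: "'a::topological_space signed_measure" where
  "zero_signed = of_positive (null_measure borel)"

text \<open>\<open>|\<mu>| = \<mu>\<^sup>+ + \<mu>\<^sup>-\<close>\<close>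
definition total_variation :: "'a::topological_space signed_measure \<Rightarrow> 'a measure" where
  "total_variation \<mu> =
     measure_of UNIV (sets borel) (\<lambda>B. emeasure (pos_part \<mu>) B + emeasure (neg_part \<mu>) B)"

text \<open>The difference \<open>\<sigma> = \<mu> - \<nu>\<close>. The identity
  \<open>\<sigma>\<^sup>+ - \<sigma>\<^sup>- = (\<mu>\<^sup>+ - \<mu>\<^sup>-) - (\<nu>\<^sup>+ - \<nu>\<^sup>-)\<close>, meaningful on sets of finite measure, is
  rearranged so that no subtraction of infinite values occurs.\<close>
definition signed_diff ::
  "'a::topological_space signed_measure \<Rightarrow> 'a signed_measure \<Rightarrow> 'a signed_measure" where
  "signed_diff \<mu> \<nu> = (THE \<sigma>. signed_radon \<sigma> \<and>
     (\<forall>B\<in>sets borel.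
        emeasure (pos_part \<sigma>) B + emeasure (neg_part \<mu>) B + emeasure (pos_part \<nu>) B =
        emeasure (neg_part \<sigma>) B + emeasure (pos_part \<mu>) B + emeasure (neg_part \<nu>) B))"

definition measure_support :: "'a::topological_space measure \<Rightarrow> 'a set" where
  "measure_support M = {x. \<forall>U. open U \<and> x \<in> U \<longrightarrow> emeasure M U > 0}"

text \<open>\<open>A\<close> is an arbitrary set, not necessarily Borel, so negligibility of its complement is
  meant in the sense of outer measure.\<close>
definition concentrated_on :: "'a measure \<Rightarrow> 'a set \<Rightarrow> bool" where
  "concentrated_on M A \<longleftrightarrow> (\<exists>N\<in>null_sets M. - A \<subseteq> N)"

definition Cc :: "('a::topological_space \<Rightarrow> real) set" where
  "Cc = {\<phi>. continuous_on UNIV \<phi> \<and> compact (closure {x. \<phi> x \<noteq> 0})}"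

text \<open>The topology on the space of signed Radon measures induced by the evaluations
  \<open>\<mu> \<mapsto> \<integral>\<phi> d\<mu>\<close>, \<open>\<phi>\<close> ranging over \<open>Cc\<close>.\<close>
definition vague_topology :: "'a::topological_space signed_measure topology" where
  "vague_topology =
     pullback_topology {\<mu>. signed_radon \<mu>}
       (\<lambda>\<mu>. restrict (\<lambda>\<phi>. (LINT x|pos_part \<mu>. \<phi> x) - (LINT x|neg_part \<mu>. \<phi> x)) Cc)
       (product_topology (\<lambda>_. euclideanreal) Cc)"

section \<open>Kernels, potentials and energies\<close>

definition lower_semicontinuous :: "('b::topological_space \<Rightarrow> ennreal) \<Rightarrow> bool" where
  "lower_semicontinuous g \<longleftrightarrow> (\<forall>t. open {x. t < g x})"

definition upper_semicontinuous_on :: "'b::topological_space set \<Rightarrow> ('b \<Rightarrow> ennreal) \<Rightarrow> bool" where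
  "upper_semicontinuous_on S g \<longleftrightarrow> (\<forall>t. openin (top_of_set S) {x\<in>S. g x < t})"

definition kernel :: "('a::topological_space \<times> 'a \<Rightarrow> ennreal) \<Rightarrow> bool" where
  "kernel \<kappa> \<longleftrightarrow> (\<forall>x y. \<kappa> (x, y) = \<kappa> (y, x)) \<and> lower_semicontinuous \<kappa>"

definition potential :: "('a \<times> 'a \<Rightarrow> ennreal) \<Rightarrow> 'a measure \<Rightarrow> 'a \<Rightarrow> ennreal" where
  "potential \<kappa> M x = (\<integral>\<^sup>+ y. \<kappa> (x, y) \<partial>M)"

definition mutual_energy :: "('a \<times> 'a \<Rightarrow> ennreal) \<Rightarrow> 'a measure \<Rightarrow> 'a measure \<Rightarrow> ennreal" where
  "mutual_energy \<kappa> M N = (\<integral>\<^sup>+ p. \<kappa> p \<partial>(M \<Otimes>\<^sub>M N))"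

abbreviation energy :: "('a \<times> 'a \<Rightarrow> ennreal) \<Rightarrow> 'a measure \<Rightarrow> ennreal" where
  "energy \<kappa> M \<equiv> mutual_energy \<kappa> M M"

text \<open>Where \<open>U\<close> of both parts is infinite, the potential of a signed measure is undefined; the
  \<open>ereal\<close> convention gives it an infinite value there, so \<open>ext_integrable\<close> below treats
  such points as points where the function is not finite.\<close>
definition signed_potential ::
  "('a \<times> 'a \<Rightarrow> ennreal) \<Rightarrow> 'a signed_measure \<Rightarrow> 'a \<Rightarrow> ereal" where
  "signed_potential \<kappa> \<mu> x =
     enn2ereal (potential \<kappa> (pos_part \<mu>) x) - enn2ereal (potential \<kappa> (neg_part \<mu>) x)"

text \<open>Integrals of \<open>\<kappa>\<close> against the positive and the negative part of \<open>\<mu> \<otimes> \<nu>\<close>.\<close>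
definition signed_energy_pos ::
  "('a \<times> 'a \<Rightarrow> ennreal) \<Rightarrow> 'a signed_measure \<Rightarrow> 'a signed_measure \<Rightarrow> ennreal" where
  "signed_energy_pos \<kappa> \<mu> \<nu> =
     mutual_energy \<kappa> (pos_part \<mu>) (pos_part \<nu>) + mutual_energy \<kappa> (neg_part \<mu>) (neg_part \<nu>)"

definition signed_energy_neg ::
  "('a \<times> 'a \<Rightarrow> ennreal) \<Rightarrow> 'a signed_measure \<Rightarrow> 'a signed_measure \<Rightarrow> ennreal" where
  "signed_energy_neg \<kappa> \<mu> \<nu> =
     mutual_energy \<kappa> (pos_part \<mu>) (neg_part \<nu>) + mutual_energy \<kappa> (neg_part \<mu>) (pos_part \<nu>)"

definition signed_energy_defined ::
  "('a \<times> 'a \<Rightarrow> ennreal) \<Rightarrow> 'a signed_measure \<Rightarrow> 'a signed_measure \<Rightarrow> bool" where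
  "signed_energy_defined \<kappa> \<mu> \<nu> \<longleftrightarrow>
     signed_energy_pos \<kappa> \<mu> \<nu> < \<infinity> \<or> signed_energy_neg \<kappa> \<mu> \<nu> < \<infinity>"

definition signed_mutual_energy ::
  "('a \<times> 'a \<Rightarrow> ennreal) \<Rightarrow> 'a signed_measure \<Rightarrow> 'a signed_measure \<Rightarrow> ereal" where
  "signed_mutual_energy \<kappa> \<mu> \<nu> =
     enn2ereal (signed_energy_pos \<kappa> \<mu> \<nu>) - enn2ereal (signed_energy_neg \<kappa> \<mu> \<nu>)"

definition strictly_positive_definite :: "('a::topological_space \<times> 'a \<Rightarrow> ennreal) \<Rightarrow> bool" where
  "strictly_positive_definite \<kappa> \<longleftrightarrow>
     (\<forall>\<mu>. signed_radon \<mu> \<and> signed_energy_defined \<kappa> \<mu> \<mu> \<longrightarrow>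
        0 \<le> signed_mutual_energy \<kappa> \<mu> \<mu> \<and>
        (signed_mutual_energy \<kappa> \<mu> \<mu> = 0 \<longrightarrow> \<mu> = zero_signed))"

definition energy_space ::
  "('a::topological_space \<times> 'a \<Rightarrow> ennreal) \<Rightarrow> 'a signed_measure set" where
  "energy_space \<kappa> = {\<mu>. signed_radon \<mu> \<and> signed_energy_defined \<kappa> \<mu> \<mu> \<and>
     \<bar>signed_mutual_energy \<kappa> \<mu> \<mu>\<bar> \<noteq> \<infinity>}"

definition energy_norm :: "('a \<times> 'a \<Rightarrow> ennreal) \<Rightarrow> 'a signed_measure \<Rightarrow> real" where
  "energy_norm \<kappa> \<mu> = sqrt (real_of_ereal (signed_mutual_energy \<kappa> \<mu> \<mu>))"

text \<open>The value \<open>0\<close> off \<open>energy_space\<close> is only there because \<open>Metric_space\<close> asks for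
  nonnegativity and symmetry of the distance on the whole type.\<close>
definition strong_dist ::
  "('a::topological_space \<times> 'a \<Rightarrow> ennreal) \<Rightarrow> 'a signed_measure \<Rightarrow> 'a signed_measure \<Rightarrow> real" where
  "strong_dist \<kappa> \<mu> \<nu> =
     (if \<mu> \<in> energy_space \<kappa> \<and> \<nu> \<in> energy_space \<kappa> then energy_norm \<kappa> (signed_diff \<mu> \<nu>) else 0)"

text \<open>\<open>Metric_space (energy_space \<kappa>) (strong_dist \<kappa>)\<close> holds for strictly positive definite
  kernels, the only ones for which this topology is considered.\<close>
definition strong_topology ::
  "('a::topological_space \<times> 'a \<Rightarrow> ennreal) \<Rightarrow> 'a signed_measure topology" where
  "strong_topology \<kappa> = Metric_space.mtopology (energy_space \<kappa>) (strong_dist \<kappa>)"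

text \<open>\<open>\<E>\<^sup>+(A)\<close>; the case \<open>A = UNIV\<close> is \<open>\<E>\<^sup>+\<close>.\<close>
definition energy_cone ::
  "('a::topological_space \<times> 'a \<Rightarrow> ennreal) \<Rightarrow> 'a set \<Rightarrow> 'a measure set" where
  "energy_cone \<kappa> A = {\<mu>. radon_measure \<mu> \<and> energy \<kappa> \<mu> < \<infinity> \<and> concentrated_on \<mu> A}"

definition consistent :: "('a::topological_space \<times> 'a \<Rightarrow> ennreal) \<Rightarrow> bool" where
  "consistent \<kappa> \<longleftrightarrow>
     (let E = of_positive ` energy_cone \<kappa> UNIV in
        Metric_space.mcomplete E (strong_dist \<kappa>) \<and>
        (\<forall>U. openin (subtopology vague_topology E) U \<longrightarrow>
             openin (subtopology (strong_topology \<kappa>) E) U))"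

definition perfect_kernel :: "('a::topological_space \<times> 'a \<Rightarrow> ennreal) \<Rightarrow> bool" where
  "perfect_kernel \<kappa> \<longleftrightarrow> kernel \<kappa> \<and> strictly_positive_definite \<kappa> \<and> consistent \<kappa>"

definition ugaheri_maximum_principle ::
  "real \<Rightarrow> ('a::topological_space \<times> 'a \<Rightarrow> ennreal) \<Rightarrow> bool" where
  "ugaheri_maximum_principle h \<kappa> \<longleftrightarrow>
     (\<forall>\<mu>\<in>energy_cone \<kappa> UNIV. \<forall>c>0.
        (AE x in \<mu>. potential \<kappa> \<mu> x \<le> ennreal c) \<longrightarrow> (\<forall>x. potential \<kappa> \<mu> x \<le> ennreal (h * c)))"

text \<open>The infimum of the empty set is \<open>\<infinity>\<close> in \<open>ennreal\<close>, and \<open>1 / \<infinity> = 0\<close>.\<close>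
definition capacity :: "('a::topological_space \<times> 'a \<Rightarrow> ennreal) \<Rightarrow> 'a set \<Rightarrow> ennreal" where
  "capacity \<kappa> K = 1 / (INF \<mu>\<in>{\<mu>\<in>energy_cone \<kappa> K. emeasure \<mu> K = 1}. energy \<kappa> \<mu>)"

definition inner_capacity :: "('a::topological_space \<times> 'a \<Rightarrow> ennreal) \<Rightarrow> 'a set \<Rightarrow> ennreal" where
  "inner_capacity \<kappa> E = (SUP K\<in>{K. compact K \<and> K \<subseteq> E}. capacity \<kappa> K)"

section \<open>The inner Gauss variational problem and inner pseudo-balayage\<close>

definition ext_integrable :: "'a measure \<Rightarrow> ('a \<Rightarrow> ereal) \<Rightarrow> bool" where
  "ext_integrable M f \<longleftrightarrow>
     (AE x in M. \<bar>f x\<bar> \<noteq> \<infinity>) \<and> integrable M (\<lambda>x. real_of_ereal (f x))"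

definition field_cone ::
  "('a::topological_space \<times> 'a \<Rightarrow> ennreal) \<Rightarrow> ('a \<Rightarrow> ereal) \<Rightarrow> 'a set \<Rightarrow> 'a measure set" where
  "field_cone \<kappa> f A = {\<mu>\<in>energy_cone \<kappa> A. ext_integrable \<mu> f}"

definition unit_field_cone ::
  "('a::topological_space \<times> 'a \<Rightarrow> ennreal) \<Rightarrow> ('a \<Rightarrow> ereal) \<Rightarrow> 'a set \<Rightarrow> 'a measure set" where
  "unit_field_cone \<kappa> f A = {\<mu>\<in>field_cone \<kappa> f A. emeasure \<mu> UNIV = 1}"

definition gauss_functional ::
  "('a \<times> 'a \<Rightarrow> ennreal) \<Rightarrow> ('a \<Rightarrow> ereal) \<Rightarrow> 'a measure \<Rightarrow> real" where
  "gauss_functional \<kappa> f \<mu> = enn2real (energy \<kappa> \<mu>) + 2 * (LINT x|\<mu>. real_of_ereal (f x))"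

definition gauss_inf ::
  "('a::topological_space \<times> 'a \<Rightarrow> ennreal) \<Rightarrow> ('a \<Rightarrow> ereal) \<Rightarrow> 'a set \<Rightarrow> ereal" where
  "gauss_inf \<kappa> f A = (INF \<mu>\<in>unit_field_cone \<kappa> f A. ereal (gauss_functional \<kappa> f \<mu>))"

definition gauss_solution ::
  "('a::topological_space \<times> 'a \<Rightarrow> ennreal) \<Rightarrow> ('a \<Rightarrow> ereal) \<Rightarrow> 'a set \<Rightarrow> 'a measure \<Rightarrow> bool" where
  "gauss_solution \<kappa> f A l \<longleftrightarrow>
     l \<in> unit_field_cone \<kappa> f A \<and> ereal (gauss_functional \<kappa> f l) = gauss_inf \<kappa> f A"

definition pseudo_balayage ::
  "('a::topological_space \<times> 'a \<Rightarrow> ennreal) \<Rightarrow> 'a signed_measure \<Rightarrow> 'a set \<Rightarrow> 'a measure" where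
  "pseudo_balayage \<kappa> \<omega> A =
     (let f = (\<lambda>x. - signed_potential \<kappa> \<omega> x) in
        THE \<mu>. \<mu> \<in> field_cone \<kappa> f A \<and>
          (\<forall>\<nu>\<in>field_cone \<kappa> f A. gauss_functional \<kappa> f \<mu> \<le> gauss_functional \<kappa> f \<nu>))"

end

theory Submission
  imports Defs
begin

text \<open>
  The argument rests on convexity. At the midpoint of two measures \<open>\<mu>\<close> and \<open>\<nu>\<close> the Gauss functional
  \<open>J\<close> falls below its average by a quarter of the squared energy norm of \<open>\<mu> - \<nu>\<close>. So a
  minimizer over a convex set is unique, and a minimizing sequence is strongly Cauchy
  (\<open>minimizing_sequence\<close>). Perfectness supplies a strong limit, which is also a vague limit. To
  see that it is a minimizer one needs semicontinuity of the linear term and control of the mass.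

  Semicontinuity (\<open>field_lsc\<close>): the potential of \<open>\<omega>\<^sup>-\<close> is lower semicontinuous, hence so is its
  integral. For \<open>\<omega>\<^sup>+\<close> the superlevel sets of the potential are relatively closed in \<open>A\<close> and, by the
  decay of the kernel at infinity, relatively compact; as every measure in question, the limit
  included, is concentrated on \<open>A\<close>, the portmanteau inequality for compact sets applies to them.

  Mass (\<open>positivity_of_mass\<close>): if \<open>L\<close> minimizes \<open>J\<close> among measures of mass at most \<open>q\<close>, its
  potential is at most that of \<open>\<omega>\<^sup>+\<close> almost everywhere with respect to \<open>L\<close>, because the part of \<open>L\<close>
  where this fails could be removed with profit. Integrating against equilibrium measures of compact
  sets, whose potentials are controlled by the maximum principle, gives \<open>L(X) \<le> h \<omega>\<^sup>+(X)\<close>. This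
  bound does not involve \<open>q\<close>, so for large \<open>q\<close> the constraint is inactive and \<open>L\<close> is a global
  minimizer: the pseudo-balayage exists and has finite mass (\<open>global_minimizer_exists\<close>).

  Consider now unit measures. If the capacity of \<open>A\<close> is finite, measures of bounded energy on \<open>A\<close> are
  tight (\<open>finite_capacity_tightness\<close>), no mass is lost in the limit, and a solution exists. If the
  pseudo-balayage has mass at least one, the segment from the minimizer over measures of mass at most
  one to the pseudo-balayage contains a unit measure, which is a solution. If the capacity is infinite
  and the mass of the pseudo-balayage is smaller than one, the missing mass can be added far away at
  arbitrarily small cost (\<open>no_solution\<close>). The infimum over unit measures then equals the global
  minimum, which is attained by the pseudo-balayage only, and that is not a unit measure. Finally, a
  pseudo-balayage of mass one is itself the solution, and the only one by uniqueness.
\<close>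

section \<open>Radon measures on a locally compact space with a countable base\<close>

locale lc_space =
  fixes X :: "'a::{t2_space, second_countable_topology} itself"
  assumes lc: "locally_compact_space (euclidean :: 'a topology)"

lemma (in lc_space) compact_exhaustion:
  obtains Q :: "nat \<Rightarrow> 'a set"
  where "\<And>n. compact (Q n)" "incseq Q" "(\<Union>n. Q n) = UNIV"
    "\<And>K. compact K \<Longrightarrow> \<exists>n. K \<subseteq> interior (Q n)"
proof -
  have "\<forall>x::'a. \<exists>U K. open U \<and> compact K \<and> x \<in> U \<and> U \<subseteq> K"
    using lc unfolding locally_compact_space_def by auto
  then obtain U K where UK: "\<And>x::'a. open (U x)" "\<And>x. compact (K x)" "\<And>x. x \<in> U x" "\<And>x. U x \<subseteq> K x"
    by metis
  obtain F where F: "F \<subseteq> range U" "countable F" "\<Union>F = \<Union>(range U)"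
    using Lindelof[of "range U"] UK(1) by blast
  have cov: "\<Union>F = UNIV" using F(3) UK(3) by auto
  then have "F \<noteq> {}" by auto
  then obtain s :: "nat \<Rightarrow> 'a set" where s: "range s = F" using F(2) by (metis range_from_nat_into)
  have "\<forall>i. \<exists>x. s i = U x" using s F(1) by blast
  then obtain x where x: "\<And>i. s i = U (x i)" by metis
  define Q where "Q n = (\<Union>i\<le>n. K (x i))" for n
  have 1: "compact (Q n)" for n unfolding Q_def by (intro compact_UN) (auto intro: UK)
  have 2: "incseq Q" unfolding Q_def by (fastforce simp: incseq_def)
  have 3: "\<exists>n. L \<subseteq> interior (Q n)" if L: "compact L" for L
  proof -
    have "L \<subseteq> (\<Union>i\<in>UNIV. s i)" using cov s by auto
    moreover have "\<And>i. open (s i)" by (simp add: x UK)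
    ultimately obtain I where I: "finite I" "L \<subseteq> (\<Union>i\<in>I. s i)"
      using compactE_image[OF L, of UNIV s] by auto
    obtain n where n: "\<forall>i\<in>I. i \<le> n" using I(1) finite_nat_set_iff_bounded_le by auto
    have "(\<Union>i\<in>I. s i) \<subseteq> interior (Q n)"
    proof (rule interior_maximal)
      show "(\<Union>i\<in>I. s i) \<subseteq> Q n" using n UK(4) unfolding Q_def x by fastforce
      show "open (\<Union>i\<in>I. s i)" by (auto simp: x UK)
    qed
    with I(2) show ?thesis by auto
  qed
  have 4: "(\<Union>n. Q n) = UNIV"
  proof -
    have "y \<in> (\<Union>n. Q n)" for y
      using 3[of "{y}"] interior_subset by fastforce
    then show ?thesis by auto
  qed
  show thesis using that[OF 1 2 4 3] .
qed

abbreviation mass :: "'a measure \<Rightarrow> ennreal" where "mass M \<equiv> emeasure M UNIV"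

lemma radon_sets [simp]: "radon_measure M \<Longrightarrow> sets M = sets borel"
  and radon_compact_finite: "radon_measure M \<Longrightarrow> compact K \<Longrightarrow> emeasure M K < \<infinity>"
  and radon_inner: "radon_measure M \<Longrightarrow> B \<in> sets borel \<Longrightarrow>
        emeasure M B = (SUP K\<in>{K. compact K \<and> K \<subseteq> B}. emeasure M K)"
  by (auto simp: radon_measure_def)

lemma radon_space [simp]: "radon_measure M \<Longrightarrow> space M = UNIV"
  using sets_eq_imp_space_eq[of M borel] by simp

lemma radon_measurable_cong: "radon_measure M \<Longrightarrow> measurable M N = measurable borel N"
  by (rule measurable_cong_sets) auto

lemma compact_borel [measurable]: "compact K \<Longrightarrow> K \<in> sets borel" for K :: "'a::t2_space set"
  by (simp add: compact_imp_closed)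

lemma radon_inner_approx:
  assumes "radon_measure M" "B \<in> sets borel" "c < emeasure M B"
  obtains K where "compact K" "K \<subseteq> B" "c < emeasure M K"
  using assms(3) unfolding radon_inner[OF assms(1,2)] less_SUP_iff by blast

lemma (in lc_space) radon_sigma_finite:
  fixes M :: "'a measure"
  assumes M: "radon_measure M"
  shows "sigma_finite_measure M"
proof -
  obtain Q :: "nat \<Rightarrow> 'a set" where Q: "\<And>n. compact (Q n)" "(\<Union>n. Q n) = UNIV"
    using compact_exhaustion by metis
  show ?thesis
    by standard (use Q M radon_compact_finite[OF M] in
      \<open>auto intro!: exI[of _ "range Q"] simp: less_top[symmetric]\<close>)
qed

lemma radon_null_measure: "radon_measure (null_measure borel)"
proof -
  have "(SUP K\<in>{K. compact K \<and> K \<subseteq> B}. 0::ennreal) = 0" for B :: "'a set"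
    by (rule SUP_eq_const) (auto intro!: exI[of _ "{}"])
  then show ?thesis unfolding radon_measure_def by simp
qed

text \<open>Unite compact sets that realize the supremum in inner regularity.\<close>

lemma radon_sigma_compact_core:
  fixes M :: "'a::t2_space measure"
  assumes M: "radon_measure M" and B: "B \<in> sets borel" and fin: "emeasure M B < \<infinity>"
  obtains K :: "nat \<Rightarrow> 'a set" where "\<And>n. compact (K n)" "\<And>n. K n \<subseteq> B" "incseq K"
    "emeasure M (B - (\<Union>n. K n)) = 0"
proof -
  have ne: "{K. compact K \<and> K \<subseteq> B} \<noteq> {}" by (auto intro!: exI[of _ "{}"])
  obtain f where f: "range f \<subseteq> emeasure M ` {K. compact K \<and> K \<subseteq> B}"
     "(SUP K\<in>{K. compact K \<and> K \<subseteq> B}. emeasure M K) = (SUP i::nat. f i)"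
    using ennreal_Sup_countable_SUP[of "emeasure M ` {K. compact K \<and> K \<subseteq> B}"] ne by auto
  have "\<forall>i. \<exists>K. compact K \<and> K \<subseteq> B \<and> f i = emeasure M K" using f(1) by blast
  then obtain L where L: "\<And>i. compact (L i)" "\<And>i. L i \<subseteq> B" "\<And>i. f i = emeasure M (L i)" by metis
  define K where "K n = (\<Union>i\<le>n. L i)" for n
  have cK: "compact (K n)" for n unfolding K_def by (intro compact_UN) (auto intro: L)
  have KB: "K n \<subseteq> B" for n unfolding K_def using L by auto
  have inc: "incseq K" unfolding K_def by (fastforce simp: incseq_def)
  have Um: "(\<Union>n. K n) \<in> sets M" using cK M by auto
  have le: "emeasure M B \<le> emeasure M (\<Union>n. K n)"
  proof -
    have "emeasure M B = (SUP i. emeasure M (L i))" using radon_inner[OF M B] f(2) L(3) by simp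
    also have "\<dots> \<le> emeasure M (\<Union>n. K n)"
      by (intro SUP_least emeasure_mono Um) (auto simp: K_def)
    finally show ?thesis .
  qed
  have sub: "(\<Union>n. K n) \<subseteq> B" using KB by auto
  have "emeasure M (B - (\<Union>n. K n)) = emeasure M B - emeasure M (\<Union>n. K n)"
  proof (rule emeasure_Diff)
    show "emeasure M (\<Union>n. K n) \<noteq> \<infinity>"
      using order.strict_trans1[OF emeasure_mono[OF sub, of M] fin] B M by simp
  qed (use Um B M sub in auto)
  also have "\<dots> = 0" using le by (simp add: diff_eq_0_iff_ennreal fin[simplified infinity_ennreal_def])
  finally show thesis using that cK KB inc by blast
qed

lemma emeasure_exhaust:
  fixes B :: "'a::t2_space set"
  assumes "sets M = sets borel" "B \<in> sets borel" "\<And>n. compact (Q n)" "incseq Q" "(\<Union>n. Q n) = UNIV"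
  shows "emeasure M B = (SUP n. emeasure M (B \<inter> Q n))"
proof -
  have "(\<Union>n. B \<inter> Q n) = B" using assms(5) by auto
  moreover have "(SUP n. emeasure M (B \<inter> Q n)) = emeasure M (\<Union>n. B \<inter> Q n)"
  proof (rule SUP_emeasure_incseq)
    show "range (\<lambda>n. B \<inter> Q n) \<subseteq> sets M" using assms(1-3) by auto
    show "incseq (\<lambda>n. B \<inter> Q n)" using assms(4) unfolding incseq_def by blast
  qed
  ultimately show ?thesis by simp
qed

text \<open>A \<open>\<sigma>\<close>-compact core of a set for \<open>M\<close> omits only an \<open>N\<close>-null set, so inner
  regularity is inherited. This makes restrictions, densities and multiples of Radon measures Radon.\<close>

lemma (in lc_space) radon_absolutely_continuous:
  fixes M N :: "'a measure"
  assumes M: "radon_measure M" and N: "sets N = sets borel" "\<And>K. compact K \<Longrightarrow> emeasure N K < \<infinity>"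
    and ac: "absolutely_continuous M N"
  shows "radon_measure N"
  unfolding radon_measure_def
proof (intro conjI allI impI ballI)
  fix B :: "'a set" assume B: "B \<in> sets borel"
  obtain Q :: "nat \<Rightarrow> 'a set" where Q: "\<And>n. compact (Q n)" "incseq Q" "(\<Union>n. Q n) = UNIV"
    using compact_exhaustion by metis
  show "emeasure N B = (SUP K\<in>{K. compact K \<and> K \<subseteq> B}. emeasure N K)" (is "_ = ?S")
  proof (rule antisym)
    have "emeasure N B = (SUP n. emeasure N (B \<inter> Q n))" by (rule emeasure_exhaust[OF N(1) B Q])
    also have "\<dots> \<le> ?S"
    proof (rule SUP_least)
      fix n
      have "emeasure M (B \<inter> Q n) < \<infinity>"
        using emeasure_mono[of "B \<inter> Q n" "Q n" M] radon_compact_finite[OF M Q(1)[of n]] Q M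
        by (auto simp: order.strict_trans1)
      then obtain K where K: "\<And>n. compact (K n)" "\<And>i. K i \<subseteq> B \<inter> Q n" "incseq K"
        "emeasure M (B \<inter> Q n - (\<Union>n. K n)) = 0"
        using radon_sigma_compact_core[OF M, of "B \<inter> Q n"] B Q by auto
      have s: "B \<inter> Q n - (\<Union>n. K n) \<in> sets borel" using B Q K by auto
      then have "B \<inter> Q n - (\<Union>n. K n) \<in> null_sets N"
        using ac K(4) M unfolding absolutely_continuous_def by (auto simp: null_sets_def)
      then have z: "emeasure N (B \<inter> Q n - (\<Union>n. K n)) = 0" by auto
      have rK: "range K \<subseteq> sets N" using K N by auto
      have UK: "(\<Union>n. K n) \<in> sets N" using K N by auto
      have "emeasure N (B \<inter> Q n) \<le> emeasure N ((B \<inter> Q n - (\<Union>n. K n)) \<union> (\<Union>n. K n))"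
        by (rule emeasure_mono, fast) (use s UK N in \<open>simp del: Un_Diff_cancel2\<close>)
      also have "\<dots> \<le> emeasure N (B \<inter> Q n - (\<Union>n. K n)) + emeasure N (\<Union>n. K n)"
        by (rule emeasure_subadditive) (use s UK N in simp_all)
      also have "\<dots> = (SUP i. emeasure N (K i))"
        using z SUP_emeasure_incseq[OF rK K(3)] by simp
      also have "\<dots> \<le> ?S"
        by (rule SUP_least, rule SUP_upper) (use K in auto)
      finally show "emeasure N (B \<inter> Q n) \<le> ?S" .
    qed
    finally show "emeasure N B \<le> ?S" .
    show "?S \<le> emeasure N B"
      by (rule SUP_least, rule emeasure_mono) (use B N in auto)
  qed
qed (use N in auto)

lemma (in lc_space) radon_density:
  fixes M :: "'a measure"
  assumes M: "radon_measure M" and g: "g \<in> borel_measurable borel"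
    and fin: "\<And>K. compact K \<Longrightarrow> emeasure (density M g) K < \<infinity>"
  shows "radon_measure (density M g)"
proof (rule radon_absolutely_continuous[OF M _ fin])
  show "absolutely_continuous M (density M g)"
    using g M by (intro absolutely_continuousI_density) (simp add: radon_measurable_cong)
qed (use M in auto)

abbreviation restr :: "'a measure \<Rightarrow> 'a set \<Rightarrow> 'a measure" where
  "restr M B \<equiv> density M (indicator B)"

lemma (in lc_space) radon_restrict:
  fixes M :: "'a measure"
  assumes M: "radon_measure M" and B: "B \<in> sets borel"
  shows "radon_measure (restr M B)"
proof (rule radon_density[OF M])
  fix K :: "'a set" assume K: "compact K"
  have "emeasure (restr M B) K = emeasure M (B \<inter> K)"
    using K B M by (simp add: emeasure_restricted)
  also have "\<dots> \<le> emeasure M K" by (rule emeasure_mono) (use K B M in auto)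
  also have "\<dots> < \<infinity>" by (rule radon_compact_finite[OF M K])
  finally show "emeasure (restr M B) K < \<infinity>" .
qed (use B in auto)

lemma (in lc_space) radon_scale:
  fixes M :: "'a measure"
  assumes M: "radon_measure M" and r: "r < \<infinity>"
  shows "radon_measure (scale_measure r M)"
proof (rule radon_absolutely_continuous[OF M])
  show "absolutely_continuous M (scale_measure r M)"
    by (auto simp: absolutely_continuous_def null_sets_def)
qed (use M r radon_compact_finite[OF M] in \<open>auto simp: ennreal_mult_less_top\<close>)

definition add_measure :: "'a::topological_space measure \<Rightarrow> 'a measure \<Rightarrow> 'a measure" where
  "add_measure M N = measure_of UNIV (sets borel) (\<lambda>B. emeasure M B + emeasure N B)"

lemma sets_add_measure [simp, measurable_cong]: "sets (add_measure M N) = sets borel"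
  and space_add_measure [simp]: "space (add_measure M N) = UNIV"
  using sets.space_closed[of borel] sets.sigma_sets_eq[of borel]
  by (auto simp: add_measure_def sets_measure_of space_measure_of)

lemma total_variation_eq: "total_variation \<mu> = add_measure (pos_part \<mu>) (neg_part \<mu>)"
  by (simp add: total_variation_def add_measure_def)

lemma emeasure_add_measure:
  assumes "sets M = sets borel" "sets N = sets borel"
  shows "emeasure (add_measure M N) B = emeasure M B + emeasure N B"
proof (cases "B \<in> sets borel")
  case True
  show ?thesis
    unfolding add_measure_def
  proof (rule emeasure_measure_of_sigma)
    show "sigma_algebra UNIV (sets borel)" using sets.sigma_algebra_axioms[of borel] by simp
    show "positive (sets borel) (\<lambda>B. emeasure M B + emeasure N B)" by (simp add: positive_def)
    show "countably_additive (sets borel) (\<lambda>B. emeasure M B + emeasure N B)"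
    proof (rule countably_additiveI)
      fix A :: "nat \<Rightarrow> 'a set"
      assume A: "range A \<subseteq> sets borel" "disjoint_family A"
      have "(\<Sum>i. emeasure M (A i) + emeasure N (A i)) = (\<Sum>i. emeasure M (A i)) + (\<Sum>i. emeasure N (A i))"
        by (rule suminf_add[symmetric]) auto
      then show "(\<Sum>i. emeasure M (A i) + emeasure N (A i)) = emeasure M (\<Union>i. A i) + emeasure N (\<Union>i. A i)"
        using A assms by (simp add: suminf_emeasure)
    qed
  qed (fact True)
next
  case False then show ?thesis using assms by (simp add: emeasure_notin_sets)
qed

lemma nn_integral_add_measure:
  assumes s: "sets M = sets borel" "sets N = sets borel" and f: "f \<in> borel_measurable borel"
  shows "(\<integral>\<^sup>+x. f x \<partial>add_measure M N) = (\<integral>\<^sup>+x. f x \<partial>M) + (\<integral>\<^sup>+x. f x \<partial>N)"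
proof -
  have mM: "\<And>g::'a\<Rightarrow>ennreal. g \<in> borel_measurable borel \<Longrightarrow> g \<in> borel_measurable M"
   and mN: "\<And>g::'a\<Rightarrow>ennreal. g \<in> borel_measurable borel \<Longrightarrow> g \<in> borel_measurable N"
   and mA: "\<And>g::'a\<Rightarrow>ennreal. g \<in> borel_measurable borel \<Longrightarrow> g \<in> borel_measurable (add_measure M N)"
    using s by (auto simp: measurable_cong_sets[OF s(1) refl] measurable_cong_sets[OF s(2) refl]
        measurable_cong_sets[OF sets_add_measure refl])
  show ?thesis
    using f
  proof (induction rule: borel_measurable_induct)
    case (cong f g)
    then have "f = g" by (auto simp: fun_eq_iff)
    with cong show ?case by simp
  next
    case (set A)
    then show ?case using s by (simp add: emeasure_add_measure)
  next
    case (mult u v)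
    then show ?case by (simp add: nn_integral_cmult mM mN mA distrib_left)
  next
    case (add u v)
    then show ?case by (simp add: nn_integral_add mM mN mA ac_simps)
  next
    case (seq U)
    have inc: "incseq (\<lambda>i. \<integral>\<^sup>+x. U i x \<partial>K)" for K
      using seq by (auto simp: incseq_def le_fun_def intro!: nn_integral_mono)
    have S: "(\<integral>\<^sup>+x. (SUP i. U i) x \<partial>K) = (SUP i. \<integral>\<^sup>+x. U i x \<partial>K)"
      if "sets K = sets borel" for K
    proof -
      have "(\<integral>\<^sup>+x. (SUP i. U i x) \<partial>K) = (SUP i. \<integral>\<^sup>+x. U i x \<partial>K)"
        by (rule nn_integral_monotone_convergence_SUP)
          (use seq that in \<open>auto simp: measurable_cong_sets[OF that refl]\<close>)
      then show ?thesis by (simp add: image_comp)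
    qed
    show ?case
      unfolding seq(4) S[OF s(1)] S[OF s(2)] S[OF sets_add_measure] using seq by (simp add: ennreal_SUP_add inc)
  qed
qed

lemma radon_add:
  assumes M: "radon_measure (M :: 'a::t2_space measure)" and N: "radon_measure N"
  shows "radon_measure (add_measure M N)"
  unfolding radon_measure_def
proof (intro conjI allI impI ballI)
  have e: "emeasure (add_measure M N) B = emeasure M B + emeasure N B" for B
    using M N by (simp add: emeasure_add_measure)
  show "emeasure (add_measure M N) K < \<infinity>" if "compact K" for K
    using that by (simp add: e radon_compact_finite[OF M, simplified] radon_compact_finite[OF N, simplified])
  fix B :: "'a set" assume B: "B \<in> sets borel"
  let ?K = "{K. compact K \<and> K \<subseteq> B}"
  have "emeasure (add_measure M N) B = (SUP K\<in>?K. emeasure M K) + (SUP K\<in>?K. emeasure N K)"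
    unfolding e radon_inner[OF M B] radon_inner[OF N B] ..
  also have "\<dots> = (SUP K\<in>?K. emeasure M K + emeasure N K)"
  proof (rule SUP_add_directed_ennreal[symmetric])
    fix K L assume KL: "K \<in> ?K" "L \<in> ?K"
    have "emeasure M K + emeasure N L \<le> emeasure M (K \<union> L) + emeasure N (K \<union> L)"
      by (intro add_mono emeasure_mono) (use KL M N in auto)
    moreover have "K \<union> L \<in> ?K" using KL by auto
    ultimately show "\<exists>L'\<in>?K. emeasure M K + emeasure N L \<le> emeasure M L' + emeasure N L'" by blast
  qed
  finally show "emeasure (add_measure M N) B = (SUP K\<in>?K. emeasure (add_measure M N) K)" unfolding e .
qed simp

section \<open>Differences of Radon measures\<close>

lemma add_measure_commute:
  assumes "sets M = sets borel" "sets N = sets borel"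
  shows "add_measure M N = add_measure N M"
  by (rule measure_eqI) (auto simp: emeasure_add_measure assms add.commute)

lemma add_measure_null:
  assumes "sets M = sets borel"
  shows "add_measure M (null_measure borel) = M" "add_measure (null_measure borel) M = M"
proof -
  show "add_measure M (null_measure borel) = M"
    by (rule measure_eqI) (use assms in \<open>simp_all add: emeasure_add_measure\<close>)
  show "add_measure (null_measure borel) M = M"
    by (rule measure_eqI) (use assms in \<open>simp_all add: emeasure_add_measure\<close>)
qed

lemma (in lc_space) add_measure_cancel:
  fixes R :: "'a measure"
  assumes R: "radon_measure R"
    and M: "sets M = sets borel" and N: "sets N = sets borel"
    and eq: "add_measure M R = add_measure N R"
  shows "M = N"
proof (rule measure_eqI)
  fix B assume "B \<in> sets M"
  then have B: "B \<in> sets borel" using M by simp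
  obtain Q :: "nat \<Rightarrow> 'a set" where Q: "\<And>n. compact (Q n)" "incseq Q" "(\<Union>n. Q n) = UNIV"
    using compact_exhaustion by metis
  have "emeasure M (B \<inter> Q n) = emeasure N (B \<inter> Q n)" for n
  proof -
    have "emeasure R (B \<inter> Q n) \<le> emeasure R (Q n)" by (rule emeasure_mono) (use Q R in auto)
    also have "\<dots> < \<infinity>" by (rule radon_compact_finite[OF R Q(1)])
    finally have "emeasure R (B \<inter> Q n) \<noteq> \<infinity>" by simp
    moreover have "emeasure M (B \<inter> Q n) + emeasure R (B \<inter> Q n) = emeasure N (B \<inter> Q n) + emeasure R (B \<inter> Q n)"
      using arg_cong[OF eq, of "\<lambda>m. emeasure m (B \<inter> Q n)"] M N R by (simp add: emeasure_add_measure)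
    ultimately show ?thesis
      by (metis ennreal_add_left_cancel add.commute infinity_ennreal_def)
  qed
  then show "emeasure M B = emeasure N B"
    unfolding emeasure_exhaust[OF M B Q] emeasure_exhaust[OF N B Q] by simp
qed (use M N in simp)

text \<open>With the densities \<open>p, q\<close> of \<open>a, b\<close> with respect to \<open>a + b\<close>, the truncated differences
  \<open>p - q\<close> and \<open>q - p\<close> give the Jordan parts of \<open>a - b\<close>, and \<open>min p q\<close> the common part.\<close>

lemma (in lc_space) radon_jordan:
  fixes a b :: "'a measure"
  assumes a: "radon_measure a" and b: "radon_measure b"
  obtains s t r where "radon_measure s" "radon_measure t" "radon_measure r" "mutually_singular s t"
    "a = add_measure s r" "b = add_measure t r"
proof -
  define T where "T = add_measure a b"
  have T: "radon_measure T" unfolding T_def by (rule radon_add[OF a b])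
  interpret T: sigma_finite_measure T by (rule radon_sigma_finite[OF T])
  have Te: "emeasure T B = emeasure a B + emeasure b B" for B
    unfolding T_def using a b by (simp add: emeasure_add_measure)
  have ac: "absolutely_continuous T a" "absolutely_continuous T b"
    using a b T by (auto simp: absolutely_continuous_def null_sets_def Te)
  define p where "p = RN_deriv T a"
  define q where "q = RN_deriv T b"
  have pm: "p \<in> borel_measurable borel" and qm: "q \<in> borel_measurable borel"
    unfolding p_def q_def using borel_measurable_RN_deriv[of T] T by (auto simp: radon_measurable_cong)
  note [measurable] = pm qm
  have da: "density T p = a" and db: "density T q = b"
    unfolding p_def q_def using T a b by (auto intro!: T.density_RN_deriv ac)
  have fin: "AE x in T. p x \<noteq> \<infinity>"
    unfolding p_def by (rule T.RN_deriv_finite[OF radon_sigma_finite[OF a] ac(1)]) (use a T in simp)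
  have ed: "emeasure (density T g) B = (\<integral>\<^sup>+x. g x * indicator B x \<partial>T)"
    if "B \<in> sets borel" "g \<in> borel_measurable borel" for B g
    using that T by (simp add: emeasure_density radon_measurable_cong)
  have rd: "radon_measure (density T g)"
    if g: "g \<in> borel_measurable borel" and le: "\<And>x. g x \<le> p x \<or> g x \<le> q x" for g
  proof (rule radon_density[OF T g])
    fix K :: "'a set" assume K: "compact K"
    have "emeasure (density T g) K \<le> (\<integral>\<^sup>+x. p x * indicator K x + q x * indicator K x \<partial>T)"
      unfolding ed[OF compact_borel[OF K] g]
    proof (rule nn_integral_mono)
      fix x show "g x * indicator K x \<le> p x * indicator K x + q x * indicator K x"
        using le[of x] by (auto split: split_indicator intro: add_increasing add_increasing2)
    qed
    also have "\<dots> = emeasure a K + emeasure b K"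
      using K T by (subst nn_integral_add) (auto simp: ed[symmetric] da db radon_measurable_cong)
    also have "\<dots> < \<infinity>" using radon_compact_finite[OF a K] radon_compact_finite[OF b K] by simp
    finally show "emeasure (density T g) K < \<infinity>" .
  qed
  define s where "s = density T (\<lambda>x. p x - q x)"
  define t where "t = density T (\<lambda>x. q x - p x)"
  define r where "r = density T (\<lambda>x. min (p x) (q x))"
  have str: "radon_measure s" "radon_measure t" "radon_measure r"
    unfolding s_def t_def r_def by (auto intro!: rd simp: diff_le_self_ennreal min_le_iff_disj)
  have split: "(u - v) + min u v = u" for u v :: ennreal
  proof (cases "u \<le> v")
    case True
    show ?thesis
    proof (cases "u = top")
      case False
      then have "u - v = 0" using True by (simp add: diff_eq_0_iff_ennreal less_top)
      then show ?thesis using True by (simp add: min_def)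
    qed (use True in \<open>simp add: top_unique\<close>)
  next
    case False
    then show ?thesis by (simp add: min_def diff_add_cancel_ennreal)
  qed
  have sums: "add_measure (density T (\<lambda>x. u x - v x)) (density T (\<lambda>x. min (u x) (v x))) = density T u"
    if [measurable]: "u \<in> borel_measurable borel" "v \<in> borel_measurable borel" for u v :: "'a \<Rightarrow> ennreal"
  proof (rule measure_eqI)
    fix B assume "B \<in> sets (add_measure (density T (\<lambda>x. u x - v x)) (density T (\<lambda>x. min (u x) (v x))))"
    then have B[measurable]: "B \<in> sets borel" by simp
    have "emeasure (add_measure (density T (\<lambda>x. u x - v x)) (density T (\<lambda>x. min (u x) (v x)))) B
      = (\<integral>\<^sup>+x. (u x - v x) * indicator B x \<partial>T) + (\<integral>\<^sup>+x. min (u x) (v x) * indicator B x \<partial>T)"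
      using T by (simp add: emeasure_add_measure ed)
    also have "\<dots> = (\<integral>\<^sup>+x. (u x - v x) * indicator B x + min (u x) (v x) * indicator B x \<partial>T)"
      using T by (subst nn_integral_add) (auto simp: radon_measurable_cong)
    also have "\<dots> = emeasure (density T u) B"
      using T by (simp add: ed distrib_right[symmetric] split)
    finally show "emeasure (add_measure (density T (\<lambda>x. u x - v x)) (density T (\<lambda>x. min (u x) (v x)))) B
      = emeasure (density T u) B" .
  qed (use T in simp)
  have A: "a = add_measure s r" unfolding s_def r_def using sums[OF pm qm] da by simp
  have B: "b = add_measure t r" unfolding t_def r_def using sums[OF qm pm] db by (simp add: min.commute)
  define S where "S = {x. p x \<le> q x \<or> p x = \<infinity>}"
  have S: "S \<in> sets borel" unfolding S_def by measurable
  have "emeasure s S = (\<integral>\<^sup>+x. (p x - q x) * indicator S x \<partial>T)"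
    unfolding s_def using S by (intro ed) auto
  also have "\<dots> = (\<integral>\<^sup>+x. 0 \<partial>T)"
  proof (rule nn_integral_cong_AE)
    show "AE x in T. (p x - q x) * indicator S x = 0"
      using fin
    proof eventually_elim
      case (elim x)
      then show ?case by (auto simp: S_def diff_eq_0_iff_ennreal less_top split: split_indicator)
    qed
  qed
  finally have "emeasure s S = 0" by simp
  moreover have "emeasure t (- S) = 0"
  proof -
    have "emeasure t (- S) = (\<integral>\<^sup>+x. (q x - p x) * indicator (- S) x \<partial>T)"
      unfolding t_def using S by (intro ed) auto
    also have "\<dots> = (\<integral>\<^sup>+x. 0 \<partial>T)"
    proof (rule nn_integral_cong)
      fix x
      have "q x - p x = 0" if "\<not> p x \<le> q x"
      proof -
        have "q x < top" using that by (metis less_top top_greatest)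
        then show ?thesis using that by (simp add: diff_eq_0_iff_ennreal)
      qed
      then show "(q x - p x) * indicator (- S) x = 0" by (auto simp: S_def split: split_indicator)
    qed
    finally show ?thesis by simp
  qed
  ultimately have "mutually_singular s t" unfolding mutually_singular_def using S by auto
  with that A B str show thesis by blast
qed

lemma mutually_singular_commute: "mutually_singular P N \<Longrightarrow> mutually_singular N P"
  unfolding mutually_singular_def by (metis double_complement borel_comp)

text \<open>Where \<open>s\<close> lives \<open>t\<close> vanishes, so there \<open>s \<le> s + t' = s' + t = s'\<close>; hence a Jordan
  decomposition is the smallest representation as a difference.\<close>

lemma mutually_singular_minimal:
  assumes s: "sets s = sets borel" "sets t = sets borel" "sets s' = sets borel" "sets t' = sets borel"
    and st: "mutually_singular s t" and eq: "add_measure s t' = add_measure s' t"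
    and B: "B \<in> sets borel"
  shows "emeasure s B \<le> emeasure s' B"
proof -
  obtain S where S: "S \<in> sets borel" "emeasure s S = 0" "emeasure t (- S) = 0"
    using st unfolding mutually_singular_def by auto
  let ?B = "B - S"
  have "emeasure s B \<le> emeasure s (?B \<union> S)" by (rule emeasure_mono) (use B S s in auto)
  also have "\<dots> \<le> emeasure s ?B + emeasure s S" by (rule emeasure_subadditive) (use B S s in auto)
  also have "\<dots> \<le> emeasure s ?B + emeasure t' ?B" using S by simp
  also have "\<dots> = emeasure s' ?B + emeasure t ?B"
    using arg_cong[OF eq, of "\<lambda>m. emeasure m ?B"] s by (simp add: emeasure_add_measure)
  also have "emeasure t ?B = 0"
    using emeasure_mono[of ?B "- S" t] S s B by auto
  also have "emeasure s' ?B + 0 \<le> emeasure s' B" by (simp, rule emeasure_mono) (use B s in auto)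
  finally show ?thesis .
qed

lemma jordan_unique:
  assumes s: "sets s = sets borel" "sets t = sets borel" "sets s' = sets borel" "sets t' = sets borel"
    and st: "mutually_singular s t" "mutually_singular s' t'"
    and eq: "add_measure s t' = add_measure s' t"
  shows "s = s'" "t = t'"
proof -
  have eq': "add_measure t s' = add_measure t' s"
    using eq s by (simp add: add_measure_commute)
  show "s = s'"
    using mutually_singular_minimal[OF s st(1) eq]
      mutually_singular_minimal[OF s(3,4,1,2) st(2) eq[symmetric]] s
    by (intro measure_eqI antisym) auto
  show "t = t'"
    using mutually_singular_minimal[OF s(2,1,4,3) mutually_singular_commute[OF st(1)] eq']
      mutually_singular_minimal[OF s(4,3,2,1) mutually_singular_commute[OF st(2)] eq'[symmetric]] s
    by (intro measure_eqI antisym) auto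
qed

lemma signed_radonD:
  assumes "signed_radon \<mu>"
  shows "radon_measure (pos_part \<mu>)" "radon_measure (neg_part \<mu>)" "mutually_singular (pos_part \<mu>) (neg_part \<mu>)"
  using assms by (auto simp: signed_radon_def)

lemma signed_radon_of_positive: "radon_measure M \<Longrightarrow> signed_radon (of_positive M)"
  unfolding signed_radon_def of_positive_def mutually_singular_def
  by (auto simp: radon_null_measure intro!: bexI[of _ "{}"])

lemma of_positive_simps [simp]:
  "pos_part (of_positive M) = M" "neg_part (of_positive M) = null_measure borel"
  by (auto simp: of_positive_def)

text \<open>By the minimality of Jordan decompositions the description of \<open>signed_diff\<close> determines it: its
  defining equation contains the common part \<open>r\<close> on both sides, which cancels although \<open>r\<close> may
  be infinite, since it is finite on compact sets.\<close>

lemma (in lc_space) signed_diff_jordan: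
  fixes \<mu> \<nu> :: "'a signed_measure"
  assumes \<mu>: "signed_radon \<mu>" and \<nu>: "signed_radon \<nu>"
  obtains s t r where "radon_measure s" "radon_measure t" "radon_measure r" "mutually_singular s t"
    "add_measure (pos_part \<mu>) (neg_part \<nu>) = add_measure s r"
    "add_measure (neg_part \<mu>) (pos_part \<nu>) = add_measure t r"
    "signed_diff \<mu> \<nu> = Signed s t"
proof -
  note M = signed_radonD[OF \<mu>] note N = signed_radonD[OF \<nu>]
  obtain s t r where str: "radon_measure s" "radon_measure t" "radon_measure r" "mutually_singular s t"
    and A: "add_measure (pos_part \<mu>) (neg_part \<nu>) = add_measure s r"
    and B: "add_measure (neg_part \<mu>) (pos_part \<nu>) = add_measure t r"
    by (rule radon_jordan[OF radon_add[OF M(1) N(2)] radon_add[OF M(2) N(1)]])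
  have eA: "emeasure (pos_part \<mu>) C + emeasure (neg_part \<nu>) C = emeasure s C + emeasure r C" for C
    using arg_cong[OF A, of "\<lambda>m. emeasure m C"] M N str by (simp add: emeasure_add_measure)
  have eB: "emeasure (neg_part \<mu>) C + emeasure (pos_part \<nu>) C = emeasure t C + emeasure r C" for C
    using arg_cong[OF B, of "\<lambda>m. emeasure m C"] M N str by (simp add: emeasure_add_measure)
  have "signed_diff \<mu> \<nu> = Signed s t"
    unfolding signed_diff_def add.assoc eA eB
  proof (rule the_equality)
    show "signed_radon (Signed s t) \<and> (\<forall>C\<in>sets borel.
        emeasure (pos_part (Signed s t)) C + (emeasure t C + emeasure r C) =
        emeasure (neg_part (Signed s t)) C + (emeasure s C + emeasure r C))"
      using str by (auto simp: signed_radon_def ac_simps)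
  next
    fix \<sigma> assume \<sigma>: "signed_radon \<sigma> \<and> (\<forall>C\<in>sets borel.
        emeasure (pos_part \<sigma>) C + (emeasure t C + emeasure r C) =
        emeasure (neg_part \<sigma>) C + (emeasure s C + emeasure r C))"
    then have S: "radon_measure (pos_part \<sigma>)" "radon_measure (neg_part \<sigma>)" "mutually_singular (pos_part \<sigma>) (neg_part \<sigma>)"
      by (auto simp: signed_radon_def)
    have "add_measure (add_measure (pos_part \<sigma>) t) r = add_measure (add_measure s (neg_part \<sigma>)) r"
      by (rule measure_eqI) (use \<sigma> S str in \<open>auto simp: emeasure_add_measure ac_simps\<close>)
    then have "add_measure (pos_part \<sigma>) t = add_measure s (neg_part \<sigma>)"
      by (rule add_measure_cancel[OF str(3), rotated 2]) auto
    from jordan_unique[OF _ _ _ _ S(3) str(4) this] show "\<sigma> = Signed s t"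
      using S str by (cases \<sigma>) auto
  qed
  with str A B that show thesis by blast
qed

section \<open>Restriction, concentration and vague convergence\<close>

lemma emeasure_restrict:
  assumes "radon_measure M" "B \<in> sets borel" "C \<in> sets borel"
  shows "emeasure (restr M B) C = emeasure M (B \<inter> C)"
  using assms by (simp add: emeasure_restricted)

lemma nn_integral_restrict:
  assumes "radon_measure M" "B \<in> sets borel" "g \<in> borel_measurable borel"
  shows "(\<integral>\<^sup>+x. g x \<partial>restr M B) = (\<integral>\<^sup>+x. indicator B x * g x \<partial>M)"
  using assms by (subst nn_integral_density) (auto simp: radon_measurable_cong)

lemma restrict_split:
  assumes M: "radon_measure M" and B: "B \<in> sets borel"
  shows "M = add_measure (restr M B) (restr M (- B))"
proof (rule measure_eqI)
  fix C assume "C \<in> sets M"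
  then have C: "C \<in> sets borel" using M by simp
  have "emeasure M C = emeasure M (B \<inter> C) + emeasure M (- B \<inter> C)"
    using plus_emeasure[of "B \<inter> C" M "- B \<inter> C"] B C M
    by (auto simp: Int_Un_distrib2[symmetric] Un_Int_distrib2[symmetric])
  then show "emeasure M C = emeasure (add_measure (restr M B) (restr M (- B))) C"
    using M B C by (simp add: emeasure_add_measure emeasure_restrict)
qed (use M in simp)

lemma concentrated_on_UNIV [simp]: "concentrated_on M UNIV"
  unfolding concentrated_on_def by (auto intro!: bexI[of _ "{}"])

lemma concentrated_on_absolutely_continuous:
  "absolutely_continuous M N \<Longrightarrow> concentrated_on M A \<Longrightarrow> concentrated_on N A"
  unfolding concentrated_on_def absolutely_continuous_def by blast

lemma concentrated_on_restrict:
  assumes "radon_measure M" "B \<in> sets borel" "concentrated_on M A"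
  shows "concentrated_on (restr M B) A"
  using assms by (intro concentrated_on_absolutely_continuous[OF absolutely_continuousI_density])
    (auto simp: radon_measurable_cong)

lemma concentrated_on_scale: "concentrated_on M A \<Longrightarrow> concentrated_on (scale_measure r M) A"
  by (rule concentrated_on_absolutely_continuous) (auto simp: absolutely_continuous_def null_sets_def)

lemma concentrated_on_add:
  assumes s: "sets M = sets borel" "sets N = sets borel" and "concentrated_on M A" "concentrated_on N A"
  shows "concentrated_on (add_measure M N) A"
proof -
  obtain Z W where Z: "Z \<in> null_sets M" "- A \<subseteq> Z" and W: "W \<in> null_sets N" "- A \<subseteq> W"
    using assms(3,4) unfolding concentrated_on_def by auto
  have b: "Z \<in> sets borel" "W \<in> sets borel" using Z W s by auto
  have "emeasure M (Z \<inter> W) = 0" "emeasure N (Z \<inter> W) = 0"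
    using emeasure_mono[of "Z \<inter> W" Z M] emeasure_mono[of "Z \<inter> W" W N] null_setsD1[OF Z(1)] null_setsD1[OF W(1)]
      null_setsD2[OF Z(1)] null_setsD2[OF W(1)] by auto
  then have "Z \<inter> W \<in> null_sets (add_measure M N)"
    using b s by (auto simp: null_sets_def emeasure_add_measure)
  moreover have "- A \<subseteq> Z \<inter> W" using Z(2) W(2) by (rule Int_greatest)
  ultimately show ?thesis unfolding concentrated_on_def by (rule bexI[rotated])
qed

lemma concentrated_on_mono: "concentrated_on M A \<Longrightarrow> A \<subseteq> B \<Longrightarrow> concentrated_on M B"
  unfolding concentrated_on_def by blast

lemma concentrated_on_borel:
  assumes "sets M = sets borel" "B \<in> sets borel"
  shows "concentrated_on M B \<longleftrightarrow> emeasure M (- B) = 0"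
  using assms unfolding concentrated_on_def
  by (metis (no_types, lifting) borel_comp emeasure_eq_0 null_setsD1 null_setsD2 null_setsI subset_refl)

lemma concentrated_mass:
  assumes "radon_measure M" "B \<in> sets borel" "concentrated_on M B"
  shows "mass M = emeasure M B"
  using assms emeasure_Un_null_set[of B M "- B"] by (simp add: concentrated_on_borel null_sets_def)

lemma concentrated_on_null: "concentrated_on (null_measure borel) (A :: 'a::topological_space set)"
  unfolding concentrated_on_def by (auto intro!: bexI[of _ UNIV] simp: null_sets_def)

lemma concentrated_on_AE:
  assumes "concentrated_on M A"
  shows "AE x in M. x \<in> A"
  using assms unfolding concentrated_on_def by (auto simp: eventually_ae_filter)

text \<open>Since \<open>A\<close> need not be Borel, inner regularity has to be applied to a Borel subset of full
  measure.\<close>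

lemma concentrated_on_borel_core:
  assumes "sets M = sets borel" "concentrated_on M A"
  obtains B where "B \<in> sets borel" "B \<subseteq> A" "emeasure M (- B) = 0"
proof -
  obtain Z where Z: "Z \<in> null_sets M" "- A \<subseteq> Z" using assms(2) unfolding concentrated_on_def by auto
  have "- Z \<in> sets borel" "- Z \<subseteq> A" "emeasure M (- (- Z)) = 0" using Z assms(1) by auto
  with that show thesis by blast
qed

text \<open>The complement of the support is a union of open null sets, and countably many of them suffice.\<close>

lemma emeasure_compl_support:
  fixes M :: "'a::second_countable_topology measure"
  assumes "sets M = sets borel"
  shows "emeasure M (- measure_support M) = 0"
proof -
  let ?F = "{U. open U \<and> emeasure M U = 0}"
  have eq: "- measure_support M = \<Union>?F"
    by (auto simp: measure_support_def zero_less_iff_neq_zero)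
  obtain F where F: "F \<subseteq> ?F" "countable F" "\<Union>F = \<Union>?F"
    using Lindelof[of ?F] by auto
  have "U \<in> null_sets M" if "U \<in> F" for U using that F(1) assms by (auto simp: null_sets_def)
  then have "\<Union>F \<in> null_sets M" using F(2) null_sets_UN'[of F "\<lambda>x. x" M] by simp
  then show ?thesis using eq F(3) by auto
qed


definition vague_limit :: "(nat \<Rightarrow> 'a::topological_space measure) \<Rightarrow> 'a measure \<Rightarrow> bool" where
  "vague_limit M N \<longleftrightarrow> (\<forall>\<phi>\<in>Cc. (\<lambda>n. LINT x|M n. \<phi> x) \<longlonglongrightarrow> (LINT x|N. \<phi> x))"

lemma Cc_integrable:
  assumes M: "radon_measure (M :: 'a::t2_space measure)" and \<phi>: "\<phi> \<in> Cc"
  shows "integrable M \<phi>"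
proof -
  define S where "S = closure {x. \<phi> x \<noteq> 0}"
  have S: "compact S" and c: "continuous_on UNIV \<phi>" using \<phi> by (auto simp: Cc_def S_def)
  have m: "\<phi> \<in> borel_measurable M"
    using borel_measurable_continuous_onI[OF c] M by (simp add: radon_measurable_cong)
  have "bounded (\<phi> ` S)" by (intro compact_imp_bounded compact_continuous_image S continuous_on_subset[OF c]) auto
  then obtain C where C: "\<And>x. x \<in> S \<Longrightarrow> norm (\<phi> x) \<le> C" by (auto simp: bounded_iff)
  have z: "x \<notin> S \<Longrightarrow> \<phi> x = 0" for x unfolding S_def using closure_subset[of "{x. \<phi> x \<noteq> 0}"] by auto
  show ?thesis
  proof (rule Bochner_Integration.integrable_bound[where f = "\<lambda>x. C * indicator S x"])
    show "integrable M (\<lambda>x. C * indicator S x)"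
      using radon_compact_finite[OF M S] M S
      by (intro integrable_mult_right) (auto simp: integrable_indicator_iff)
    show "AE x in M. norm (\<phi> x) \<le> norm (C * indicator S x :: real)"
      using C z by (auto intro!: AE_I2 split: split_indicator) (smt (verit) C real_norm_def)
  qed (fact m)
qed

lemma Hausdorff_space_t2: "Hausdorff_space (euclidean :: 'a::t2_space topology)"
  unfolding Hausdorff_space_def disjnt_def using hausdorff by simp blast

lemma (in lc_space) Urysohn_Cc:
  fixes K :: "'a set"
  assumes K: "compact K" and G: "open G" "K \<subseteq> G"
  obtains \<phi> where "\<phi> \<in> Cc" "\<And>x. 0 \<le> \<phi> x" "\<And>x. indicator K x \<le> \<phi> x" "\<And>x. \<phi> x \<le> indicator G x"
proof -
  obtain Q :: "nat \<Rightarrow> 'a set" where Q: "\<And>n. compact (Q n)" "\<And>K. compact K \<Longrightarrow> \<exists>n. K \<subseteq> interior (Q n)"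
    using compact_exhaustion by metis
  obtain n where n: "K \<subseteq> interior (Q n)" using Q(2)[OF K] by auto
  define V where "V = G \<inter> interior (Q n)"
  have V: "open V" "K \<subseteq> V" using n G by (auto simp: V_def)
  have cr: "completely_regular_space (euclidean :: 'a topology)"
    using lc by (intro locally_compact_regular_imp_completely_regular_space) (simp_all add: Hausdorff_space_t2)
  obtain f where f: "continuous_map euclidean (subtopology euclidean {0..1::real}) f" "f ` K \<subseteq> {1}" "f ` (- V) \<subseteq> {0}"
  proof (rule Urysohn_completely_regular_compact_closed[of 0 1 "euclidean :: 'a topology" K "- V"])
  qed (use that cr K V in \<open>auto simp: disjnt_def\<close>)
  show thesis
  proof (rule that[of f])
    have c: "continuous_on UNIV f" using f(1) by (simp add: continuous_map_in_subtopology)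
    have sub: "{x. f x \<noteq> 0} \<subseteq> Q n" using f(3) interior_subset[of "Q n"] by (auto simp: V_def)
    have "compact (closure {x. f x \<noteq> 0})"
      using closure_minimal[OF sub compact_imp_closed[OF Q(1)]] Q(1)[of n]
      by (metis closed_closure compact_Int_closed inf.absorb_iff2)
    then show "f \<in> Cc" using c by (simp add: Cc_def)
    show "0 \<le> f x" "indicator K x \<le> f x" "f x \<le> indicator G x" for x
      using f by (auto simp: continuous_map_in_subtopology V_def image_subset_iff split: split_indicator)
  qed
qed

text \<open>Inside a relatively compact open neighbourhood, compact sets that exhaust the rest of the
  neighbourhood are cut away.\<close>

lemma (in lc_space) radon_outer_compact:
  fixes M :: "'a measure"
  assumes M: "radon_measure M"
    and K: "compact K" and c: "emeasure M K < c"
  obtains G where "open G" "K \<subseteq> G" "emeasure M G < c"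
proof -
  obtain Q :: "nat \<Rightarrow> 'a set" where Q: "\<And>n. compact (Q n)" "\<And>K. compact K \<Longrightarrow> \<exists>n. K \<subseteq> interior (Q n)"
    using compact_exhaustion by metis
  obtain n where n: "K \<subseteq> interior (Q n)" using Q(2)[OF K] by auto
  let ?V = "interior (Q n)"
  have Vf: "emeasure M ?V < \<infinity>"
    using emeasure_mono[of ?V "Q n" M] interior_subset[of "Q n"] radon_compact_finite[OF M Q(1)[of n]] M Q(1)[of n]
    by (auto simp: order.strict_trans1)
  have fin: "emeasure M B < \<infinity>" if "B \<subseteq> ?V" for B
    using emeasure_mono[OF that, of M] Vf M by (auto simp: order.strict_trans1)
  obtain L :: "nat \<Rightarrow> 'a set" where L: "\<And>n. compact (L n)" "\<And>i. L i \<subseteq> ?V - K" "incseq L"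
    "emeasure M ((?V - K) - (\<Union>n. L n)) = 0"
    using radon_sigma_compact_core[OF M, of "?V - K"] fin[of "?V - K"] K by auto
  have mL: "L i \<in> sets M" for i using L(1)[of i] M by auto
  have "(INF i. emeasure M (?V - L i)) = emeasure M (\<Inter>i. ?V - L i)"
  proof (rule INF_emeasure_decseq)
    show "range (\<lambda>i. ?V - L i) \<subseteq> sets M" using mL M by auto
    show "decseq (\<lambda>i. ?V - L i)" using L(3) by (fastforce simp: decseq_def incseq_def)
    show "emeasure M (?V - L i) \<noteq> \<infinity>" for i using fin[of "?V - L i"] by auto
  qed
  also have "\<dots> \<le> emeasure M (K \<union> ((?V - K) - (\<Union>n. L n)))"
    by (rule emeasure_mono) (use M mL K in \<open>auto intro!: sets.Un sets.Diff\<close>)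
  also have "\<dots> \<le> emeasure M K + emeasure M ((?V - K) - (\<Union>n. L n))"
    by (rule emeasure_subadditive) (use M mL K in \<open>auto intro!: sets.Un sets.Diff\<close>)
  also have "\<dots> = emeasure M K" using L(4) by simp
  also have "\<dots> < c" by (rule c)
  finally obtain i where i: "emeasure M (?V - L i) < c" unfolding INF_less_iff by auto
  have "open (?V - L i)" using L(1) by (intro open_Diff) (auto intro: compact_imp_closed)
  moreover have "K \<subseteq> ?V - L i" using n L(2) by blast
  ultimately show thesis using that i by blast
qed

lemma nn_integral_Cc:
  assumes "radon_measure (M :: 'a::t2_space measure)" "\<phi> \<in> Cc" "\<And>x. 0 \<le> \<phi> x"
  shows "(\<integral>\<^sup>+x. ennreal (\<phi> x) \<partial>M) = ennreal (LINT x|M. \<phi> x)"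
  using assms by (intro nn_integral_eq_integral Cc_integrable) auto

text \<open>The two halves of the portmanteau theorem, by squeezing a function of compact support between
  a compact set and an open set containing it.\<close>

lemma (in lc_space)
  fixes M :: "nat \<Rightarrow> 'a measure"
  assumes M: "\<And>n. radon_measure (M n)"
    and N: "radon_measure N" and v: "vague_limit M N"
  shows vague_limit_open: "open G \<Longrightarrow> c < emeasure N G \<Longrightarrow> eventually (\<lambda>n. c < emeasure (M n) G) sequentially"
    and vague_limit_compact: "compact K \<Longrightarrow> emeasure N K < c \<Longrightarrow> eventually (\<lambda>n. emeasure (M n) K < c) sequentially"
proof -
  have low: "emeasure R K \<le> ennreal (LINT x|R. \<phi> x)" and upp: "ennreal (LINT x|R. \<phi> x) \<le> emeasure R G"
    if R: "radon_measure R" and K: "compact K" and G: "open G" and \<phi>: "\<phi> \<in> Cc" "\<And>x. 0 \<le> \<phi> x"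
      "\<And>x. indicator K x \<le> \<phi> x" "\<And>x. \<phi> x \<le> indicator G x" for \<phi> :: "'a \<Rightarrow> real" and K G R
  proof -
    have "emeasure R K = (\<integral>\<^sup>+x. indicator K x \<partial>R)" using R K by simp
    also have "\<dots> \<le> (\<integral>\<^sup>+x. ennreal (\<phi> x) \<partial>R)"
    proof (rule nn_integral_mono)
      fix x show "indicator K x \<le> ennreal (\<phi> x)"
        using \<phi>(3)[of x] by (auto split: split_indicator simp: one_ennreal_def[symmetric] simp flip: ennreal_1)
    qed
    finally show "emeasure R K \<le> ennreal (LINT x|R. \<phi> x)" using nn_integral_Cc[OF R \<phi>(1,2)] by simp
    have "(\<integral>\<^sup>+x. ennreal (\<phi> x) \<partial>R) \<le> (\<integral>\<^sup>+x. indicator G x \<partial>R)"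
    proof (rule nn_integral_mono)
      fix x show "ennreal (\<phi> x) \<le> indicator G x"
        using \<phi>(4)[of x] \<phi>(2)[of x] by (auto split: split_indicator simp flip: ennreal_1)
    qed
    also have "\<dots> = emeasure R G" using R G by simp
    finally show "ennreal (LINT x|R. \<phi> x) \<le> emeasure R G" using nn_integral_Cc[OF R \<phi>(1,2)] by simp
  qed
  have lim: "(\<lambda>n. ennreal (LINT x|M n. \<phi> x)) \<longlonglongrightarrow> ennreal (LINT x|N. \<phi> x)" if "\<phi> \<in> Cc" for \<phi>
    using v that unfolding vague_limit_def by (intro tendsto_ennrealI) auto
  show "eventually (\<lambda>n. c < emeasure (M n) G) sequentially" if G: "open G" and c: "c < emeasure N G"
  proof -
    obtain K where K: "compact K" "K \<subseteq> G" "c < emeasure N K"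
      using radon_inner_approx[OF N _ c] G by auto
    obtain \<phi> where \<phi>: "\<phi> \<in> Cc" "\<And>x. 0 \<le> \<phi> x" "\<And>x. indicator K x \<le> \<phi> x" "\<And>x. \<phi> x \<le> indicator G x"
      using Urysohn_Cc[OF K(1) G K(2)] by blast
    have "c < ennreal (LINT x|N. \<phi> x)" using low[OF N K(1) G \<phi>] K(3) by simp
    from order_tendstoD(1)[OF lim[OF \<phi>(1)] this]
    show ?thesis by (rule eventually_mono) (erule order.strict_trans2[OF _ upp[OF M K(1) G \<phi>]])
  qed
  show "eventually (\<lambda>n. emeasure (M n) K < c) sequentially" if K: "compact K" and c: "emeasure N K < c"
  proof -
    obtain G where G: "open G" "K \<subseteq> G" "emeasure N G < c"
      by (rule radon_outer_compact[OF N K c])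
    obtain \<phi> where \<phi>: "\<phi> \<in> Cc" "\<And>x. 0 \<le> \<phi> x" "\<And>x. indicator K x \<le> \<phi> x" "\<And>x. \<phi> x \<le> indicator G x"
      using Urysohn_Cc[OF K G(1,2)] by blast
    have "ennreal (LINT x|N. \<phi> x) < c" using upp[OF N K G(1) \<phi>] G(3) by simp
    from order_tendstoD(2)[OF lim[OF \<phi>(1)] this]
    show ?thesis by (rule eventually_mono) (erule order.strict_trans1[OF low[OF M K G(1) \<phi>]])
  qed
qed

section \<open>The energy form of a perfect kernel\<close>

locale perfect_kernel_space = lc_space "TYPE('a)"
  for \<kappa> :: "'a::{t2_space, second_countable_topology} \<times> 'a \<Rightarrow> ennreal" +
  assumes perfect: "perfect_kernel \<kappa>"
begin

abbreviation I :: "'a measure \<Rightarrow> 'a measure \<Rightarrow> ennreal" where "I \<equiv> mutual_energy \<kappa>"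
abbreviation U :: "'a measure \<Rightarrow> 'a \<Rightarrow> ennreal" where "U \<equiv> potential \<kappa>"

abbreviation cone :: "'a set \<Rightarrow> 'a measure set" where "cone \<equiv> energy_cone \<kappa>"
abbreviation E :: "'a measure set" where "E \<equiv> energy_cone \<kappa> UNIV"

lemma kernel_sym: "\<kappa> (x, y) = \<kappa> (y, x)"
  using perfect by (simp add: perfect_kernel_def kernel_def)

lemma kernel_measurable: "\<kappa> \<in> borel_measurable borel"
  using perfect by (intro borel_measurableI_greater)
    (auto simp: perfect_kernel_def kernel_def lower_semicontinuous_def)

lemma kernel_measurable_pair:
  assumes "radon_measure M" "radon_measure N"
  shows "\<kappa> \<in> borel_measurable (M \<Otimes>\<^sub>M N)"
proof -
  have "sets (M \<Otimes>\<^sub>M N) = sets (borel \<Otimes>\<^sub>M borel :: ('a \<times> 'a) measure)"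
    by (rule sets_pair_measure_cong) (use assms in auto)
  then have "sets (M \<Otimes>\<^sub>M N) = sets (borel :: ('a \<times> 'a) measure)" unfolding borel_prod .
  from measurable_cong_sets[OF this refl] show ?thesis using kernel_measurable by auto
qed

lemma kernel_measurable_section: "(\<lambda>y. \<kappa> (x, y)) \<in> borel_measurable borel"
proof -
  have "continuous_on UNIV (\<lambda>y::'a. (x, y))" by (intro continuous_intros)
  from measurable_compose[OF borel_measurable_continuous_onI[OF this] kernel_measurable] show ?thesis .
qed

text \<open>Potentials inherit lower semicontinuity from the kernel by Fatou's lemma; sequences suffice in a
  first countable space.\<close>

lemma potential_superlevel_open:
  assumes M: "radon_measure M"
  shows "open {x. t < U M x}"
proof -
  have "closure (- {x. t < U M x}) \<subseteq> - {x. t < U M x}"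
  proof
    fix x assume "x \<in> closure (- {x. t < U M x})"
    then obtain u where u: "\<And>n. U M (u n) \<le> t" "u \<longlonglongrightarrow> x"
      unfolding closure_sequential by (auto simp: not_less)
    have lim: "\<kappa> (x, y) \<le> liminf (\<lambda>n. \<kappa> (u n, y))" for y
      unfolding le_Liminf_iff
    proof (intro allI impI)
      fix c assume c: "c < \<kappa> (x, y)"
      have "open {p. c < \<kappa> p}"
        using perfect by (simp add: perfect_kernel_def kernel_def lower_semicontinuous_def)
      moreover have "(\<lambda>n. (u n, y)) \<longlonglongrightarrow> (x, y)" by (intro tendsto_Pair u tendsto_const)
      ultimately show "eventually (\<lambda>n. c < \<kappa> (u n, y)) sequentially"
        using topological_tendstoD[of "\<lambda>n. (u n, y)" "(x, y)" sequentially "{p. c < \<kappa> p}"] c by simp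
    qed
    have "U M x \<le> (\<integral>\<^sup>+y. liminf (\<lambda>n. \<kappa> (u n, y)) \<partial>M)"
      unfolding potential_def by (rule nn_integral_mono) (rule lim)
    also have "\<dots> \<le> liminf (\<lambda>n. U M (u n))"
      unfolding potential_def
      by (rule nn_integral_liminf) (use kernel_measurable_section M in \<open>simp add: radon_measurable_cong\<close>)
    also have "\<dots> \<le> liminf (\<lambda>n. t)" by (rule Liminf_mono) (simp add: u)
    also have "\<dots> = t" by (simp add: Liminf_const)
    finally show "x \<in> - {x. t < U M x}" by simp
  qed
  then have "closed (- {x. t < U M x})" by (simp add: closure_subset_eq)
  then show ?thesis by (simp add: open_closed)
qed

lemma potential_measurable [measurable]: "radon_measure M \<Longrightarrow> U M \<in> borel_measurable borel"
  by (intro borel_measurableI_greater) (simp add: potential_superlevel_open)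

lemma mutual_energy_potential:
  assumes M: "radon_measure M" and N: "radon_measure N"
  shows "I M N = (\<integral>\<^sup>+x. U N x \<partial>M)"
proof -
  interpret sigma_finite_measure N by (rule radon_sigma_finite[OF N])
  show ?thesis unfolding mutual_energy_def potential_def
    by (rule nn_integral_fst[OF kernel_measurable_pair[OF M N], symmetric])
qed

lemma mutual_energy_commute:
  assumes M: "radon_measure M" and N: "radon_measure N"
  shows "I M N = I N M"
proof -
  interpret M: sigma_finite_measure M by (rule radon_sigma_finite[OF M])
  interpret N: sigma_finite_measure N by (rule radon_sigma_finite[OF N])
  interpret pair_sigma_finite M N ..
  have "I M N = (\<integral>\<^sup>+y. \<integral>\<^sup>+x. \<kappa> (x, y) \<partial>M \<partial>N)"
    unfolding mutual_energy_def by (rule nn_integral_snd[symmetric]) (use kernel_measurable_pair[OF M N] in simp)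
  also have "\<dots> = (\<integral>\<^sup>+y. U M y \<partial>N)" unfolding potential_def by (simp add: kernel_sym[of _ ])
  finally show ?thesis unfolding mutual_energy_potential[OF N M] .
qed

lemma potential_add:
  assumes "radon_measure M" "radon_measure N"
  shows "U (add_measure M N) x = U M x + U N x"
  unfolding potential_def using assms kernel_measurable_section by (intro nn_integral_add_measure) auto

lemma mutual_energy_add:
  assumes "radon_measure M" "radon_measure N" "radon_measure R"
  shows "I (add_measure M N) R = I M R + I N R"
    "I R (add_measure M N) = I R M + I R N"
proof -
  show 1: "I (add_measure M N) R = I M R + I N R"
    using assms by (simp add: mutual_energy_potential radon_add nn_integral_add_measure potential_measurable)
  then show "I R (add_measure M N) = I R M + I R N"
    using assms by (simp add: mutual_energy_commute[of R] radon_add)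
qed

lemma mutual_energy_scale:
  assumes "radon_measure M" "radon_measure R" "r < \<infinity>"
  shows "I (scale_measure r M) R = r * I M R"
    "I R (scale_measure r M) = r * I R M"
proof -
  note rs = radon_scale[OF assms(1,3)]
  show 1: "I (scale_measure r M) R = r * I M R"
    unfolding mutual_energy_potential[OF rs assms(2)] mutual_energy_potential[OF assms(1,2)]
    by (rule nn_integral_scale_measure) (use assms potential_measurable in \<open>simp add: radon_measurable_cong\<close>)
  then show "I R (scale_measure r M) = r * I R M"
    using mutual_energy_commute[OF assms(2) rs] mutual_energy_commute[OF assms(2,1)] by simp
qed

lemma cone_radon: "M \<in> cone A \<Longrightarrow> radon_measure M"
  and cone_energy: "M \<in> cone A \<Longrightarrow> energy \<kappa> M < \<infinity>"
  and cone_concentrated: "M \<in> cone A \<Longrightarrow> concentrated_on M A"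
  and cone_E: "M \<in> cone A \<Longrightarrow> M \<in> E"
  by (auto simp: energy_cone_def)

lemma E_radon: "M \<in> E \<Longrightarrow> radon_measure M"
  and E_sets: "M \<in> E \<Longrightarrow> sets M = sets borel"
  by (auto simp: energy_cone_def)

lemma cone_mono: "M \<in> cone A \<Longrightarrow> A \<subseteq> B \<Longrightarrow> M \<in> cone B"
  by (auto simp: energy_cone_def intro: concentrated_on_mono)

lemma cone_summand:
  assumes "add_measure M N \<in> E" "radon_measure M" "radon_measure N"
  shows "M \<in> E" "N \<in> E"
  using assms cone_energy[OF assms(1)]
  by (auto simp: energy_cone_def mutual_energy_add radon_add)

lemma cone_restrict:
  assumes M: "M \<in> cone A" and B: "B \<in> sets borel"
  shows "restr M B \<in> cone A"
proof -
  have r: "radon_measure (restr M B)" "radon_measure (restr M (- B))"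
    using radon_restrict[OF cone_radon[OF M]] B by auto
  have "add_measure (restr M B) (restr M (- B)) \<in> E"
    using restrict_split[OF cone_radon[OF M] B] cone_E[OF M] by simp
  from cone_summand(1)[OF this r] show ?thesis
    using concentrated_on_restrict[OF cone_radon[OF M] B cone_concentrated[OF M]] r
    by (auto simp: energy_cone_def)
qed

lemma cone_scale:
  assumes M: "M \<in> cone A" and r: "r < \<infinity>"
  shows "scale_measure r M \<in> cone A"
  using M radon_scale[OF cone_radon[OF M] r] r concentrated_on_scale[of M A r]
  by (simp add: energy_cone_def mutual_energy_scale ennreal_mult_less_top)

lemma cone_null: "null_measure borel \<in> cone A"
proof -
  have "I (null_measure borel) (null_measure borel) = 0"
    by (simp add: mutual_energy_potential radon_null_measure nn_integral_null_measure)
  then show ?thesis by (simp add: energy_cone_def radon_null_measure concentrated_on_null)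
qed

lemma jordan_cone:
  assumes M: "M \<in> E" and N: "N \<in> E"
  obtains s t r where "s \<in> E" "t \<in> E" "r \<in> E" "mutually_singular s t"
    "M = add_measure s r" "N = add_measure t r"
proof -
  obtain s t r where str: "radon_measure s" "radon_measure t" "radon_measure r" "mutually_singular s t"
    and MN: "M = add_measure s r" "N = add_measure t r"
    by (rule radon_jordan[OF cone_radon[OF M] cone_radon[OF N]])
  have "s \<in> E" "r \<in> E" "t \<in> E"
    using cone_summand[of s r] cone_summand[of t r] M N MN str by auto
  with str MN that show thesis by blast
qed

lemma singular_energy:
  assumes s: "s \<in> E" and t: "t \<in> E" and st: "mutually_singular s t"
  shows "I s t < \<infinity>"
    "0 \<le> signed_mutual_energy \<kappa> (Signed s t) (Signed s t)"
    "signed_mutual_energy \<kappa> (Signed s t) (Signed s t) = 0 \<Longrightarrow> Signed s t = zero_signed"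
proof -
  let ?s = "Signed s t"
  let ?m = "signed_mutual_energy \<kappa> ?s ?s" and ?p = "signed_energy_pos \<kappa> ?s ?s" and ?n = "signed_energy_neg \<kappa> ?s ?s"
  have sr: "signed_radon (Signed s t)" using s t st by (simp add: signed_radon_def E_radon E_sets)
  have d: "?p < \<infinity>"
    using cone_energy[OF s] cone_energy[OF t] by (simp add: signed_energy_pos_def)
  then have "signed_energy_defined \<kappa> (Signed s t) (Signed s t)" by (simp add: signed_energy_defined_def)
  then have pd: "0 \<le> ?m"
    "?m = 0 \<Longrightarrow> Signed s t = zero_signed"
    using perfect sr unfolding perfect_kernel_def strictly_positive_definite_def by auto
  then show "0 \<le> ?m"
    "?m = 0 \<Longrightarrow> Signed s t = zero_signed" by auto
  have "?n \<noteq> \<infinity>"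
  proof
    assume "?n = \<infinity>"
    then have "?m = - \<infinity>"
      using d unfolding signed_mutual_energy_def
      by (cases "?p") (auto simp: enn2ereal_ennreal)
    with pd(1) show False by simp
  qed
  then show "I s t < \<infinity>" by (simp add: signed_energy_neg_def less_top[symmetric])
qed

text \<open>Positive definiteness forces mutual energies to be finite: for the Jordan parts \<open>s, t\<close> of
  \<open>M - N\<close> the nonnegativity of \<open>I(s - t)\<close> bounds \<open>I(s, t)\<close>, and the part common to
  \<open>M\<close> and \<open>N\<close> is dominated by either of them.\<close>

lemma mutual_energy_finite:
  assumes M: "M \<in> E" and N: "N \<in> E"
  shows "I M N < \<infinity>"
proof -
  obtain s t r where str: "s \<in> E" "t \<in> E" "r \<in> E" "mutually_singular s t"
    and MN: "M = add_measure s r" "N = add_measure t r"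
    by (rule jordan_cone[OF M N])
  note rad = cone_radon[OF str(1)] cone_radon[OF str(2)] cone_radon[OF str(3)]
  have "I s r < \<infinity>" "I t r < \<infinity>"
    using cone_energy[OF M] cone_energy[OF N] rad unfolding MN by (auto simp: mutual_energy_add radon_add)
  then show ?thesis
    using singular_energy(1)[OF str(1,2,4)] cone_energy[OF str(3)] rad unfolding MN
    by (simp add: mutual_energy_add radon_add mutual_energy_commute[of r t])
qed

lemma cone_add:
  assumes "M \<in> cone A" "N \<in> cone A"
  shows "add_measure M N \<in> cone A"
  using assms mutual_energy_finite[OF cone_E[OF assms(1)] cone_E[OF assms(2)]]
    mutual_energy_finite[OF cone_E[OF assms(2)] cone_E[OF assms(1)]]
  by (simp add: energy_cone_def radon_add mutual_energy_add concentrated_on_add)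

definition e :: "'a measure \<Rightarrow> 'a measure \<Rightarrow> real" where
  "e M N = enn2real (I M N)"

lemma ennreal_e: "M \<in> E \<Longrightarrow> N \<in> E \<Longrightarrow> ennreal (e M N) = I M N"
  unfolding e_def using mutual_energy_finite[of M N] by simp

lemma e_nonneg [simp]: "0 \<le> e M N" by (simp add: e_def)

lemma e_commute: "M \<in> E \<Longrightarrow> N \<in> E \<Longrightarrow> e M N = e N M"
  unfolding e_def by (simp add: mutual_energy_commute[OF cone_radon cone_radon])

lemma e_add:
  assumes "M \<in> E" "N \<in> E" "R \<in> E"
  shows "e (add_measure M N) R = e M R + e N R" "e R (add_measure M N) = e R M + e R N"
  unfolding e_def using assms
  by (auto simp: mutual_energy_add[OF cone_radon cone_radon cone_radon] enn2real_plus mutual_energy_finite[simplified])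

lemma e_scale:
  assumes "M \<in> E" "R \<in> E" "0 \<le> r"
  shows "e (scale_measure (ennreal r) M) R = r * e M R" "e R (scale_measure (ennreal r) M) = r * e R M"
  unfolding e_def using assms
  by (auto simp: mutual_energy_scale[OF cone_radon cone_radon] enn2real_mult)

lemma e_null: "M \<in> E \<Longrightarrow> e M (null_measure borel) = 0" "M \<in> E \<Longrightarrow> e (null_measure borel) M = 0"
  unfolding e_def by (auto simp: mutual_energy_commute[OF cone_radon radon_null_measure]
      mutual_energy_potential[OF radon_null_measure cone_radon] nn_integral_null_measure)

lemma e_restrict_le:
  assumes M: "M \<in> E" and B: "B \<in> sets borel"
  shows "e (restr M B) (restr M B) \<le> e M M"
proof -
  let ?b = "restr M B" and ?c = "restr M (- B)"
  have bc: "?b \<in> E" "?c \<in> E" using B by (auto intro!: cone_restrict[OF M])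
  have "e M M = e (add_measure ?b ?c) (add_measure ?b ?c)" using restrict_split[OF E_radon[OF M] B] by simp
  also have "\<dots> \<ge> e ?b ?b" using bc by (simp add: e_add cone_add)
  finally show ?thesis .
qed

text \<open>The squared norm of the difference of two positive measures.\<close>

definition D2 :: "'a measure \<Rightarrow> 'a measure \<Rightarrow> real" where
  "D2 M N = e M M + e N N - 2 * e M N"

text \<open>A common summand drops out, so \<open>D2\<close> computes the energy of the Jordan decomposition.\<close>

lemma D2_common:
  assumes "s \<in> E" "t \<in> E" "r \<in> E"
  shows "D2 (add_measure s r) (add_measure t r) = D2 s t"
  using assms unfolding D2_def
  by (simp add: e_add cone_add e_commute[of r s] e_commute[of t s] e_commute[of r t])

lemma signed_energy_D2:
  assumes "s \<in> E" "t \<in> E"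
  shows "signed_mutual_energy \<kappa> (Signed s t) (Signed s t) = ereal (D2 s t)"
proof -
  have "signed_energy_pos \<kappa> (Signed s t) (Signed s t) = ennreal (e s s + e t t)"
    using assms by (simp add: signed_energy_pos_def ennreal_e[symmetric])
  moreover have "signed_energy_neg \<kappa> (Signed s t) (Signed s t) = ennreal (2 * e s t)"
    using assms by (simp add: signed_energy_neg_def ennreal_e[symmetric] e_commute[of t s] flip: ennreal_plus)
  ultimately show ?thesis by (simp add: signed_mutual_energy_def enn2ereal_ennreal D2_def del: ennreal_plus)
qed

lemma D2_nonneg:
  assumes M: "M \<in> E" and N: "N \<in> E"
  shows "0 \<le> D2 M N"
proof -
  obtain s t r where str: "s \<in> E" "t \<in> E" "r \<in> E" "mutually_singular s t"
    and MN: "M = add_measure s r" "N = add_measure t r"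
    by (rule jordan_cone[OF M N])
  show ?thesis using singular_energy(2)[OF str(1,2,4)] signed_energy_D2[OF str(1,2)] D2_common[OF str(1-3)] MN
    by simp
qed

lemma D2_eq_0:
  assumes M: "M \<in> E" and N: "N \<in> E" and z: "D2 M N = 0"
  shows "M = N"
proof -
  obtain s t r where str: "s \<in> E" "t \<in> E" "r \<in> E" "mutually_singular s t"
    and MN: "M = add_measure s r" "N = add_measure t r"
    by (rule jordan_cone[OF M N])
  have "Signed s t = zero_signed"
    using singular_energy(3)[OF str(1,2,4)] signed_energy_D2[OF str(1,2)] D2_common[OF str(1-3)] MN z
    by (simp add: zero_ereal_def)
  then have "s = t" by (simp add: zero_signed_def of_positive_def)
  then show ?thesis using MN by simp
qed

lemma D2_commute: "M \<in> E \<Longrightarrow> N \<in> E \<Longrightarrow> D2 M N = D2 N M"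
  by (simp add: D2_def e_commute)

lemma D2_add:
  assumes E: "a \<in> E" "b \<in> E" "c \<in> E" "d \<in> E"
  shows "D2 (add_measure a c) (add_measure b d) = D2 a b + 2 * (e a c + e b d - e a d - e b c) + D2 c d"
  unfolding D2_def using E
  by (simp add: e_add cone_add e_commute[of c a] e_commute[of d b] e_commute[of c b] e_commute[of d a]
      e_commute[of b a] e_commute[of d c])

text \<open>The bilinear form on differences \<open>a - b\<close> and \<open>c - d\<close> is nonnegative, so the usual
  discriminant argument applies; a negative multiple of \<open>c - d\<close> is a positive one of
  \<open>d - c\<close>.\<close>

lemma Cauchy_Schwarz_E:
  assumes E: "a \<in> E" "b \<in> E" "c \<in> E" "d \<in> E"
  shows "\<bar>e a c + e b d - e a d - e b c\<bar> \<le> sqrt (D2 a b) * sqrt (D2 c d)"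
proof -
  define B where "B = e a c + e b d - e a d - e b c"
  let ?p = "D2 a b" and ?q = "D2 c d"
  have quad: "0 \<le> ?p + 2 * t * (e a u + e b v - e a v - e b u) + t\<^sup>2 * D2 u v"
    if uv: "u \<in> E" "v \<in> E" and t: "0 \<le> t" for t u v
  proof -
    let ?u = "scale_measure (ennreal t) u" and ?v = "scale_measure (ennreal t) v"
    have sE: "?u \<in> E" "?v \<in> E" using uv by (auto intro!: cone_scale)
    have "0 \<le> D2 (add_measure a ?u) (add_measure b ?v)" by (intro D2_nonneg cone_add E sE)
    also have "\<dots> = ?p + 2 * t * (e a u + e b v - e a v - e b u) + t\<^sup>2 * D2 u v"
      unfolding D2_add[OF E(1,2) sE] unfolding D2_def using E uv t sE
      by (simp add: e_scale algebra_simps power2_eq_square)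
    finally show ?thesis .
  qed
  have pos: "0 \<le> ?p + 2 * t * B + t\<^sup>2 * ?q" and neg: "0 \<le> ?p - 2 * t * B + t\<^sup>2 * ?q" if "0 \<le> t" for t
    using quad[OF E(3,4) that] quad[OF E(4,3) that] D2_commute[OF E(3,4)]
    by (simp_all add: B_def algebra_simps)
  have p: "0 \<le> ?p" and q: "0 \<le> ?q" using D2_nonneg E by auto
  have key: "2 * t * \<bar>B\<bar> \<le> ?p + t\<^sup>2 * ?q" if "0 \<le> t" for t
    using pos[OF that] neg[OF that] by (cases "B \<ge> 0") (auto simp: abs_if)
  have "\<bar>B\<bar>\<^sup>2 \<le> ?p * ?q"
  proof (cases "?q = 0")
    case False
    then have q: "?q > 0" using q by simp
    from key[of "\<bar>B\<bar> / ?q"] q have "2 * (\<bar>B\<bar> / ?q) * \<bar>B\<bar> \<le> ?p + (\<bar>B\<bar> / ?q)\<^sup>2 * ?q" by simp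
    then show ?thesis using q by (simp add: field_simps power2_eq_square)
  next
    case True
    have "\<bar>B\<bar> = 0"
    proof (rule ccontr)
      assume "\<bar>B\<bar> \<noteq> 0"
      then have "\<bar>B\<bar> > 0" by simp
      with key[of "(?p + 1) / (2 * \<bar>B\<bar>)"] True p show False by (simp add: field_simps)
    qed
    then show ?thesis using True by simp
  qed
  then have "\<bar>B\<bar> \<le> sqrt (?p * ?q)" by (simp add: real_le_rsqrt)
  then show ?thesis by (simp add: real_sqrt_mult B_def)
qed

lemma e_le_norms:
  assumes "a \<in> E" "b \<in> E"
  shows "e a b \<le> sqrt (e a a) * sqrt (e b b)"
  using Cauchy_Schwarz_E[OF assms(1) cone_null assms(2) cone_null] assms
  by (simp add: D2_def e_null cone_null)

lemma D2_triangle_sum: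
  assumes E: "a \<in> E" "b \<in> E" "c \<in> E" "d \<in> E"
  shows "sqrt (D2 (add_measure a c) (add_measure b d)) \<le> sqrt (D2 a b) + sqrt (D2 c d)"
proof (rule real_le_lsqrt)
  have "D2 (add_measure a c) (add_measure b d) = D2 a b + 2 * (e a c + e b d - e a d - e b c) + D2 c d"
    by (rule D2_add[OF E])
  also have "\<dots> \<le> D2 a b + 2 * (sqrt (D2 a b) * sqrt (D2 c d)) + D2 c d"
    using Cauchy_Schwarz_E[OF E] by simp
  also have "\<dots> = (sqrt (D2 a b) + sqrt (D2 c d))\<^sup>2"
    using D2_nonneg E by (simp add: power2_sum)
  finally show "D2 (add_measure a c) (add_measure b d) \<le> (sqrt (D2 a b) + sqrt (D2 c d))\<^sup>2" .
qed (use D2_nonneg E in auto)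

lemma D2_triangle:
  assumes E: "M \<in> E" "N \<in> E" "R \<in> E"
  shows "sqrt (D2 M R) \<le> sqrt (D2 M N) + sqrt (D2 N R)"
  using D2_triangle_sum[OF E(1,2,2,3)] D2_common[OF E(1,3,2)] E
  by (simp add: add_measure_commute[of N R] E_radon E_sets)

section \<open>Strong convergence\<close>

lemma energy_spaceD:
  assumes "\<mu> \<in> energy_space \<kappa>"
  shows "signed_radon \<mu>" "pos_part \<mu> \<in> E" "neg_part \<mu> \<in> E" "mutually_singular (pos_part \<mu>) (neg_part \<mu>)"
proof -
  show sr: "signed_radon \<mu>" using assms by (simp add: energy_space_def)
  then show "mutually_singular (pos_part \<mu>) (neg_part \<mu>)" by (simp add: signed_radon_def)
  let ?p = "signed_energy_pos \<kappa> \<mu> \<mu>" and ?n = "signed_energy_neg \<kappa> \<mu> \<mu>"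
  have "?p < \<infinity> \<or> ?n < \<infinity>" "\<bar>enn2ereal ?p - enn2ereal ?n\<bar> \<noteq> \<infinity>"
    using assms by (auto simp: energy_space_def signed_energy_defined_def signed_mutual_energy_def)
  then have "?p < \<infinity>"
    by (cases ?p; cases ?n) (auto simp: enn2ereal_ennreal)
  then show "pos_part \<mu> \<in> E" "neg_part \<mu> \<in> E"
    using sr by (auto simp: energy_cone_def signed_energy_pos_def signed_radon_def)
qed

lemma energy_space_of_positive:
  assumes M: "M \<in> E"
  shows "of_positive M \<in> energy_space \<kappa>"
  using signed_energy_D2[OF M cone_null] signed_radon_of_positive[OF cone_radon[OF M]] cone_energy[OF M]
    cone_energy[OF cone_null[of UNIV]]
  by (auto simp: energy_space_def of_positive_def signed_energy_defined_def signed_energy_pos_def)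

text \<open>The difference \<open>\<mu> - \<nu>\<close> of signed measures is the difference of the positive measures
  \<open>\<mu>\<^sup>+ + \<nu>\<^sup>-\<close> and \<open>\<mu>\<^sup>- + \<nu>\<^sup>+\<close>. In this form the metric axioms follow from
  the inequalities for \<open>D2\<close>.\<close>

lemma strong_dist_eq:
  assumes \<mu>: "\<mu> \<in> energy_space \<kappa>" and \<nu>: "\<nu> \<in> energy_space \<kappa>"
  shows "strong_dist \<kappa> \<mu> \<nu> =
    sqrt (D2 (add_measure (pos_part \<mu>) (neg_part \<nu>)) (add_measure (neg_part \<mu>) (pos_part \<nu>)))"
proof -
  note M = energy_spaceD[OF \<mu>] note N = energy_spaceD[OF \<nu>]
  obtain s t r where str: "radon_measure s" "radon_measure t" "radon_measure r" "mutually_singular s t"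
    and A: "add_measure (pos_part \<mu>) (neg_part \<nu>) = add_measure s r"
    and B: "add_measure (neg_part \<mu>) (pos_part \<nu>) = add_measure t r"
    and d: "signed_diff \<mu> \<nu> = Signed s t"
    by (rule signed_diff_jordan[OF M(1) N(1)])
  have "s \<in> E" "r \<in> E" "t \<in> E"
    using cone_summand[of s r] cone_summand[of t r] cone_add[OF M(2) N(3)] cone_add[OF M(3) N(2)] A B str by auto
  then show ?thesis
    unfolding A B by (simp add: strong_dist_def \<mu> \<nu> d energy_norm_def signed_energy_D2 D2_common)
qed

lemma strong_dist_of_positive:
  assumes "M \<in> E" "N \<in> E"
  shows "strong_dist \<kappa> (of_positive M) (of_positive N) = sqrt (D2 M N)"
  using assms by (simp add: strong_dist_eq energy_space_of_positive add_measure_null E_radon E_sets)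

lemma Metric_space_strong: "Metric_space (energy_space \<kappa>) (strong_dist \<kappa>)"
proof
  show "0 \<le> strong_dist \<kappa> \<mu> \<nu>" for \<mu> \<nu>
  proof (cases "\<mu> \<in> energy_space \<kappa> \<and> \<nu> \<in> energy_space \<kappa>")
    case True
    then show ?thesis by (auto simp: strong_dist_eq intro!: D2_nonneg cone_add energy_spaceD)
  qed (auto simp: strong_dist_def)
  show "strong_dist \<kappa> \<mu> \<nu> = strong_dist \<kappa> \<nu> \<mu>" for \<mu> \<nu>
  proof (cases "\<mu> \<in> energy_space \<kappa> \<and> \<nu> \<in> energy_space \<kappa>")
    case True
    then have t: "\<mu> \<in> energy_space \<kappa>" "\<nu> \<in> energy_space \<kappa>" by auto
    note M = energy_spaceD[OF t(1)] note N = energy_spaceD[OF t(2)]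
    show ?thesis unfolding strong_dist_eq[OF t] strong_dist_eq[OF t(2,1)]
      using M N by (subst D2_commute) (auto simp: cone_add add_measure_commute E_radon E_sets)
  qed (auto simp: strong_dist_def)
  show "strong_dist \<kappa> \<mu> \<nu> = 0 \<longleftrightarrow> \<mu> = \<nu>" if \<mu>: "\<mu> \<in> energy_space \<kappa>" and \<nu>: "\<nu> \<in> energy_space \<kappa>" for \<mu> \<nu>
  proof -
    note M = energy_spaceD[OF \<mu>] note N = energy_spaceD[OF \<nu>]
    show ?thesis
    proof
      assume "strong_dist \<kappa> \<mu> \<nu> = 0"
      then have "add_measure (pos_part \<mu>) (neg_part \<nu>) = add_measure (neg_part \<mu>) (pos_part \<nu>)"
        using M N by (intro D2_eq_0 cone_add) (auto simp: strong_dist_eq[OF \<mu> \<nu>])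
      then have "add_measure (pos_part \<mu>) (neg_part \<nu>) = add_measure (pos_part \<nu>) (neg_part \<mu>)"
        using M N by (simp add: add_measure_commute E_radon E_sets)
      from jordan_unique[OF _ _ _ _ M(4) N(4) this] show "\<mu> = \<nu>"
        using M N by (simp add: signed_measure.expand E_radon E_sets)
    next
      assume eq: "\<mu> = \<nu>"
      show "strong_dist \<kappa> \<mu> \<nu> = 0"
        unfolding strong_dist_eq[OF \<mu> \<nu>] unfolding eq using N
        by (simp add: add_measure_commute[of "neg_part \<nu>"] E_radon E_sets D2_def)
    qed
  qed
  show "strong_dist \<kappa> \<mu> \<rho> \<le> strong_dist \<kappa> \<mu> \<nu> + strong_dist \<kappa> \<nu> \<rho>"
    if \<mu>: "\<mu> \<in> energy_space \<kappa>" and \<nu>: "\<nu> \<in> energy_space \<kappa>" and \<rho>: "\<rho> \<in> energy_space \<kappa>" for \<mu> \<nu> \<rho>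
  proof -
    note M = energy_spaceD[OF \<mu>] note N = energy_spaceD[OF \<nu>] note R = energy_spaceD[OF \<rho>]
    let ?n = "add_measure (neg_part \<nu>) (pos_part \<nu>)"
    have 1: "add_measure (add_measure (pos_part \<mu>) (neg_part \<nu>)) (add_measure (pos_part \<nu>) (neg_part \<rho>))
      = add_measure (add_measure (pos_part \<mu>) (neg_part \<rho>)) ?n"
      using M N R by (intro measure_eqI) (auto simp: emeasure_add_measure E_radon E_sets ac_simps)
    have 2: "add_measure (add_measure (neg_part \<mu>) (pos_part \<nu>)) (add_measure (neg_part \<nu>) (pos_part \<rho>))
      = add_measure (add_measure (neg_part \<mu>) (pos_part \<rho>)) ?n"
      using M N R by (intro measure_eqI) (auto simp: emeasure_add_measure E_radon E_sets ac_simps)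
    have "strong_dist \<kappa> \<mu> \<rho> = sqrt (D2 (add_measure (add_measure (pos_part \<mu>) (neg_part \<rho>)) ?n)
        (add_measure (add_measure (neg_part \<mu>) (pos_part \<rho>)) ?n))"
      unfolding strong_dist_eq[OF \<mu> \<rho>] using M N R by (subst D2_common) (auto intro!: cone_add)
    also have "\<dots> \<le> strong_dist \<kappa> \<mu> \<nu> + strong_dist \<kappa> \<nu> \<rho>"
      unfolding 1[symmetric] 2[symmetric] strong_dist_eq[OF \<mu> \<nu>] strong_dist_eq[OF \<nu> \<rho>]
      using M N R by (intro D2_triangle_sum cone_add) auto
    finally show ?thesis .
  qed
qed

lemma Metric_space_strong_positive: "Metric_space (of_positive ` E) (strong_dist \<kappa>)"
  using Metric_space.subspace[OF Metric_space_strong, of "of_positive ` E"] energy_space_of_positive by blast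

text \<open>Strong convergence of positive measures, stated through \<open>D2\<close> so that signed differences need
  not be formed after this section.\<close>

definition strong_limit :: "(nat \<Rightarrow> 'a measure) \<Rightarrow> 'a measure \<Rightarrow> bool" where
  "strong_limit M N \<longleftrightarrow> range M \<subseteq> E \<and> N \<in> E \<and> (\<lambda>n. D2 (M n) N) \<longlonglongrightarrow> 0"

lemma strong_limitD:
  assumes "strong_limit M N"
  shows "\<And>n. M n \<in> E" "N \<in> E" "(\<lambda>n. sqrt (D2 (M n) N)) \<longlonglongrightarrow> 0"
  using assms tendsto_real_sqrt[of "\<lambda>n. D2 (M n) N" 0] by (auto simp: strong_limit_def)

text \<open>Integration of a function of compact support is a vaguely continuous functional, and consistency
  makes vaguely open sets strongly open.\<close>

lemma strong_vague:
  assumes s: "strong_limit M N"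
  shows "vague_limit M N"
  unfolding vague_limit_def
proof
  fix \<phi> :: "'a \<Rightarrow> real" assume \<phi>: "\<phi> \<in> Cc"
  interpret S: Metric_space "energy_space \<kappa>" "strong_dist \<kappa>" by (rule Metric_space_strong)
  note d = strong_limitD[OF s]
  let ?g = "\<lambda>\<mu>::'a signed_measure. (LINT x|pos_part \<mu>. \<phi> x) - (LINT x|neg_part \<mu>. \<phi> x)"
  have g: "?g (of_positive R) = (LINT x|R. \<phi> x)" for R by (simp add: integral_null_measure)
  show "(\<lambda>n. LINT x|M n. \<phi> x) \<longlonglongrightarrow> (LINT x|N. \<phi> x)"
    unfolding tendsto_iff
  proof (intro allI impI)
    fix \<epsilon> :: real assume \<epsilon>: "0 < \<epsilon>"
    let ?B = "ball (LINT x|N. \<phi> x) \<epsilon>"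
    let ?ev = "\<lambda>\<mu>::'a signed_measure. restrict (\<lambda>\<phi>. (LINT x|pos_part \<mu>. \<phi> x) - (LINT x|neg_part \<mu>. \<phi> x)) Cc"
    define V where "V = {h \<in> topspace (product_topology (\<lambda>_::'a \<Rightarrow> real. euclideanreal) Cc). h \<phi> \<in> ?B}"
    have "openin (product_topology (\<lambda>_::'a \<Rightarrow> real. euclideanreal) Cc) V"
      unfolding V_def by (rule openin_continuous_map_preimage[OF continuous_map_product_projection[OF \<phi>]]) simp
    then have "openin vague_topology (?ev -` V \<inter> {\<mu>. signed_radon \<mu>})"
      unfolding vague_topology_def openin_pullback_topology by blast
    then have "openin (subtopology vague_topology (of_positive ` E)) ((?ev -` V \<inter> {\<mu>. signed_radon \<mu>}) \<inter> of_positive ` E)"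
      by (auto simp: openin_subtopology)
    then have "openin (subtopology (strong_topology \<kappa>) (of_positive ` E)) ((?ev -` V \<inter> {\<mu>. signed_radon \<mu>}) \<inter> of_positive ` E)"
      using perfect unfolding perfect_kernel_def consistent_def Let_def by blast
    then obtain W where W: "openin S.mtopology W"
      "(?ev -` V \<inter> {\<mu>. signed_radon \<mu>}) \<inter> of_positive ` E = W \<inter> of_positive ` E"
      unfolding openin_subtopology strong_topology_def by auto
    have V: "?ev (of_positive R) \<in> V \<longleftrightarrow> dist (LINT x|R. \<phi> x) (LINT x|N. \<phi> x) < \<epsilon>" for R
      using \<phi> by (auto simp: V_def g dist_commute)
    have VW: "?ev (of_positive R) \<in> V \<longleftrightarrow> of_positive R \<in> W" if "R \<in> E" for R
      using W(2)[THEN eqset_imp_iff, of "of_positive R"] that signed_radon_of_positive[OF cone_radon[OF that]]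
      by simp
    have "of_positive N \<in> W" using VW[OF d(2)] V[of N] \<epsilon> by simp
    then obtain r where r: "r > 0" "S.mball (of_positive N) r \<subseteq> W"
      using W(1) unfolding S.openin_mtopology by blast
    have "eventually (\<lambda>n. sqrt (D2 (M n) N) < r) sequentially" using order_tendstoD(2)[OF d(3) r(1)] .
    then show "eventually (\<lambda>n. dist (LINT x|M n. \<phi> x) (LINT x|N. \<phi> x) < \<epsilon>) sequentially"
    proof eventually_elim
      case (elim n)
      have "of_positive (M n) \<in> S.mball (of_positive N) r"
        using elim d by (simp add: S.in_mball energy_space_of_positive strong_dist_of_positive D2_commute)
      then have "of_positive (M n) \<in> W" using r(2) by blast
      then show ?case using V[of "M n"] VW[OF d(1)[of n]] by simp
    qed
  qed
qed

lemma strong_complete: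
  assumes M: "\<And>n. M n \<in> E" and C: "\<And>\<epsilon>. \<epsilon> > 0 \<Longrightarrow> \<exists>n0. \<forall>m\<ge>n0. \<forall>n\<ge>n0. D2 (M m) (M n) < \<epsilon>"
  obtains N where "strong_limit M N"
proof -
  interpret S: Metric_space "of_positive ` E" "strong_dist \<kappa>" by (rule Metric_space_strong_positive)
  have "S.MCauchy (of_positive \<circ> M)"
    unfolding S.MCauchy_def
  proof (intro conjI allI impI)
    show "range (of_positive \<circ> M) \<subseteq> of_positive ` E" using M by auto
    fix \<epsilon> :: real assume "\<epsilon> > 0"
    then obtain n0 where n0: "\<forall>m\<ge>n0. \<forall>n\<ge>n0. D2 (M m) (M n) < \<epsilon>\<^sup>2" using C[of "\<epsilon>\<^sup>2"] by auto
    have "sqrt (D2 (M m) (M n)) < \<epsilon>" if "m \<ge> n0" "n \<ge> n0" for m n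
      using n0 that \<open>\<epsilon> > 0\<close> by (metis real_sqrt_abs real_sqrt_less_iff abs_of_pos)
    then show "\<exists>N. \<forall>n n'. N \<le> n \<longrightarrow> N \<le> n' \<longrightarrow> strong_dist \<kappa> ((of_positive \<circ> M) n) ((of_positive \<circ> M) n') < \<epsilon>"
      using M by (auto simp: strong_dist_of_positive intro!: exI[of _ n0])
  qed
  then obtain x where x: "limitin S.mtopology (of_positive \<circ> M) x sequentially"
    using perfect unfolding perfect_kernel_def consistent_def Let_def S.mcomplete_def by blast
  then obtain N where N: "N \<in> E" "x = of_positive N" unfolding S.limitin_metric by blast
  have "(\<lambda>n. sqrt (D2 (M n) N)) \<longlonglongrightarrow> 0"
    using x M N unfolding S.limitin_metric_dist_null by (simp add: strong_dist_of_positive)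
  from tendsto_power[OF this, of 2] have "(\<lambda>n. D2 (M n) N) \<longlonglongrightarrow> 0"
    using D2_nonneg M N by simp
  then show thesis using that[of N] M N by (auto simp: strong_limit_def)
qed

lemma strong_closed:
  assumes c: "closedin (strong_topology \<kappa>) (of_positive ` cone A)"
    and s: "strong_limit M N" and M: "\<And>n. M n \<in> cone A"
  shows "N \<in> cone A"
proof -
  interpret S: Metric_space "energy_space \<kappa>" "strong_dist \<kappa>" by (rule Metric_space_strong)
  note d = strong_limitD[OF s]
  have "limitin S.mtopology (of_positive \<circ> M) (of_positive N) sequentially"
    unfolding S.limitin_metric_dist_null using d
    by (simp add: strong_dist_of_positive energy_space_of_positive)
  moreover have "range (of_positive \<circ> M) \<subseteq> of_positive ` cone A" using M by auto
  ultimately have "of_positive N \<in> of_positive ` cone A"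
    using c unfolding strong_topology_def S.metric_closedin_iff_sequentially_closed by blast
  then show ?thesis by (auto simp: of_positive_def)
qed

lemma strong_limit_energy:
  assumes s: "strong_limit M N"
  shows "(\<lambda>n. e (M n) (M n)) \<longlonglongrightarrow> e N N"
proof -
  note d = strong_limitD[OF s]
  have nrm: "sqrt (D2 R (null_measure borel)) = sqrt (e R R)" if "R \<in> E" for R
    using that by (simp add: D2_def e_null cone_null)
  have b: "\<bar>sqrt (e (M n) (M n)) - sqrt (e N N)\<bar> \<le> sqrt (D2 (M n) N)" for n
    using D2_triangle[OF d(1)[of n] d(2) cone_null] D2_triangle[OF d(2) d(1)[of n] cone_null]
      D2_commute[OF d(2) d(1)[of n]] nrm d by simp
  have "(\<lambda>n. sqrt (e (M n) (M n)) - sqrt (e N N)) \<longlonglongrightarrow> 0"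
    by (rule tendsto_0_le[OF d(3), of _ 1]) (use b D2_nonneg[OF d(1) d(2)] in auto)
  then have "(\<lambda>n. sqrt (e (M n) (M n))) \<longlonglongrightarrow> sqrt (e N N)" by (simp add: LIM_zero_iff)
  from tendsto_power[OF this, of 2] show ?thesis by simp
qed

end

section \<open>Minimizing quadratic functionals over convex sets of measures\<close>

lemma ennreal_inverse_antimono: "a \<le> b \<Longrightarrow> inverse b \<le> inverse (a :: ennreal)"
proof (cases a; cases b)
  fix r s assume rs: "0 \<le> r" "a = ennreal r" "0 \<le> s" "b = ennreal s" and le: "a \<le> b"
  show "inverse b \<le> inverse a"
  proof (cases "r = 0")
    case False
    then have "0 < r" "r \<le> s" using rs le by (auto simp: ennreal_le_iff)
    then show ?thesis using rs by (simp add: inverse_ennreal ennreal_leI le_imp_inverse_le)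
  qed (use rs in simp)
qed (auto simp: top_unique)

definition mix :: "real \<Rightarrow> 'a::topological_space measure \<Rightarrow> 'a measure \<Rightarrow> 'a measure" where
  "mix t M N = add_measure (scale_measure (ennreal (1 - t)) M) (scale_measure (ennreal t) N)"

lemma sets_mix [simp]: "sets (mix t M N) = sets borel"
  by (simp add: mix_def)

lemma emeasure_mix:
  assumes "sets M = sets borel" "sets N = sets borel"
  shows "emeasure (mix t M N) B = ennreal (1 - t) * emeasure M B + ennreal t * emeasure N B"
  unfolding mix_def using assms by (simp add: emeasure_add_measure)

lemma mix_mass_le:
  assumes "sets M = sets borel" "sets N = sets borel" "0 \<le> t" "t \<le> 1"
    and "emeasure M B \<le> q" "emeasure N B \<le> q"
  shows "emeasure (mix t M N) B \<le> q"
proof -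
  have "emeasure (mix t M N) B \<le> ennreal (1 - t) * q + ennreal t * q"
    unfolding emeasure_mix[OF assms(1,2)] by (intro add_mono mult_left_mono assms) auto
  also have "\<dots> = q" using assms(3,4) by (simp add: distrib_right[symmetric] flip: ennreal_plus)
  finally show ?thesis .
qed

lemma mix_mass_ge:
  assumes "sets M = sets borel" "sets N = sets borel" "0 \<le> t" "t \<le> 1"
    and "q \<le> emeasure M B" "q \<le> emeasure N B"
  shows "q \<le> emeasure (mix t M N) B"
proof -
  have "q = ennreal (1 - t) * q + ennreal t * q"
    using assms(3,4) by (simp add: distrib_right[symmetric] flip: ennreal_plus)
  also have "\<dots> \<le> emeasure (mix t M N) B"
    unfolding emeasure_mix[OF assms(1,2)] by (intro add_mono mult_left_mono assms) auto
  finally show ?thesis .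
qed

context perfect_kernel_space
begin

lemma mix_cone:
  assumes "M \<in> cone A" "N \<in> cone A"
  shows "mix t M N \<in> cone A"
  unfolding mix_def by (intro cone_add cone_scale assms) auto

lemma e_mix:
  assumes M: "M \<in> E" and N: "N \<in> E" and t: "0 \<le> t" "t \<le> 1"
  shows "e (mix t M N) (mix t M N) = (1 - t)\<^sup>2 * e M M + 2 * t * (1 - t) * e M N + t\<^sup>2 * e N N"
proof -
  have s: "scale_measure (ennreal (1 - t)) M \<in> E" "scale_measure (ennreal t) N \<in> E"
    using M N by (auto intro!: cone_scale)
  show ?thesis unfolding mix_def using M N t s
    by (simp add: e_add e_scale cone_add e_commute[OF N M]) (simp add: algebra_simps power2_eq_square)
qed

text \<open>With \<open>J(M) = I(M) + 2 l(M)\<close>, affine \<open>l\<close>, and the midpoint \<open>P\<close> of \<open>M\<close> and \<open>N\<close>,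
  the parallelogram law reads \<open>D2 M N = 2 J(M) + 2 J(N) - 4 J(P)\<close>. It makes
  nearly minimal elements strongly Cauchy, also when the convex sets shrink, as long as the infima stay bounded.\<close>

lemma minimizing_sequence:
  fixes G :: "nat \<Rightarrow> 'a measure set" and l :: "'a measure \<Rightarrow> real" and b B :: real
  assumes GE: "\<And>k. G k \<subseteq> E" and dec: "\<And>k m. k \<le> m \<Longrightarrow> G m \<subseteq> G k"
    and mid: "\<And>k M N. M \<in> G k \<Longrightarrow> N \<in> G k \<Longrightarrow> mix (1/2) M N \<in> G k"
    and l: "\<And>M N. M \<in> G 0 \<Longrightarrow> N \<in> G 0 \<Longrightarrow> l (mix (1/2) M N) = (l M + l N) / 2"
    and below: "\<And>M. M \<in> G 0 \<Longrightarrow> b \<le> e M M + 2 * l M"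
    and above: "\<And>k. \<exists>M\<in>G k. e M M + 2 * l M \<le> B"
  obtains M N where "\<And>k. M k \<in> G k" "strong_limit M N"
    "\<And>k R. R \<in> G k \<Longrightarrow> e (M k) (M k) + 2 * l (M k) \<le> e R R + 2 * l R + 1 / Suc k"
proof -
  define J where "J M = e M M + 2 * l M" for M
  have G0: "M \<in> G k \<Longrightarrow> M \<in> G 0" for M k using dec[of 0 k] by auto
  have bdd: "bdd_below (J ` G k)" for k using below G0 by (auto simp: J_def intro!: bdd_belowI2[of _ b])
  define j where "j k = Inf (J ` G k)" for k
  have j_le: "j k \<le> J M" if "M \<in> G k" for k M
    unfolding j_def by (rule cInf_lower) (use that bdd in auto)
  have jB: "j k \<le> B" for k using above[of k] j_le[of _ k] by (force simp: J_def)
  have jmono: "j k \<le> j m" if "k \<le> m" for k m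
    unfolding j_def[of m] by (rule cInf_greatest) (use above[of m] j_le dec[OF that] in auto)
  obtain L where "j \<longlonglongrightarrow> L"
    using incseq_convergent[of j B] jmono jB unfolding incseq_def by metis
  then have jC: "Cauchy j" by (rule LIMSEQ_imp_Cauchy)
  define r :: "nat \<Rightarrow> real" where "r k = 1 / Suc k" for k
  have r_pos: "0 < r k" for k by (simp add: r_def)
  have "\<exists>M\<in>G k. J M < j k + r k" for k
  proof -
    have "J ` G k \<noteq> {}" using above[of k] by auto
    then have "\<exists>x\<in>J ` G k. x < j k + r k"
      using cInf_lessD[of "J ` G k" "j k + r k"] r_pos[of k] by (simp add: j_def)
    then show ?thesis by auto
  qed
  then obtain M where M: "\<And>k. M k \<in> G k" "\<And>k. J (M k) < j k + r k" by metis
  have ME: "M k \<in> E" for k using M(1) GE by auto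
  have par: "D2 (M k) (M m) \<le> 2 * j m - 2 * j k + 2 * (r k) + 2 * (r m)" if km: "k \<le> m" for k m
  proof -
    have Mm: "M m \<in> G k" using M(1)[of m] dec[OF km] by auto
    have "D2 (M k) (M m) = 2 * J (M k) + 2 * J (M m) - 4 * J (mix (1/2) (M k) (M m))"
      unfolding J_def D2_def using l[of "M k" "M m"] G0[OF M(1)] e_mix[OF ME ME, of "1/2" k m]
      by (simp add: field_simps power2_eq_square)
    moreover have "j k \<le> J (mix (1/2) (M k) (M m))" by (rule j_le[OF mid[OF M(1) Mm]])
    moreover note M(2)[of k] M(2)[of m]
    ultimately show ?thesis by linarith
  qed
  have "\<exists>n0. \<forall>m\<ge>n0. \<forall>n\<ge>n0. D2 (M m) (M n) < \<epsilon>" if \<epsilon>: "\<epsilon> > 0" for \<epsilon>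
  proof -
    obtain n1 where n1: "\<And>m n. m \<ge> n1 \<Longrightarrow> n \<ge> n1 \<Longrightarrow> dist (j m) (j n) < \<epsilon> / 6"
      using jC \<epsilon> unfolding Cauchy_def by (meson divide_pos_pos zero_less_numeral)
    obtain n2 where n2: "1 / Suc n2 < \<epsilon> / 6"
      using \<epsilon> nat_approx_posE[of "\<epsilon> / 6"] by auto
    have small: "r k < \<epsilon> / 6" if "k \<ge> n2" for k
    proof -
      have "1 / real (Suc k) \<le> 1 / Suc n2" using that by (intro divide_left_mono) auto
      with n2 show ?thesis unfolding r_def by simp
    qed
    have ord: "D2 (M k) (M m) < \<epsilon>" if "k \<ge> max n1 n2" "k \<le> m" for k m
    proof -
      have "\<bar>j k - j m\<bar> < \<epsilon> / 6" using n1[of k m] that by (simp add: dist_real_def)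
      then have "j m - j k < \<epsilon> / 6" by linarith
      moreover have "r k < \<epsilon> / 6" "r m < \<epsilon> / 6" using small that by auto
      ultimately show ?thesis using par[OF that(2)] by linarith
    qed
    have "D2 (M m) (M n) < \<epsilon>" if "m \<ge> max n1 n2" "n \<ge> max n1 n2" for m n
      using ord[of m n] ord[of n m] that D2_commute[OF ME[of m] ME[of n]] by (cases "m \<le> n") auto
    then show ?thesis by blast
  qed
  with ME obtain N where N: "strong_limit M N" using strong_complete[of M] by blast
  have "e (M k) (M k) + 2 * l (M k) \<le> e R R + 2 * l R + 1 / Suc k" if "R \<in> G k" for k R
    using M(2)[of k] j_le[OF that] by (simp add: J_def r_def)
  with that M(1) N show thesis by blast
qed

lemma minimizer_exists:
  fixes G :: "'a measure set" and l :: "'a measure \<Rightarrow> real" and b :: real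
  assumes GE: "G \<subseteq> E" and ne: "G \<noteq> {}"
    and mid: "\<And>M N. M \<in> G \<Longrightarrow> N \<in> G \<Longrightarrow> mix (1/2) M N \<in> G"
    and l: "\<And>M N. M \<in> G \<Longrightarrow> N \<in> G \<Longrightarrow> l (mix (1/2) M N) = (l M + l N) / 2"
    and below: "\<And>M. M \<in> G \<Longrightarrow> b \<le> e M M + 2 * l M"
    and closed: "\<And>M N. (\<And>n. M n \<in> G) \<Longrightarrow> strong_limit M N \<Longrightarrow> N \<in> G"
    and lsc: "\<And>M N \<epsilon>. (\<And>n. M n \<in> G) \<Longrightarrow> strong_limit M N \<Longrightarrow> 0 < \<epsilon> \<Longrightarrow>
      eventually (\<lambda>n. l N \<le> l (M n) + \<epsilon>) sequentially"
  obtains N where "N \<in> G" "\<And>R. R \<in> G \<Longrightarrow> e N N + 2 * l N \<le> e R R + 2 * l R"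
proof -
  obtain R0 where R0: "R0 \<in> G" using ne by auto
  obtain M N where M: "\<And>k::nat. M k \<in> G" "strong_limit M N"
    and near: "\<And>k R. R \<in> G \<Longrightarrow> e (M k) (M k) + 2 * l (M k) \<le> e R R + 2 * l R + 1 / Suc k"
  proof (rule minimizing_sequence[of "\<lambda>_. G" l b "e R0 R0 + 2 * l R0"])
    show "\<exists>M\<in>G. e M M + 2 * l M \<le> e R0 R0 + 2 * l R0" using R0 by auto
  qed (use GE mid l below that in auto)
  have NG: "N \<in> G" by (rule closed[OF M])
  have "e N N + 2 * l N \<le> e R R + 2 * l R" if R: "R \<in> G" for R
  proof (rule field_le_epsilon)
    fix \<epsilon> :: real assume \<epsilon>: "0 < \<epsilon>"
    have 1: "eventually (\<lambda>n. l N \<le> l (M n) + \<epsilon> / 8) sequentially" using lsc[OF M] \<epsilon> by simp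
    have 2: "eventually (\<lambda>n. e N N - \<epsilon> / 4 < e (M n) (M n)) sequentially"
      using order_tendstoD(1)[OF strong_limit_energy[OF M(2)], of "e N N - \<epsilon> / 4"] \<epsilon> by simp
    have 3: "eventually (\<lambda>n. 1 / real (Suc n) < \<epsilon> / 4) sequentially"
      using order_tendstoD(2)[OF LIMSEQ_Suc[OF lim_1_over_n], of "\<epsilon> / 4"] \<epsilon> by simp
    from eventually_happens[OF eventually_conj[OF 1 eventually_conj[OF 2 3]]]
    obtain n where n: "l N \<le> l (M n) + \<epsilon> / 8" "e N N - \<epsilon> / 4 < e (M n) (M n)" "1 / real (Suc n) < \<epsilon> / 4"
      by auto
    then show "e N N + 2 * l N \<le> e R R + 2 * l R + \<epsilon>" using near[OF R, of n] \<epsilon> by simp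
  qed
  with NG that show thesis by blast
qed

text \<open>Along the segment from \<open>M\<close> to \<open>N\<close> the functional is a quadratic polynomial in \<open>t\<close>; the
  claim is that its derivative at \<open>0\<close> is nonnegative.\<close>

lemma first_variation:
  assumes M: "M \<in> E" and N: "N \<in> E"
    and l: "\<And>t. 0 \<le> t \<Longrightarrow> t \<le> 1 \<Longrightarrow> l (mix t M N) = (1 - t) * l M + t * l N"
    and min: "\<And>t. 0 \<le> t \<Longrightarrow> t \<le> 1 \<Longrightarrow> e M M + 2 * l M \<le> e (mix t M N) (mix t M N) + 2 * l (mix t M N)"
  shows "e M M + l M \<le> e M N + l N"
proof (rule ccontr)
  assume neg: "\<not> ?thesis"
  define X where "X = e M M + l M - e M N - l N"
  have X: "X > 0" using neg by (simp add: X_def)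
  define D where "D = D2 M N"
  have D: "D \<ge> 0" unfolding D_def by (rule D2_nonneg[OF M N])
  \<comment> \<open>small enough for the linear term \<open>-2 t X\<close> to dominate the quadratic term \<open>t\<^sup>2 D\<close>\<close>
  define t where "t = min 1 (X / (D + 1))"
  have t: "0 < t" "t \<le> 1" using X D by (auto simp: t_def)
  have "0 \<le> - 2 * t * X + t\<^sup>2 * D"
    using min[of t] e_mix[OF M N, of t] l[of t] t unfolding X_def D_def D2_def
    by (simp add: algebra_simps power2_eq_square)
  then have "0 \<le> t * (- 2 * X + t * D)" by (simp add: algebra_simps power2_eq_square)
  then have "2 * X \<le> t * D" using t(1) by (simp add: zero_le_mult_iff)
  also have "\<dots> \<le> X / (D + 1) * D" using D by (intro mult_right_mono) (auto simp: t_def)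
  also have "\<dots> \<le> X" using X D by (simp add: field_simps)
  finally show False using X by simp
qed

lemma strong_limit_mass_le:
  assumes s: "strong_limit M N" and q: "\<And>n. mass (M n) \<le> q"
  shows "mass N \<le> q"
proof (rule ccontr)
  assume "\<not> ?thesis"
  then have "q < mass N" by simp
  from vague_limit_open[OF E_radon[OF strong_limitD(1)[OF s]] E_radon[OF strong_limitD(2)[OF s]] strong_vague[OF s] open_UNIV this]
  obtain n where "q < mass (M n)" by (auto dest: eventually_happens)
  with q[of n] show False by simp
qed

text \<open>On a compact set no mass is lost in the limit.\<close>

lemma strong_limit_compact_cone:
  assumes K: "compact K" and s: "strong_limit M N" and M: "\<And>n. M n \<in> cone K"
    and unit: "\<And>n. mass (M n) = 1"
  shows "N \<in> cone K" "mass N = 1"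
proof -
  note rM = E_radon[OF strong_limitD(1)[OF s]] note rN = E_radon[OF strong_limitD(2)[OF s]]
  have Kb: "K \<in> sets borel" using K by simp
  have Mz: "emeasure (M n) (- K) = 0" for n
    using cone_concentrated[OF M[of n]] concentrated_on_borel[of "M n" K] rM Kb by simp
  have Nz: "emeasure N (- K) = 0"
  proof (rule ccontr)
    assume "\<not> ?thesis"
    then have "0 < emeasure N (- K)" by (simp add: zero_less_iff_neq_zero)
    moreover have "open (- K)" using K by (simp add: compact_imp_closed open_Compl)
    ultimately have "eventually (\<lambda>n. 0 < emeasure (M n) (- K)) sequentially"
      by (intro vague_limit_open[OF rM rN strong_vague[OF s]])
    then obtain n where "0 < emeasure (M n) (- K)" by (auto dest: eventually_happens)
    with Mz[of n] show False by simp
  qed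
  then show "N \<in> cone K"
    using strong_limitD(2)[OF s] concentrated_on_borel[of N K] rN Kb by (simp add: energy_cone_def)
  have all: "mass R = emeasure R K" if "radon_measure R" "emeasure R (- K) = 0" for R
    using that Kb emeasure_Un_null_set[of K R "- K"] by (simp add: null_sets_def)
  have "mass N \<le> 1" by (rule strong_limit_mass_le[OF s]) (simp add: unit)
  moreover have "\<not> mass N < 1"
  proof
    assume "mass N < 1"
    then have "emeasure N K < 1" using all[OF rN Nz] by simp
    from vague_limit_compact[OF rM rN strong_vague[OF s] K this]
    obtain n where "emeasure (M n) K < 1" by (auto dest: eventually_happens)
    with all[OF rM Mz, of n] unit[of n] show False by simp
  qed
  ultimately show "mass N = 1" by (simp add: order.antisym not_less)
qed

section \<open>Equilibrium measures and the positivity of mass\<close>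

lemma restrict_normalize:
  fixes m :: real
  defines "T \<equiv> \<lambda>M D. scale_measure (ennreal (1 / m)) (restr M D)"
  assumes M: "M \<in> cone A" and D: "D \<in> sets borel" and m: "emeasure M D = ennreal m" "0 < m"
  shows "T M D \<in> cone A" "mass (T M D) = 1" "concentrated_on (T M D) D"
    "e (T M D) (T M D) \<le> e M M / m\<^sup>2"
proof -
  have c: "restr M D \<in> cone A" by (rule cone_restrict[OF M D])
  show T: "T M D \<in> cone A" unfolding T_def by (rule cone_scale[OF c]) simp
  show "mass (T M D) = 1"
    unfolding T_def using m cone_radon[OF M] D by (simp add: emeasure_restrict flip: ennreal_mult)
  have "emeasure (restr M D) (- D) = 0" using cone_radon[OF M] D by (simp add: emeasure_restrict)
  then show "concentrated_on (T M D) D"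
    using D cone_radon[OF M] by (simp add: T_def concentrated_on_borel)
  show "e (T M D) (T M D) \<le> e M M / m\<^sup>2"
    using m cone_E[OF c] cone_E[OF T] e_restrict_le[OF cone_E[OF M] D]
    by (simp add: T_def e_scale power2_eq_square divide_right_mono)
qed

lemma e_self_pos:
  assumes "M \<in> E" "mass M \<noteq> 0"
  shows "e M M > 0"
proof (rule ccontr)
  assume "\<not> ?thesis"
  then have "D2 M (null_measure borel) = 0"
    using e_nonneg[of M M] assms by (simp add: D2_def e_null cone_null not_less)
  from D2_eq_0[OF assms(1) cone_null this] assms(2) show False by simp
qed

text \<open>The minimal energy unit measure on a compact set: varying it in the direction of an arbitrary
  unit measure shows that its potential is at least its energy wherever finite energy measures can
  see it, hence equal to it almost everywhere with respect to itself.\<close>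

lemma equilibrium_measure:
  assumes K: "compact K" and ex: "\<sigma>0 \<in> cone K" "emeasure \<sigma>0 UNIV = 1"
  obtains \<gamma> V where "\<gamma> \<in> cone K" "0 < V" "AE x in \<gamma>. U \<gamma> x \<le> ennreal V"
    "\<And>\<sigma>. \<sigma> \<in> cone K \<Longrightarrow> AE x in \<sigma>. ennreal V \<le> U \<gamma> x"
proof -
  let ?G = "{\<sigma> \<in> cone K. mass \<sigma> = 1}"
  have Gmix: "mix t M N \<in> ?G" if "M \<in> ?G" "N \<in> ?G" "0 \<le> t" "t \<le> 1" for t M N
    using that by (auto intro!: mix_cone order.antisym mix_mass_le mix_mass_ge simp: cone_radon)
  obtain \<gamma> where \<gamma>: "\<gamma> \<in> ?G" "\<And>R. R \<in> ?G \<Longrightarrow> e \<gamma> \<gamma> + 2 * 0 \<le> e R R + 2 * 0"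
  proof (rule minimizer_exists[of ?G "\<lambda>_. 0" 0])
    show "?G \<subseteq> E" using cone_E by auto
    show "?G \<noteq> {}" using ex by auto
    show "N \<in> ?G" if "\<And>n. M n \<in> ?G" "strong_limit M N" for M N
      using strong_limit_compact_cone[OF K that(2)] that(1) by auto
  qed (use Gmix[of _ _ "1/2"] in auto)
  have \<gamma>E: "\<gamma> \<in> E" and \<gamma>K: "\<gamma> \<in> cone K" and \<gamma>1: "mass \<gamma> = 1" using \<gamma>(1) cone_E by auto
  note r\<gamma> = E_radon[OF \<gamma>E]
  define V where "V = e \<gamma> \<gamma>"
  have V: "V > 0" unfolding V_def using e_self_pos[OF \<gamma>E] \<gamma>1 by simp
  have var: "V \<le> e \<gamma> \<tau>" if \<tau>: "\<tau> \<in> ?G" for \<tau>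
    using first_variation[of \<gamma> \<tau> "\<lambda>_. 0"] \<gamma>E \<tau> \<gamma>(2)[OF Gmix[OF \<gamma>(1) \<tau>]] cone_E unfolding V_def by auto
  have pm[measurable]: "U \<gamma> \<in> borel_measurable borel" by (rule potential_measurable[OF r\<gamma>])
  have low: "AE x in \<sigma>. ennreal V \<le> U \<gamma> x" if \<sigma>: "\<sigma> \<in> cone K" for \<sigma>
  proof (rule ccontr)
    assume neg: "\<not> ?thesis"
    note r\<sigma> = cone_radon[OF \<sigma>]
    define D where "D = {x. U \<gamma> x < ennreal V}"
    have D: "D \<in> sets borel" unfolding D_def by measurable
    have D0: "emeasure \<sigma> D \<noteq> 0"
    proof
      assume "emeasure \<sigma> D = 0"
      then have "D \<in> null_sets \<sigma>" using D r\<sigma> by (simp add: null_sets_def)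
      from AE_not_in[OF this] have "AE x in \<sigma>. ennreal V \<le> U \<gamma> x"
        by eventually_elim (simp add: D_def)
      with neg show False by simp
    qed
    have "emeasure \<sigma> D \<le> emeasure \<sigma> (K \<union> - K)" by (rule emeasure_mono) (use r\<sigma> in auto)
    also have "\<dots> \<le> emeasure \<sigma> K + emeasure \<sigma> (- K)" by (rule emeasure_subadditive) (use r\<sigma> K in auto)
    also have "emeasure \<sigma> (- K) = 0"
      using cone_concentrated[OF \<sigma>] r\<sigma> K by (simp add: concentrated_on_borel)
    also have "emeasure \<sigma> K + 0 < \<infinity>" using radon_compact_finite[OF r\<sigma> K] by simp
    finally obtain m where m: "emeasure \<sigma> D = ennreal m" "0 < m"
      using D0 by (cases "emeasure \<sigma> D") (auto simp: less_le)
    let ?\<tau> = "scale_measure (ennreal (1 / m)) (restr \<sigma> D)"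
    have \<tau>: "?\<tau> \<in> ?G" using restrict_normalize[OF \<sigma> D m] by auto
    have \<tau>E: "?\<tau> \<in> E" using \<tau> by (auto intro: cone_E)
    have "ennreal (e \<gamma> ?\<tau>) = I ?\<tau> \<gamma>"
      unfolding e_commute[OF \<gamma>E \<tau>E] by (rule ennreal_e[OF \<tau>E \<gamma>E])
    also have "\<dots> = (\<integral>\<^sup>+x. U \<gamma> x \<partial>?\<tau>)"
      by (rule mutual_energy_potential[OF E_radon[OF \<tau>E] r\<gamma>])
    also have "\<dots> = ennreal (1 / m) * (\<integral>\<^sup>+x. indicator D x * U \<gamma> x \<partial>\<sigma>)"
      using r\<sigma> D by (subst nn_integral_scale_measure) (auto simp: nn_integral_restrict radon_measurable_cong)
    finally have 1: "ennreal (e \<gamma> ?\<tau>) = ennreal (1 / m) * (\<integral>\<^sup>+x. indicator D x * U \<gamma> x \<partial>\<sigma>)" .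
    have "(\<integral>\<^sup>+x. indicator D x * U \<gamma> x \<partial>\<sigma>) < (\<integral>\<^sup>+x. ennreal V * indicator D x \<partial>\<sigma>)"
    proof (rule nn_integral_less)
      have le: "(\<integral>\<^sup>+x. indicator D x * U \<gamma> x \<partial>\<sigma>) \<le> (\<integral>\<^sup>+x. ennreal V * indicator D x \<partial>\<sigma>)"
        by (rule nn_integral_mono) (auto simp: D_def split: split_indicator)
      also have "\<dots> = ennreal V * ennreal m" using D r\<sigma> m by (simp add: nn_integral_cmult_indicator)
      also have "\<dots> < \<infinity>" by (simp add: ennreal_mult_less_top)
      finally show "(\<integral>\<^sup>+x. indicator D x * U \<gamma> x \<partial>\<sigma>) \<noteq> \<infinity>" by simp
      show "AE x in \<sigma>. indicator D x * U \<gamma> x \<le> ennreal V * indicator D x"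
        by (auto simp: D_def split: split_indicator)
      show "\<not> (AE x in \<sigma>. ennreal V * indicator D x \<le> indicator D x * U \<gamma> x)"
      proof
        assume "AE x in \<sigma>. ennreal V * indicator D x \<le> indicator D x * U \<gamma> x"
        then have "AE x in \<sigma>. ennreal V \<le> U \<gamma> x"
          by eventually_elim (auto simp: D_def split: split_indicator_asm)
        with neg show False by simp
      qed
    qed (use r\<sigma> D in \<open>auto simp: radon_measurable_cong\<close>)
    also have "\<dots> = ennreal V * ennreal m" using D r\<sigma> m by (simp add: nn_integral_cmult_indicator)
    finally have "ennreal (e \<gamma> ?\<tau>) < ennreal (1 / m) * (ennreal V * ennreal m)"
      unfolding 1 using m by (intro ennreal_mult_strict_left_mono) auto
    also have "\<dots> = ennreal V" using m V by (simp flip: ennreal_mult)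
    finally show False using var[OF \<tau>] V by (simp add: ennreal_less_iff)
  qed
  have "AE x in \<gamma>. U \<gamma> x \<le> ennreal V"
  proof (rule ccontr)
    assume neg: "\<not> ?thesis"
    have "(\<integral>\<^sup>+x. ennreal V \<partial>\<gamma>) < (\<integral>\<^sup>+x. U \<gamma> x \<partial>\<gamma>)"
      by (rule nn_integral_less) (use low[OF \<gamma>K] neg \<gamma>1 r\<gamma> in \<open>auto simp: radon_measurable_cong\<close>)
    also have "\<dots> = ennreal V" using mutual_energy_potential[OF r\<gamma> r\<gamma>] \<gamma>E by (simp add: V_def ennreal_e)
    finally show False using \<gamma>1 r\<gamma> by simp
  qed
  with that[OF \<gamma>K V _ low] show thesis by blast
qed

text \<open>Test against equilibrium measures \<open>\<gamma>\<close> of compact sets \<open>K\<close> on which \<open>U\<^sup>L \<le> U\<^sup>R\<close>: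
  symmetry of the energy transfers the bound \<open>U\<^sup>\<gamma> \<le> hV\<close> from \<open>K\<close> to \<open>R\<close>,
  \<open>V L(K) \<le> \<integral> U\<^sup>\<gamma> dL = \<integral> U\<^sup>L d\<gamma> \<le> \<integral> U\<^sup>R d\<gamma> = \<integral> U\<^sup>\<gamma> dR \<le> h V R(X)\<close>.\<close>

lemma positivity_of_mass:
  assumes ug: "ugaheri_maximum_principle h \<kappa>" and lam: "L \<in> E" and rho: "radon_measure R"
    and le: "AE x in L. U L x \<le> U R x"
  shows "mass L \<le> ennreal h * mass R"
proof -
  note rL = E_radon[OF lam]
  define S where "S = {x. U L x \<le> U R x}"
  note [measurable] = potential_measurable[OF rL] potential_measurable[OF rho]
  have S: "S \<in> sets borel" unfolding S_def by measurable
  have "mass L = emeasure L S"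
    by (rule emeasure_eq_AE) (use le S rL in \<open>auto simp: S_def\<close>)
  also have "\<dots> = (SUP K\<in>{K. compact K \<and> K \<subseteq> S}. emeasure L K)" by (rule radon_inner[OF rL S])
  also have "\<dots> \<le> ennreal h * mass R"
  proof (rule SUP_least)
    fix K assume "K \<in> {K. compact K \<and> K \<subseteq> S}"
    then have K: "compact K" "K \<subseteq> S" by auto
    have Kb: "K \<in> sets borel" using K by simp
    show "emeasure L K \<le> ennreal h * mass R"
    proof (cases "emeasure L K = 0")
      case False
      then obtain m where m: "emeasure L K = ennreal m" "0 < m"
        using radon_compact_finite[OF rL K(1)] by (cases "emeasure L K") (auto simp: less_le)
      note n = restrict_normalize[OF lam Kb m]
      have "scale_measure (ennreal (1 / m)) (restr L K) \<in> cone K"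
        using n(1,3) by (simp add: energy_cone_def)
      from equilibrium_measure[OF K(1) this n(2)]
      obtain \<gamma> V where \<gamma>: "\<gamma> \<in> cone K" "0 < V" "AE x in \<gamma>. U \<gamma> x \<le> ennreal V"
        and low: "\<And>\<sigma>. \<sigma> \<in> cone K \<Longrightarrow> AE x in \<sigma>. ennreal V \<le> U \<gamma> x" by blast
      note r\<gamma> = cone_radon[OF \<gamma>(1)]
      have up: "U \<gamma> x \<le> ennreal (h * V)" for x
        using ug \<gamma> cone_E[OF \<gamma>(1)] unfolding ugaheri_maximum_principle_def by blast
      have LK: "restr L K \<in> cone K"
        using cone_restrict[OF lam Kb] rL Kb by (simp add: energy_cone_def concentrated_on_borel emeasure_restrict)
      have "ennreal V * emeasure L K = (\<integral>\<^sup>+x. ennreal V \<partial>restr L K)"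
        using rL Kb by (simp add: emeasure_restrict)
      also have "\<dots> \<le> (\<integral>\<^sup>+x. U \<gamma> x \<partial>restr L K)"
        by (rule nn_integral_mono_AE[OF low[OF LK]])
      also have "\<dots> = (\<integral>\<^sup>+x. indicator K x * U \<gamma> x \<partial>L)"
        by (rule nn_integral_restrict[OF rL Kb potential_measurable[OF r\<gamma>]])
      also have "\<dots> \<le> (\<integral>\<^sup>+x. U \<gamma> x \<partial>L)"
        by (rule nn_integral_mono) (auto split: split_indicator)
      also have "\<dots> = (\<integral>\<^sup>+x. U L x \<partial>\<gamma>)"
        using mutual_energy_commute[OF rL r\<gamma>] mutual_energy_potential[OF rL r\<gamma>] mutual_energy_potential[OF r\<gamma> rL] by simp
      also have "\<dots> \<le> (\<integral>\<^sup>+x. U R x \<partial>\<gamma>)"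
      proof (rule nn_integral_mono_AE)
        show "AE x in \<gamma>. U L x \<le> U R x"
          using concentrated_on_AE[OF cone_concentrated[OF \<gamma>(1)]] by eventually_elim (use K(2) in \<open>auto simp: S_def\<close>)
      qed
      also have "\<dots> = (\<integral>\<^sup>+x. U \<gamma> x \<partial>R)"
        using mutual_energy_commute[OF rho r\<gamma>] mutual_energy_potential[OF rho r\<gamma>] mutual_energy_potential[OF r\<gamma> rho] by simp
      also have "\<dots> \<le> (\<integral>\<^sup>+x. ennreal (h * V) \<partial>R)" by (rule nn_integral_mono) (rule up)
      also have "\<dots> = ennreal V * (ennreal h * mass R)"
        using rho \<gamma>(2) ennreal_mult''[of V h] by (simp add: ac_simps)
      finally show ?thesis using \<gamma>(2) by (simp add: ennreal_mult_le_mult_iff)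
    qed simp
  qed
  finally show ?thesis .
qed

section \<open>Mass and capacity\<close>

lemma unit_measure_exists:
  assumes "inner_capacity \<kappa> A > 0"
  obtains \<tau> where "\<tau> \<in> cone A" "mass \<tau> = 1"
proof -
  obtain K where K: "K \<subseteq> A" "compact K" "capacity \<kappa> K > 0"
    using assms unfolding inner_capacity_def less_SUP_iff by auto
  then have "{\<mu> \<in> cone K. emeasure \<mu> K = 1} \<noteq> {}"
    unfolding capacity_def by (intro notI) simp
  then obtain \<tau> where t: "\<tau> \<in> cone K" "emeasure \<tau> K = 1" by auto
  have "mass \<tau> = emeasure \<tau> K"
    using K(2) by (intro concentrated_mass[OF cone_radon[OF t(1)] _ cone_concentrated[OF t(1)]]) simp
  with that cone_mono[OF t(1) K(1)] t(2) show thesis by simp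
qed

lemma infinite_capacity_small_energy:
  assumes inf: "inner_capacity \<kappa> A = \<infinity>" and \<epsilon>: "\<epsilon> > 0"
  obtains \<tau> where "\<tau> \<in> cone A" "mass \<tau> = 1" "e \<tau> \<tau> < \<epsilon>"
proof -
  have "ennreal (1 / \<epsilon>) < inner_capacity \<kappa> A" using inf by simp
  then obtain K where K: "K \<subseteq> A" "compact K" "capacity \<kappa> K > ennreal (1 / \<epsilon>)"
    unfolding inner_capacity_def less_SUP_iff by auto
  let ?I = "INF \<mu>\<in>{\<mu> \<in> cone K. emeasure \<mu> K = 1}. energy \<kappa> \<mu>"
  have "?I < ennreal \<epsilon>"
  proof (rule ccontr)
    assume "\<not> ?I < ennreal \<epsilon>"
    then have "1 / ?I \<le> 1 / ennreal \<epsilon>" by (simp add: divide_ennreal_def ennreal_inverse_antimono)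
    also have "\<dots> = ennreal (1 / \<epsilon>)" using \<epsilon> by (simp add: divide_ennreal flip: ennreal_1)
    finally show False using K(3) by (simp add: capacity_def)
  qed
  then obtain \<tau> where t: "\<tau> \<in> cone K" "emeasure \<tau> K = 1" "energy \<kappa> \<tau> < ennreal \<epsilon>"
    unfolding INF_less_iff by auto
  have "mass \<tau> = emeasure \<tau> K"
    using K(2) by (intro concentrated_mass[OF cone_radon[OF t(1)] _ cone_concentrated[OF t(1)]]) simp
  moreover have "e \<tau> \<tau> < \<epsilon>"
    using t(3) cone_E[OF t(1)] by (simp add: ennreal_e[symmetric] ennreal_less_iff)
  ultimately show thesis using that[of \<tau>] cone_mono[OF t(1) K(1)] t(2) by simp
qed

text \<open>The normalized restriction of \<open>M\<close> to a compact subset of \<open>A\<close> competes in the definition of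
  the capacity of that compact set.\<close>

lemma mass_le_capacity:
  assumes cap: "inner_capacity \<kappa> A \<le> ennreal c" and c: "0 \<le> c" and M: "M \<in> cone A"
  shows "mass M \<le> ennreal (sqrt (c * e M M))"
proof -
  note rM = cone_radon[OF M]
  obtain B where B: "B \<in> sets borel" "B \<subseteq> A" "emeasure M (- B) = 0"
    by (rule concentrated_on_borel_core[OF _ cone_concentrated[OF M]]) (use rM in auto)
  have "mass M = emeasure M B"
    using emeasure_Un_null_set[of B M "- B"] B rM by (simp add: null_sets_def)
  also have "\<dots> = (SUP K\<in>{K. compact K \<and> K \<subseteq> B}. emeasure M K)" by (rule radon_inner[OF rM B(1)])
  also have "\<dots> \<le> ennreal (sqrt (c * e M M))"
  proof (rule SUP_least)
    fix K assume "K \<in> {K. compact K \<and> K \<subseteq> B}"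
    then have K: "compact K" "K \<subseteq> B" by auto
    have Kb: "K \<in> sets borel" using K by simp
    show "emeasure M K \<le> ennreal (sqrt (c * e M M))"
    proof (cases "emeasure M K = 0")
      case False
      then obtain m where m: "emeasure M K = ennreal m" "0 < m"
        using radon_compact_finite[OF rM K(1)] by (cases "emeasure M K") (auto simp: less_le)
      note n = restrict_normalize[OF M Kb m]
      let ?t = "scale_measure (ennreal (1 / m)) (restr M K)"
      have tK: "?t \<in> cone K" using n(1,3) by (simp add: energy_cone_def)
      have tE: "?t \<in> E" by (rule cone_E[OF tK])
      have "emeasure ?t K = 1"
        using concentrated_mass[OF cone_radon[OF tK] Kb cone_concentrated[OF tK]] n(2) by metis
      then have "(INF \<mu>\<in>{\<mu> \<in> cone K. emeasure \<mu> K = 1}. energy \<kappa> \<mu>) \<le> ennreal (e ?t ?t)"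
        using tK tE by (intro INF_lower2[of ?t]) (auto simp: ennreal_e)
      then have "1 / ennreal (e ?t ?t) \<le> capacity \<kappa> K"
        unfolding capacity_def by (simp add: divide_ennreal_def ennreal_inverse_antimono)
      also have "\<dots> \<le> inner_capacity \<kappa> A"
        unfolding inner_capacity_def by (rule SUP_upper) (use K B in auto)
      also have "\<dots> \<le> ennreal c" by (rule cap)
      finally have "1 / ennreal (e ?t ?t) \<le> ennreal c" .
      moreover have tp: "e ?t ?t > 0" by (rule e_self_pos[OF tE]) (use n(2) in \<open>metis zero_neq_one\<close>)
      ultimately have "1 / e ?t ?t \<le> c"
        using c by (simp add: divide_ennreal flip: ennreal_1)
      then have "1 \<le> c * e ?t ?t" using tp by (simp add: field_simps)
      also have "\<dots> \<le> c * (e M M / m\<^sup>2)" using n(4) c by (rule mult_left_mono)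
      finally have "m\<^sup>2 \<le> c * e M M" using m by (simp add: field_simps)
      then show ?thesis using m by (simp add: real_le_rsqrt ennreal_leI)
    qed simp
  qed
  finally show ?thesis .
qed

text \<open>Otherwise measures of mass at least \<open>\<delta>\<close> and bounded energy could be placed
  outside every compact set. Those of nearly minimal energy form a strongly convergent sequence, whose
  vague limit charges no compact set; so the energies tend to \<open>0\<close>, and with them the masses, because
  the capacity is finite.\<close>

lemma finite_capacity_tightness:
  fixes b \<delta> :: real
  assumes cap: "inner_capacity \<kappa> A < \<infinity>" and \<delta>: "0 < \<delta>"
  obtains Q where "compact Q" "\<And>M. M \<in> cone A \<Longrightarrow> e M M \<le> b \<Longrightarrow> emeasure M (- Q) \<le> ennreal \<delta>"
proof -
  obtain Q :: "nat \<Rightarrow> 'a set" where Q: "\<And>n. compact (Q n)" "incseq Q"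
    "\<And>K. compact K \<Longrightarrow> \<exists>n. K \<subseteq> interior (Q n)"
    using compact_exhaustion by metis
  have Qb: "Q n \<in> sets borel" for n using Q(1) by simp
  obtain c where c: "inner_capacity \<kappa> A \<le> ennreal c" "0 \<le> c"
    using cap by (cases "inner_capacity \<kappa> A") auto
  define G where "G k = {M \<in> cone A. ennreal \<delta> \<le> mass M \<and> emeasure M (Q k) = 0}" for k
  \<comment> \<open>\<open>G k\<close> decreases, and each \<open>G k\<close> is convex\<close>
  have "\<exists>k. \<forall>M\<in>cone A. e M M \<le> b \<longrightarrow> emeasure M (- Q k) \<le> ennreal \<delta>"
  proof (rule ccontr)
    assume neg: "\<not> ?thesis"
    have above: "\<exists>M\<in>G k. e M M + 2 * 0 \<le> b" for k
    proof -
      obtain M where M: "M \<in> cone A" "e M M \<le> b" "ennreal \<delta> < emeasure M (- Q k)"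
        using neg by (auto simp: not_le)
      note rM = cone_radon[OF M(1)]
      let ?N = "restr M (- Q k)"
      have N: "?N \<in> cone A" by (rule cone_restrict[OF M(1)]) (use Qb in auto)
      have "e ?N ?N \<le> b" using e_restrict_le[OF cone_E[OF M(1)], of "- Q k"] Qb[of k] M(2) by simp
      moreover have "?N \<in> G k" using N M(3) rM Qb[of k] by (auto simp: G_def emeasure_restrict)
      ultimately show ?thesis by auto
    qed
    obtain M N where M: "\<And>k. M k \<in> G k" "strong_limit M N"
    proof (rule minimizing_sequence[of G "\<lambda>_. 0" 0 b])
      show "G k \<subseteq> E" for k using cone_E by (auto simp: G_def)
      show "G m \<subseteq> G k" if "k \<le> m" for k m
      proof
        fix M assume M: "M \<in> G m"
        then have "emeasure M (Q k) \<le> emeasure M (Q m)"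
          using Q(2) that Qb by (intro emeasure_mono) (auto simp: incseq_def G_def cone_radon)
        with M show "M \<in> G k" by (auto simp: G_def)
      qed
      show "mix (1/2) M N \<in> G k" if "M \<in> G k" "N \<in> G k" for k M N
        using that by (auto simp: G_def emeasure_mix cone_radon intro!: mix_cone mix_mass_ge)
    qed (use above in auto)
    note rM = E_radon[OF strong_limitD(1)[OF M(2)]] note rN = E_radon[OF strong_limitD(2)[OF M(2)]]
    have "emeasure N (interior (Q k)) = 0" for k
    proof (rule ccontr)
      assume "\<not> ?thesis"
      then have "0 < emeasure N (interior (Q k))" by (simp add: zero_less_iff_neq_zero)
      from vague_limit_open[OF rM rN strong_vague[OF M(2)] open_interior this]
      obtain n where n: "n \<ge> k" "0 < emeasure (M n) (interior (Q k))"
        using eventually_happens[OF eventually_conj[OF eventually_ge_at_top[of k]]] by force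
      have "interior (Q k) \<subseteq> Q n" using interior_subset[of "Q k"] Q(2) n(1) by (auto simp: incseq_def)
      then have "emeasure (M n) (interior (Q k)) \<le> emeasure (M n) (Q n)"
        using Qb rM by (intro emeasure_mono) auto
      with n(2) M(1)[of n] show False by (simp add: G_def)
    qed
    then have "(\<Union>k. interior (Q k)) \<in> null_sets N" using rN by (intro null_sets_UN) (auto simp: null_sets_def)
    moreover have "(\<Union>k. interior (Q k)) = UNIV"
    proof -
      have "x \<in> (\<Union>k. interior (Q k))" for x using Q(3)[of "{x}"] by auto
      then show ?thesis by auto
    qed
    ultimately have N0: "mass N = 0" by auto
    have "N = null_measure borel"
    proof (rule measure_eqI)
      fix B assume "B \<in> sets N"
      then show "emeasure N B = emeasure (null_measure borel) B"
        using emeasure_mono[of B UNIV N] N0 rN by simp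
    qed (use rN in simp)
    then have "e N N = 0" using e_null(1)[OF cone_null] by simp
    then have "(\<lambda>n. e (M n) (M n)) \<longlonglongrightarrow> 0" using strong_limit_energy[OF M(2)] by simp
    then have "(\<lambda>n. sqrt (c * e (M n) (M n))) \<longlonglongrightarrow> sqrt (c * 0)"
      by (intro tendsto_real_sqrt tendsto_mult_left)
    then have "eventually (\<lambda>n. sqrt (c * e (M n) (M n)) < \<delta>) sequentially"
      using order_tendstoD(2)[of _ 0 sequentially \<delta>] \<delta> by simp
    then obtain n where n: "sqrt (c * e (M n) (M n)) < \<delta>" by (auto dest: eventually_happens)
    have "ennreal \<delta> \<le> mass (M n)" using M(1)[of n] by (simp add: G_def)
    also have "\<dots> \<le> ennreal (sqrt (c * e (M n) (M n)))"
      using M(1)[of n] by (intro mass_le_capacity[OF c]) (simp add: G_def)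
    finally show False using n \<delta> by (simp add: ennreal_le_iff2)
  qed
  then show thesis using that Q(1) by blast
qed

end

section \<open>Integrals against sums and truncations\<close>

lemma integral_add_measure:
  fixes g :: "'a::topological_space \<Rightarrow> real"
  assumes s: "sets M = sets borel" "sets N = sets borel" and g: "g \<in> borel_measurable borel"
    and i: "integrable M g" "integrable N g"
  shows "integrable (add_measure M N) g"
    "(LINT x|add_measure M N. g x) = (LINT x|M. g x) + (LINT x|N. g x)"
proof -
  have nn: "(\<integral>\<^sup>+x. ennreal (u x) \<partial>add_measure M N) = (\<integral>\<^sup>+x. ennreal (u x) \<partial>M) + (\<integral>\<^sup>+x. ennreal (u x) \<partial>N)"
    if "u \<in> borel_measurable borel" for u :: "'a \<Rightarrow> real"
    using that by (intro nn_integral_add_measure[OF s]) auto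
  have fin: "(\<integral>\<^sup>+x. ennreal (g x) \<partial>M) < \<infinity>" "(\<integral>\<^sup>+x. ennreal (g x) \<partial>N) < \<infinity>"
    "(\<integral>\<^sup>+x. ennreal (- g x) \<partial>M) < \<infinity>" "(\<integral>\<^sup>+x. ennreal (- g x) \<partial>N) < \<infinity>"
    using i by (auto simp: real_integrable_def less_top[symmetric])
  show 1: "integrable (add_measure M N) g"
    using fin g nn[OF g] nn[of "\<lambda>x. - g x"]
    by (auto simp: real_integrable_def measurable_cong_sets[OF sets_add_measure refl] less_top[symmetric])
  show "(LINT x|add_measure M N. g x) = (LINT x|M. g x) + (LINT x|N. g x)"
    unfolding real_lebesgue_integral_def[OF 1] real_lebesgue_integral_def[OF i(1)] real_lebesgue_integral_def[OF i(2)]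
    using fin g nn[OF g] nn[of "\<lambda>x. - g x"] by (simp add: enn2real_plus)
qed

lemma integral_scale_measure:
  fixes g :: "'a \<Rightarrow> real"
  assumes i: "integrable M g" and r: "0 \<le> r"
  shows "integrable (scale_measure (ennreal r) M) g"
    "(LINT x|scale_measure (ennreal r) M. g x) = r * (LINT x|M. g x)"
proof -
  have m: "g \<in> borel_measurable M" using i by auto
  have nn: "(\<integral>\<^sup>+x. ennreal (u x) \<partial>scale_measure (ennreal r) M) = ennreal r * (\<integral>\<^sup>+x. ennreal (u x) \<partial>M)"
    if "u \<in> borel_measurable M" for u :: "'a \<Rightarrow> real"
    using that by (intro nn_integral_scale_measure) auto
  show 1: "integrable (scale_measure (ennreal r) M) g"
    using i nn[OF m] nn[of "\<lambda>x. - g x"] m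
    by (auto simp: real_integrable_def measurable_cong_sets[OF sets_scale_measure refl] ennreal_mult_eq_top_iff)
  show "(LINT x|scale_measure (ennreal r) M. g x) = r * (LINT x|M. g x)"
    unfolding real_lebesgue_integral_def[OF 1] real_lebesgue_integral_def[OF i]
    using nn[OF m] nn[of "\<lambda>x. - g x"] m r by (simp add: enn2real_mult right_diff_distrib)
qed

lemma integral_mix:
  fixes g :: "'a::topological_space \<Rightarrow> real"
  assumes s: "sets M = sets borel" "sets N = sets borel" and g: "g \<in> borel_measurable borel"
    and i: "integrable M g" "integrable N g" and t: "0 \<le> t" "t \<le> 1"
  shows "integrable (mix t M N) g"
    "(LINT x|mix t M N. g x) = (1 - t) * (LINT x|M. g x) + t * (LINT x|N. g x)"
  unfolding mix_def using t s
  by (auto simp: integral_add_measure[OF _ _ g] integral_scale_measure i)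

text \<open>Step functions: with \<open>\<delta>\<close>-spaced levels, \<open>g\<close> lies between the sum of \<open>\<delta>\<close> times
  the indicators of the level sets and the same sum plus \<open>\<delta>\<close>, the latter where \<open>g\<close> does not exceed the top level. This transfers inequalities
  between measures of level sets to integrals; whether the level sets are open or closed is left
  free.\<close>

lemma layer_bounds:
  fixes g :: "'a \<Rightarrow> ennreal" and S :: "real \<Rightarrow> 'a set" and \<delta> C :: real and K :: nat
  assumes \<delta>: "0 < \<delta>" and KC: "C \<le> K * \<delta>"
    and S: "\<And>t. {x. ennreal t < g x} \<subseteq> S t" "\<And>t. S t \<subseteq> {x. ennreal t \<le> g x}"
  shows "(\<Sum>k\<in>{1..K}. ennreal \<delta> * indicator (S (k * \<delta>)) x) \<le> g x" (is "?sum \<le> _")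
    and "g x \<le> ennreal C \<Longrightarrow> g x \<le> ennreal \<delta> + (\<Sum>k\<in>{1..K}. ennreal \<delta> * indicator (S (k * \<delta>)) x)"
proof -
  define I where "I = {k \<in> {1..K}. x \<in> S (real k * \<delta>)}"
  have fI: "finite I" unfolding I_def by simp
  have "?sum = ennreal \<delta> * (\<Sum>k\<in>{1..K}. indicator (S (k * \<delta>)) x)"
    by (simp add: sum_distrib_left)
  also have "(\<Sum>k\<in>{1..K}. indicator (S (k * \<delta>)) x :: ennreal) = of_nat (card I)"
    unfolding I_def by (simp add: indicator_def sum.If_cases Int_def)
  finally have sum: "?sum = ennreal (\<delta> * card I)"
    using \<delta> by (simp add: ennreal_mult ennreal_of_nat_eq_real_of_nat)
  show "?sum \<le> g x"
  proof (cases "g x")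
    case (real r)
    have "I \<subseteq> {1..nat \<lfloor>r / \<delta>\<rfloor>}"
    proof
      fix k assume k: "k \<in> I"
      then have "x \<in> {x. ennreal (real k * \<delta>) \<le> g x}" using S(2)[of "real k * \<delta>"] unfolding I_def by blast
      then have "real k * \<delta> \<le> r" using real by (simp add: ennreal_le_iff)
      then have "real k \<le> r / \<delta>" using \<delta> by (simp add: field_simps)
      then have "k \<le> nat \<lfloor>r / \<delta>\<rfloor>" by (simp add: le_nat_floor)
      then show "k \<in> {1..nat \<lfloor>r / \<delta>\<rfloor>}" using k by (simp add: I_def)
    qed
    then have "card I \<le> nat \<lfloor>r / \<delta>\<rfloor>" using card_mono[of "{1..nat \<lfloor>r / \<delta>\<rfloor>}" I] by simp
    moreover have "real (nat \<lfloor>r / \<delta>\<rfloor>) \<le> r / \<delta>" using real(1) \<delta> by (intro of_nat_floor) simp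
    ultimately have "real (card I) \<le> r / \<delta>" by linarith
    then have "\<delta> * card I \<le> r" using \<delta> by (simp add: field_simps)
    then show ?thesis unfolding sum real(2) by (rule ennreal_leI)
  qed simp
  show "g x \<le> ennreal \<delta> + ?sum" if gC: "g x \<le> ennreal C"
  proof -
    obtain r where r: "0 \<le> r" "g x = ennreal r" using gC by (cases "g x") (auto simp: top_unique)
    show ?thesis
    proof (cases "r = 0")
      case False
      then have rp: "0 < r" using r(1) by simp
      have rC: "r \<le> C" using gC r rp by (auto simp: ennreal_le_iff2)
      define m where "m = nat (\<lceil>r / \<delta>\<rceil> - 1)"
      have "0 < r / \<delta>" using rp \<delta> by simp
      then have c1: "1 \<le> \<lceil>r / \<delta>\<rceil>" by linarith
      have "r / \<delta> \<le> K" using rC KC \<delta> by (simp add: field_simps)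
      then have "\<lceil>r / \<delta>\<rceil> \<le> int K" by (simp add: ceiling_le_iff)
      then have mK: "m \<le> K" unfolding m_def by linarith
      have mr: "real m = real_of_int \<lceil>r / \<delta>\<rceil> - 1" unfolding m_def using c1 by simp
      have "{1..m} \<subseteq> I"
      proof
        fix k assume k: "k \<in> {1..m}"
        then have "real k \<le> real m" by simp
        then have "real k < r / \<delta>" using mr ceiling_correct[of "r / \<delta>"] by linarith
        then have "real k * \<delta> < r" using \<delta> by (simp add: field_simps)
        then have "ennreal (real k * \<delta>) < g x" using r \<delta> by (simp add: ennreal_less_iff)
        then show "k \<in> I" using S(1)[of "real k * \<delta>"] k mK by (auto simp: I_def)
      qed
      then have "m \<le> card I" using card_mono[OF fI, of "{1..m}"] by simp
      moreover have "r / \<delta> \<le> real m + 1" using mr by linarith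
      ultimately have "r / \<delta> \<le> real (card I) + 1" by linarith
      then have "r \<le> \<delta> + \<delta> * card I" using \<delta> by (simp add: field_simps)
      then have "ennreal r \<le> ennreal (\<delta> + \<delta> * card I)" by (rule ennreal_leI)
      also have "\<dots> = ennreal \<delta> + ?sum" unfolding sum using \<delta> by simp
      finally show ?thesis using r by simp
    qed (use r in simp)
  qed
qed

text \<open>It suffices to compare the two sequences of measures on level sets at positive heights.\<close>

lemma layer_comparison:
  fixes g :: "'a::topological_space \<Rightarrow> ennreal" and M N :: "nat \<Rightarrow> 'a measure" and q C \<epsilon> :: real
  assumes M: "\<And>n. radon_measure (M n)" and N: "\<And>n. radon_measure (N n)"
    and g: "g \<in> borel_measurable borel" and gC: "\<And>x. x \<in> A \<Longrightarrow> g x \<le> ennreal C"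
    and NA: "\<And>n. concentrated_on (N n) A" and q: "0 \<le> q" "\<And>n. mass (N n) \<le> ennreal q"
    and S: "\<And>t. {x. ennreal t < g x} \<subseteq> S t" "\<And>t. S t \<subseteq> {x. ennreal t \<le> g x}"
    and Sb: "\<And>t. S t \<in> sets borel"
    and lev: "\<And>t \<eta>. 0 < t \<Longrightarrow> 0 < \<eta> \<Longrightarrow>
      eventually (\<lambda>n. emeasure (N n) (S t) \<le> emeasure (M n) (S t) + ennreal \<eta>) sequentially"
    and \<epsilon>: "0 < \<epsilon>"
  shows "eventually (\<lambda>n. (\<integral>\<^sup>+x. g x \<partial>N n) \<le> (\<integral>\<^sup>+x. g x \<partial>M n) + ennreal \<epsilon>) sequentially"
proof -
  \<comment> \<open>the step size costs \<open>\<delta> q\<close>, and the \<open>K\<close> levels together cost \<open>K \<delta> \<eta>\<close>\<close>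
  define \<delta> where "\<delta> = \<epsilon> / (2 * (q + 1))"
  have \<delta>: "0 < \<delta>" using \<epsilon> q by (simp add: \<delta>_def)
  obtain K :: nat where "C / \<delta> \<le> K" using real_arch_simple by blast
  then have K: "C \<le> K * \<delta>" using \<delta> by (simp add: field_simps)
  define \<eta> where "\<eta> = \<epsilon> / (2 * (K * \<delta> + 1))"
  have Kd: "0 \<le> K * \<delta>" using \<delta> by simp
  have \<eta>: "0 < \<eta>" using \<epsilon> Kd by (simp add: \<eta>_def)
  have small: "\<delta> * q + K * (\<delta> * \<eta>) \<le> \<epsilon>"
  proof -
    have "\<delta> * q \<le> \<epsilon> / 2" using \<epsilon> q by (simp add: \<delta>_def field_simps)
    moreover have "(K * \<delta>) * \<eta> \<le> \<epsilon> / 2"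
      using \<epsilon> Kd unfolding \<eta>_def by (simp add: field_simps)
    ultimately show ?thesis by (simp add: mult.assoc)
  qed
  have int: "(\<integral>\<^sup>+x. (\<Sum>k\<in>{1..K}. ennreal \<delta> * indicator (S (k * \<delta>)) x) \<partial>R)
      = (\<Sum>k\<in>{1..K}. ennreal \<delta> * emeasure R (S (k * \<delta>)))" if "radon_measure R" for R
    using that Sb by (subst nn_integral_sum) (auto simp: nn_integral_cmult_indicator radon_measurable_cong)
  have "eventually (\<lambda>n. \<forall>k\<in>{1..K}. emeasure (N n) (S (k * \<delta>)) \<le> emeasure (M n) (S (k * \<delta>)) + ennreal \<eta>) sequentially"
    using lev \<delta> \<eta> by (intro eventually_ball_finite) auto
  then show ?thesis
  proof eventually_elim
    case (elim n)
    have AEA: "AE x in N n. x \<in> A" by (rule concentrated_on_AE[OF NA])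
    have "(\<integral>\<^sup>+x. g x \<partial>N n) \<le> (\<integral>\<^sup>+x. ennreal \<delta> + (\<Sum>k\<in>{1..K}. ennreal \<delta> * indicator (S (k * \<delta>)) x) \<partial>N n)"
      by (rule nn_integral_mono_AE, rule eventually_mono[OF AEA]) (rule layer_bounds(2)[OF \<delta> K S gC])
    also have "\<dots> = ennreal \<delta> * mass (N n) + (\<Sum>k\<in>{1..K}. ennreal \<delta> * emeasure (N n) (S (k * \<delta>)))"
      unfolding int[OF N, symmetric] using N[of n] Sb by (subst nn_integral_add) (auto simp: radon_measurable_cong)
    also have "\<dots> \<le> ennreal \<delta> * ennreal q +
        (\<Sum>k\<in>{1..K}. ennreal \<delta> * (emeasure (M n) (S (k * \<delta>)) + ennreal \<eta>))"
      using elim q(2)[of n] by (intro add_mono sum_mono mult_left_mono) auto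
    also have "\<dots> = (\<Sum>k\<in>{1..K}. ennreal \<delta> * emeasure (M n) (S (k * \<delta>))) + ennreal (\<delta> * q + K * (\<delta> * \<eta>))"
      using \<delta> \<eta> q(1) by (simp add: distrib_left sum.distrib ennreal_mult ennreal_of_nat_eq_real_of_nat ac_simps)
    also have "\<dots> \<le> (\<Sum>k\<in>{1..K}. ennreal \<delta> * emeasure (M n) (S (k * \<delta>))) + ennreal \<epsilon>"
      using small by (intro add_mono ennreal_leI) auto
    also have "(\<Sum>k\<in>{1..K}. ennreal \<delta> * emeasure (M n) (S (k * \<delta>))) \<le> (\<integral>\<^sup>+x. g x \<partial>M n)"
      unfolding int[OF M, symmetric] by (rule nn_integral_mono) (rule layer_bounds(1)[OF \<delta> K S])
    finally show ?case by (simp add: add_right_mono)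
  qed
qed

section \<open>The Gauss functional\<close>

locale gauss_problem = perfect_kernel_space \<kappa>
  for \<kappa> :: "'a::{t2_space, second_countable_topology} \<times> 'a \<Rightarrow> ennreal" +
  fixes A :: "'a set" and \<omega> :: "'a signed_measure" and h :: real
  assumes strongly_closed: "closedin (strong_topology \<kappa>) (of_positive ` energy_cone \<kappa> A)"
    and omega_radon: "signed_radon \<omega>"
    and pos_usc: "\<And>K. compact K \<Longrightarrow> K \<subseteq> A \<Longrightarrow> upper_semicontinuous_on K (potential \<kappa> (pos_part \<omega>))"
    and bounded: "(SUP x\<in>A. potential \<kappa> (total_variation \<omega>) x) < \<infinity>"
    and ugaheri: "h \<ge> 1" "ugaheri_maximum_principle h \<kappa>"
    and vanishing: "\<And>Q \<epsilon>. compact Q \<Longrightarrow> \<epsilon> > 0 \<Longrightarrow>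
              \<exists>Q'. compact Q' \<and> (\<forall>x\<in>Q. \<forall>y. y \<notin> Q' \<longrightarrow> \<kappa> (x, y) < ennreal \<epsilon>)"
    and compact_support: "compact (measure_support (total_variation \<omega>))"
begin

abbreviation "up \<equiv> U (pos_part \<omega>)"
abbreviation "un \<equiv> U (neg_part \<omega>)"

definition field :: "'a \<Rightarrow> ereal" where "field x = - signed_potential \<kappa> \<omega> x"

abbreviation rfield :: "'a \<Rightarrow> real" where "rfield x \<equiv> real_of_ereal (field x)"

definition l :: "'a measure \<Rightarrow> real" where "l M = (LINT x|M. rfield x)"

abbreviation "EA \<equiv> energy_cone \<kappa> A"
abbreviation "fcone \<equiv> field_cone \<kappa> field A"
abbreviation "unit_cone \<equiv> unit_field_cone \<kappa> field A"
abbreviation "bal \<equiv> pseudo_balayage \<kappa> \<omega> A"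
abbreviation J :: "'a measure \<Rightarrow> real" where "J \<equiv> gauss_functional \<kappa> field"

lemma J_eq: "J M = e M M + 2 * l M"
  by (simp add: gauss_functional_def e_def l_def)

lemmas omega = signed_radonD[OF omega_radon]

lemma up_measurable [measurable]: "up \<in> borel_measurable borel"
  and un_measurable [measurable]: "un \<in> borel_measurable borel"
  by (auto intro!: potential_measurable omega)

definition C :: real where "C = enn2real (SUP x\<in>A. U (total_variation \<omega>) x)"

lemma C_nonneg: "0 \<le> C" by (simp add: C_def)

lemma potentials_le_C:
  assumes "x \<in> A"
  shows "up x \<le> ennreal C" "un x \<le> ennreal C"
proof -
  have "up x + un x = U (total_variation \<omega>) x"
    unfolding total_variation_eq by (rule potential_add[symmetric]) (rule omega)+
  also have "\<dots> \<le> (SUP x\<in>A. U (total_variation \<omega>) x)" by (rule SUP_upper[OF assms])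
  also have "\<dots> = ennreal C" using bounded by (simp add: C_def)
  finally have s: "up x + un x \<le> ennreal C" .
  show "up x \<le> ennreal C" by (rule order_trans[OF _ s]) simp
  show "un x \<le> ennreal C" by (rule order_trans[OF _ s]) simp
qed

lemma support_null:
  "emeasure (pos_part \<omega>) (- measure_support (total_variation \<omega>)) = 0"
  "emeasure (neg_part \<omega>) (- measure_support (total_variation \<omega>)) = 0"
  "mass (pos_part \<omega>) < \<infinity>" "mass (neg_part \<omega>) < \<infinity>"
proof -
  let ?S = "measure_support (total_variation \<omega>)"
  have S: "?S \<in> sets borel" using compact_support by simp
  have z: "emeasure (pos_part \<omega>) (- ?S) + emeasure (neg_part \<omega>) (- ?S) = 0"
    using emeasure_compl_support[of "total_variation \<omega>"] omega unfolding total_variation_eq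
    by (simp add: emeasure_add_measure)
  then show z1: "emeasure (pos_part \<omega>) (- ?S) = 0" and z2: "emeasure (neg_part \<omega>) (- ?S) = 0" by auto
  have "mass R < \<infinity>" if "radon_measure R" "emeasure R (- ?S) = 0" for R
    using concentrated_mass[OF that(1) S] that S radon_compact_finite[OF that(1) compact_support]
    by (simp add: concentrated_on_borel)
  then show "mass (pos_part \<omega>) < \<infinity>" "mass (neg_part \<omega>) < \<infinity>" using omega z1 z2 by auto
qed

text \<open>The two parts of \<open>\<omega>\<close> are finite and carried by a compact set, on which the kernel is uniformly
  small when its other argument is far away.\<close>

lemma potentials_vanish:
  assumes t: "0 < t"
  obtains Q where "compact Q" "{x. ennreal t \<le> up x} \<subseteq> Q" "{x. ennreal t \<le> un x} \<subseteq> Q"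
proof -
  let ?S = "measure_support (total_variation \<omega>)"
  obtain m where m: "0 \<le> m" "mass (pos_part \<omega>) \<le> ennreal m" "mass (neg_part \<omega>) \<le> ennreal m"
  proof (rule that[of "enn2real (mass (pos_part \<omega>) + mass (neg_part \<omega>))"])
  qed (use support_null in \<open>auto simp: less_top[symmetric]\<close>)
  define \<epsilon> where "\<epsilon> = t / (2 * (m + 1))"
  have \<epsilon>: "0 < \<epsilon>" using t m by (simp add: \<epsilon>_def)
  have \<epsilon>m: "\<epsilon> * m < t" using t m by (simp add: \<epsilon>_def field_simps add_nonneg_pos)
  obtain Q where Q: "compact Q" "\<And>x y. x \<in> ?S \<Longrightarrow> y \<notin> Q \<Longrightarrow> \<kappa> (x, y) < ennreal \<epsilon>"
    using vanishing[OF compact_support \<epsilon>] by blast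
  have small: "U R y < ennreal t"
    if y: "y \<notin> Q" and R: "radon_measure R" "emeasure R (- ?S) = 0" "mass R \<le> ennreal m" for y R
  proof -
    have "- ?S \<in> null_sets R" using R compact_support by (auto simp: null_sets_def)
    from AE_not_in[OF this] have "AE x in R. \<kappa> (y, x) \<le> ennreal \<epsilon>"
      by eventually_elim (use Q(2)[OF _ y] in \<open>auto simp: kernel_sym[of y] intro: less_imp_le\<close>)
    then have "U R y \<le> (\<integral>\<^sup>+x. ennreal \<epsilon> \<partial>R)"
      unfolding potential_def by (rule nn_integral_mono_AE)
    also have "\<dots> \<le> ennreal \<epsilon> * ennreal m" using R by (simp add: mult_left_mono)
    also have "\<dots> < ennreal t" using \<epsilon> m \<epsilon>m t by (simp add: ennreal_less_iff flip: ennreal_mult)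
    finally show ?thesis .
  qed
  show thesis
    by (rule that[OF Q(1)])
       (use small[OF _ omega(1) support_null(1) m(2)] small[OF _ omega(2) support_null(2) m(3)] in \<open>auto simp: not_less[symmetric]\<close>)
qed

lemma field_measurable: "rfield \<in> borel_measurable borel"
  unfolding field_def signed_potential_def by measurable

lemma field_on_A:
  assumes "x \<in> A"
  shows "\<bar>field x\<bar> \<noteq> \<infinity>" "rfield x = enn2real (un x) - enn2real (up x)"
  using potentials_le_C[OF assms] unfolding field_def signed_potential_def
  by (cases "up x"; cases "un x"; auto simp: top_unique enn2ereal_ennreal)+

lemma field_cone_iff:
  "M \<in> fcone \<longleftrightarrow> M \<in> EA \<and> integrable M rfield"
proof -
  have "AE x in M. \<bar>field x\<bar> \<noteq> \<infinity>" if "M \<in> EA"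
    using concentrated_on_AE[OF cone_concentrated[OF that]] by eventually_elim (rule field_on_A)
  then show ?thesis by (auto simp: field_cone_def ext_integrable_def)
qed

lemma field_cone_mix:
  assumes "M \<in> fcone" "N \<in> fcone" "0 \<le> t" "t \<le> 1"
  shows "mix t M N \<in> fcone" "l (mix t M N) = (1 - t) * l M + t * l N"
  using assms unfolding l_def field_cone_iff
  by (auto intro!: mix_cone integral_mix field_measurable simp: cone_radon)

lemma field_cone_E: "M \<in> fcone \<Longrightarrow> M \<in> E"
  unfolding field_cone_iff by (auto intro: cone_E)

lemma J_mix:
  assumes M: "M \<in> fcone" and N: "N \<in> fcone" and t: "0 \<le> t" "t \<le> 1"
  shows "J (mix t M N) = (1 - t) * J M + t * J N - t * (1 - t) * D2 M N"
  using field_cone_mix[OF assms] e_mix[OF field_cone_E[OF M] field_cone_E[OF N] t]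
  by (simp add: J_eq D2_def algebra_simps power2_eq_square)

lemma J_mix_le:
  assumes M: "M \<in> fcone" and N: "N \<in> fcone" and t: "0 \<le> t" "t \<le> 1"
  shows "J (mix t M N) \<le> (1 - t) * J M + t * J N"
  unfolding J_mix[OF assms] using D2_nonneg[OF field_cone_E[OF M] field_cone_E[OF N]] t by simp

text \<open>Strict convexity: at the midpoint \<open>J\<close> falls below its average by a quarter of \<open>D2 M N\<close>.\<close>

lemma minimizer_unique:
  assumes M: "M \<in> fcone" and N: "N \<in> fcone"
    and le: "J M \<le> J (mix (1/2) M N)" "J N \<le> J (mix (1/2) M N)"
  shows "M = N"
proof -
  have "D2 M N \<le> 0" using J_mix[OF M N, of "1/2"] le by simp
  with D2_nonneg[OF field_cone_E[OF M] field_cone_E[OF N]] show ?thesis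
    by (intro D2_eq_0 field_cone_E[OF M] field_cone_E[OF N]) simp
qed

lemma finite_mass_integrals:
  assumes M: "M \<in> EA" and q: "mass M \<le> ennreal q" "0 \<le> q"
  shows "M \<in> fcone"
    "(\<integral>\<^sup>+x. up x \<partial>M) \<le> ennreal (C * q)" "(\<integral>\<^sup>+x. un x \<partial>M) \<le> ennreal (C * q)"
    "l M = enn2real (\<integral>\<^sup>+x. un x \<partial>M) - enn2real (\<integral>\<^sup>+x. up x \<partial>M)"
proof -
  note rM = cone_radon[OF M]
  have AEA: "AE x in M. x \<in> A" by (rule concentrated_on_AE[OF cone_concentrated[OF M]])
  have bound: "(\<integral>\<^sup>+x. g x \<partial>M) \<le> ennreal (C * q)" if "\<And>x. x \<in> A \<Longrightarrow> g x \<le> ennreal C" for g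
  proof -
    have "(\<integral>\<^sup>+x. g x \<partial>M) \<le> (\<integral>\<^sup>+x. ennreal C \<partial>M)"
      by (rule nn_integral_mono_AE, rule eventually_mono[OF AEA]) (rule that)
    also have "\<dots> \<le> ennreal C * ennreal q" using rM q by (simp add: mult_left_mono)
    finally show ?thesis using C_nonneg q by (simp add: ennreal_mult)
  qed
  show up: "(\<integral>\<^sup>+x. up x \<partial>M) \<le> ennreal (C * q)" and un: "(\<integral>\<^sup>+x. un x \<partial>M) \<le> ennreal (C * q)"
    by (auto intro!: bound potentials_le_C)
  have part: "integrable M (\<lambda>x. enn2real (g x))" "(LINT x|M. enn2real (g x)) = enn2real (\<integral>\<^sup>+x. g x \<partial>M)"
    if g: "\<And>x. x \<in> A \<Longrightarrow> g x \<le> ennreal C" "g \<in> borel_measurable borel" for g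
  proof -
    have eq: "(\<integral>\<^sup>+x. ennreal (enn2real (g x)) \<partial>M) = (\<integral>\<^sup>+x. g x \<partial>M)"
    proof (rule nn_integral_cong_AE, rule eventually_mono[OF AEA])
      fix x assume "x \<in> A"
      then have "g x < top" using g(1)[of x] by (auto simp: order.strict_trans1)
      then show "ennreal (enn2real (g x)) = g x" by simp
    qed
    have "(\<integral>\<^sup>+x. g x \<partial>M) < \<infinity>" using order.strict_trans1[OF bound[of g, OF g(1)]] by simp
    with eq show i: "integrable M (\<lambda>x. enn2real (g x))"
      using g(2) rM by (intro integrableI_nonneg) (auto simp: radon_measurable_cong)
    show "(LINT x|M. enn2real (g x)) = enn2real (\<integral>\<^sup>+x. g x \<partial>M)"
      using i by (subst integral_eq_nn_integral) (auto simp: eq)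
  qed
  have pu: "integrable M (\<lambda>x. enn2real (un x) - enn2real (up x))"
    "(LINT x|M. enn2real (un x) - enn2real (up x)) = enn2real (\<integral>\<^sup>+x. un x \<partial>M) - enn2real (\<integral>\<^sup>+x. up x \<partial>M)"
    using part[of up] part[of un] potentials_le_C by auto
  have AEeq: "AE x in M. rfield x = enn2real (un x) - enn2real (up x)"
    by (rule eventually_mono[OF AEA]) (rule field_on_A)
  have m1: "rfield \<in> borel_measurable M"
    "(\<lambda>x. enn2real (un x) - enn2real (up x)) \<in> borel_measurable M"
    using field_measurable pu(1) rM by (auto simp: radon_measurable_cong)
  show "M \<in> fcone"
    unfolding field_cone_iff using M pu(1) integrable_cong_AE[OF m1 AEeq] by simp
  show "l M = enn2real (\<integral>\<^sup>+x. un x \<partial>M) - enn2real (\<integral>\<^sup>+x. up x \<partial>M)"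
    unfolding l_def using integral_cong_AE[OF m1 AEeq] pu(2) by simp
qed

text \<open>Since the potential of the positive part is upper semicontinuous along sequences converging inside
  \<open>A\<close>, its superlevel sets are relatively closed in \<open>A\<close>, and by the decay at infinity
  their closures are compact. As all measures live on \<open>A\<close>, the inequality for compact sets
  under vague limits applies to the superlevel sets themselves.\<close>

lemma superlevel_limit:
  assumes s: "strong_limit M R" and M: "\<And>n. M n \<in> EA" and t: "0 < t"
    and c: "emeasure R {x. ennreal t \<le> up x} < c"
  shows "eventually (\<lambda>n. emeasure (M n) {x. ennreal t \<le> up x} < c) sequentially"
proof -
  have RA: "R \<in> EA" by (rule strong_closed[OF strongly_closed s M])
  let ?B = "{x. ennreal t \<le> up x}"
  define F where "F = closure (?B \<inter> A)"
  have Bb: "?B \<in> sets borel" by measurable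
  obtain Q where Q: "compact Q" "?B \<subseteq> Q" using potentials_vanish[OF t] by metis
  have FQ: "F \<subseteq> Q" unfolding F_def using Q compact_imp_closed[OF Q(1)] by (intro closure_minimal) auto
  have "compact (Q \<inter> F)" using Q(1) unfolding F_def by (intro compact_Int_closed closed_closure)
  then have cF: "compact F" using FQ by (simp add: Int_absorb1)
  have FA: "F \<inter> A \<subseteq> ?B"
  proof
    fix x assume x: "x \<in> F \<inter> A"
    then have "x \<in> closure (?B \<inter> A)" by (simp add: F_def)
    then obtain y where y: "\<And>n. y n \<in> ?B \<inter> A" "y \<longlonglongrightarrow> x" unfolding closure_sequential by metis
    let ?K = "insert x (range y)"
    have "compact ?K"
      using compactin_sequence_with_limit[of euclidean y x "range y"] y(2) by (simp add: limitin_canonical_iff)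
    moreover have "?K \<subseteq> A" using x y(1) by auto
    ultimately have usc: "upper_semicontinuous_on ?K up" by (rule pos_usc)
    show "x \<in> ?B"
    proof (rule ccontr)
      assume "x \<notin> ?B"
      then have xt: "up x < ennreal t" by simp
      have "openin (top_of_set ?K) {z \<in> ?K. up z < ennreal t}" using usc by (simp add: upper_semicontinuous_on_def)
      then obtain W where W: "open W" "{z \<in> ?K. up z < ennreal t} = ?K \<inter> W" by (auto simp: openin_open)
      have "x \<in> ?K \<inter> W" using xt unfolding W(2)[symmetric] by simp
      then have "x \<in> W" by simp
      then obtain n where "y n \<in> W" using y(2) W(1) unfolding tendsto_def by (meson eventually_sequentially order_refl)
      then have "y n \<in> ?K \<inter> W" by simp
      then have "up (y n) < ennreal t" unfolding W(2)[symmetric] by simp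
      with y(1)[of n] show False by (auto dest: leD)
    qed
  qed
  have AEle: "emeasure T X \<le> emeasure T Y"
    if T: "T \<in> EA" and "X \<in> sets borel" "Y \<in> sets borel" "X \<inter> A \<subseteq> Y" for T X Y
    by (rule emeasure_mono_AE, rule eventually_mono[OF concentrated_on_AE[OF cone_concentrated[OF T]]])
       (use that in \<open>auto simp: cone_radon\<close>)
  have "emeasure R F \<le> emeasure R ?B" by (rule AEle[OF RA]) (use cF Bb FA in auto)
  then have "emeasure R F < c" using c by simp
  from vague_limit_compact[OF cone_radon[OF M] cone_radon[OF RA] strong_vague[OF s] cF this]
  show ?thesis
  proof eventually_elim
    case (elim n)
    have "emeasure (M n) ?B \<le> emeasure (M n) F"
      by (rule AEle[OF M]) (use cF Bb closure_subset[of "?B \<inter> A"] in \<open>auto simp: F_def\<close>)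
    then show ?case using elim by simp
  qed
qed

text \<open>The potential of the negative part is lower semicontinuous on the whole space, so its integral is
  too. The opposite inequality, needed for the positive part, rests on the preceding lemma.\<close>

lemma field_lsc:
  assumes s: "strong_limit M R" and M: "\<And>n. M n \<in> EA"
    and q: "0 \<le> q" "\<And>n. mass (M n) \<le> ennreal q" and \<epsilon>: "0 < \<epsilon>"
  shows "eventually (\<lambda>n. l R \<le> l (M n) + \<epsilon>) sequentially"
proof -
  have RA: "R \<in> EA" by (rule strong_closed[OF strongly_closed s M])
  have Rq: "mass R \<le> ennreal q" by (rule strong_limit_mass_le[OF s q(2)])
  have Rfin: "emeasure R B < \<infinity>" for B
    using emeasure_space[of R B] Rq cone_radon[OF RA] by (auto simp: order.strict_trans1)
  have \<epsilon>2: "0 < \<epsilon> / 2" using \<epsilon> by simp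
  have U: "eventually (\<lambda>n. (\<integral>\<^sup>+x. up x \<partial>M n) \<le> (\<integral>\<^sup>+x. up x \<partial>R) + ennreal (\<epsilon> / 2)) sequentially"
  proof (rule layer_comparison[where M = "\<lambda>_. R" and S = "\<lambda>t. {x. ennreal t \<le> up x}" and A = A and C = C and q = q])
    fix t \<eta> :: real assume t: "0 < t" and \<eta>: "0 < \<eta>"
    have "emeasure R {x. ennreal t \<le> up x} < emeasure R {x. ennreal t \<le> up x} + ennreal \<eta>"
      using Rfin[of "{x. ennreal t \<le> up x}"] \<eta> by (simp add: ennreal_add_left_cancel_less)
    from superlevel_limit[OF s M t this]
    show "eventually (\<lambda>n. emeasure (M n) {x. ennreal t \<le> up x} \<le> emeasure R {x. ennreal t \<le> up x} + ennreal \<eta>) sequentially"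
      by eventually_elim simp
  qed (use cone_radon[OF M] cone_concentrated[OF M] cone_radon[OF RA] q \<epsilon>2 potentials_le_C in auto)
  have L: "eventually (\<lambda>n. (\<integral>\<^sup>+x. un x \<partial>R) \<le> (\<integral>\<^sup>+x. un x \<partial>M n) + ennreal (\<epsilon> / 2)) sequentially"
  proof (rule layer_comparison[where N = "\<lambda>_. R" and S = "\<lambda>t. {x. ennreal t < un x}" and A = A and C = C and q = q])
    fix t \<eta> :: real assume t: "0 < t" and \<eta>: "0 < \<eta>"
    let ?S = "{x. ennreal t < un x}"
    show "eventually (\<lambda>n. emeasure R ?S \<le> emeasure (M n) ?S + ennreal \<eta>) sequentially"
    proof (cases "emeasure R ?S \<le> ennreal \<eta>")
      case True
      then show ?thesis by (intro always_eventually) (auto intro: add_increasing)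
    next
      case False
      have "emeasure R ?S - ennreal \<eta> < emeasure R ?S"
        using False Rfin[of ?S] \<eta> by (intro ennreal_between) (auto simp: zero_less_iff_neq_zero)
      moreover have "open ?S" by (rule potential_superlevel_open[OF omega(2)])
      ultimately have "eventually (\<lambda>n. emeasure R ?S - ennreal \<eta> < emeasure (M n) ?S) sequentially"
        by (intro vague_limit_open[OF cone_radon[OF M] cone_radon[OF RA] strong_vague[OF s]])
      then show ?thesis
        by eventually_elim (auto simp: ennreal_minus_le_iff add.commute dest!: less_imp_le)
    qed
  qed (use cone_radon[OF M] cone_concentrated[OF RA] cone_radon[OF RA] q Rq \<epsilon>2 potentials_le_C in auto)
  show ?thesis
    using eventually_conj[OF U L]
  proof eventually_elim
    case (elim n)
    note fM = finite_mass_integrals[OF M[of n] q(2)[of n] q(1)] and fR = finite_mass_integrals[OF RA Rq q(1)]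
    have fin: "(\<integral>\<^sup>+x. up x \<partial>M n) < \<infinity>" "(\<integral>\<^sup>+x. un x \<partial>M n) < \<infinity>" "(\<integral>\<^sup>+x. up x \<partial>R) < \<infinity>" "(\<integral>\<^sup>+x. un x \<partial>R) < \<infinity>"
      using fM(2,3) fR(2,3) by (auto simp: order.strict_trans1)
    have "enn2real (\<integral>\<^sup>+x. up x \<partial>M n) \<le> enn2real (\<integral>\<^sup>+x. up x \<partial>R) + \<epsilon> / 2"
      using elim fin \<epsilon>2 enn2real_mono[of "\<integral>\<^sup>+x. up x \<partial>M n" "(\<integral>\<^sup>+x. up x \<partial>R) + ennreal (\<epsilon> / 2)"]
      by (simp add: enn2real_plus)
    moreover have "enn2real (\<integral>\<^sup>+x. un x \<partial>R) \<le> enn2real (\<integral>\<^sup>+x. un x \<partial>M n) + \<epsilon> / 2"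
      using elim fin \<epsilon>2 enn2real_mono[of "\<integral>\<^sup>+x. un x \<partial>R" "(\<integral>\<^sup>+x. un x \<partial>M n) + ennreal (\<epsilon> / 2)"]
      by (simp add: enn2real_plus)
    ultimately show ?case unfolding fM(4) fR(4) by simp
  qed
qed

lemma field_lower_bound:
  assumes M: "M \<in> EA" and q: "mass M \<le> ennreal q" "0 \<le> q"
  shows "- 2 * (C * q) \<le> J M"
proof -
  note f = finite_mass_integrals[OF M q]
  have "enn2real (\<integral>\<^sup>+x. up x \<partial>M) \<le> C * q" using enn2real_mono[OF f(2)] C_nonneg q(2) by simp
  then have "- (C * q) \<le> l M" unfolding f(4) using enn2real_nonneg[of "\<integral>\<^sup>+x. un x \<partial>M"] by linarith
  then show ?thesis unfolding J_eq using e_nonneg[of M M] by linarith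
qed

lemma gauss_minimizer_exists:
  assumes G: "G \<subseteq> {M \<in> EA. mass M \<le> ennreal q}" and q: "0 \<le> q" and ne: "G \<noteq> {}"
    and mid: "\<And>M N. M \<in> G \<Longrightarrow> N \<in> G \<Longrightarrow> mix (1/2) M N \<in> G"
    and closed: "\<And>M N. (\<And>n. M n \<in> G) \<Longrightarrow> strong_limit M N \<Longrightarrow> N \<in> G"
  obtains L where "L \<in> G" "\<And>R. R \<in> G \<Longrightarrow> J L \<le> J R"
proof -
  have Gq: "M \<in> EA" "mass M \<le> ennreal q" if "M \<in> G" for M using that G by auto
  have Gf: "M \<in> fcone" if "M \<in> G" for M
    using finite_mass_integrals(1)[OF Gq[OF that] q] .
  obtain L where "L \<in> G" "\<And>R. R \<in> G \<Longrightarrow> e L L + 2 * l L \<le> e R R + 2 * l R"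
  proof (rule minimizer_exists[of G l "- 2 * (C * q)"])
    show "G \<subseteq> E" using Gq(1) cone_E by auto
    show "l (mix (1/2) M N) = (l M + l N) / 2" if "M \<in> G" "N \<in> G" for M N
      using field_cone_mix(2)[OF Gf[OF that(1)] Gf[OF that(2)], of "1/2"] by (simp add: field_simps)
    show "- 2 * (C * q) \<le> e M M + 2 * l M" if "M \<in> G" for M
      using field_lower_bound[OF Gq[OF that] q] by (simp add: J_eq)
    show "eventually (\<lambda>n. l N \<le> l (M n) + \<epsilon>) sequentially"
      if "\<And>n. M n \<in> G" "strong_limit M N" "0 < \<epsilon>" for M N \<epsilon>
      by (rule field_lsc[OF that(2) Gq(1)[OF that(1)] q Gq(2)[OF that(1)] that(3)])
    show "N \<in> G" if "\<And>n. M n \<in> G" "strong_limit M N" for M N by (rule closed[OF that])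
  qed (use ne mid that in auto)
  with that show thesis by (simp add: J_eq)
qed

definition mass_cone :: "real \<Rightarrow> 'a measure set" where
  "mass_cone q = {M \<in> EA. mass M \<le> ennreal q}"

lemma mass_cone_mix:
  assumes "M \<in> mass_cone q" "N \<in> mass_cone q" "0 \<le> t" "t \<le> 1"
  shows "mix t M N \<in> mass_cone q"
  using assms by (auto simp: mass_cone_def cone_radon intro!: mix_cone mix_mass_le)

lemma mass_cone_field: "M \<in> mass_cone q \<Longrightarrow> 0 \<le> q \<Longrightarrow> M \<in> fcone"
  unfolding mass_cone_def using finite_mass_integrals(1) by blast

lemma mass_cone_minimizer:
  assumes q: "0 \<le> q"
  obtains L where "L \<in> mass_cone q" "\<And>R. R \<in> mass_cone q \<Longrightarrow> J L \<le> J R"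
proof (rule gauss_minimizer_exists[of "mass_cone q" q])
  show "mass_cone q \<noteq> {}" using cone_null[of A] by (auto simp: mass_cone_def)
  show "N \<in> mass_cone q" if "\<And>n. M n \<in> mass_cone q" "strong_limit M N" for M N
    using that strong_closed[OF strongly_closed that(2)] strong_limit_mass_le[OF that(2), of "ennreal q"]
    by (simp add: mass_cone_def)
qed (use q mass_cone_mix[of _ q _ "1/2"] that in \<open>auto simp: mass_cone_def\<close>)

text \<open>Removing from a minimizer the part lying where \<open>U\<^sup>L\<close> exceeds the potential of the
  positive part does not increase the mass, so the first variation in that direction is nonnegative,
  which forces the removed part to vanish.\<close>

lemma minimizer_potential_le:
  assumes q: "0 \<le> q" and L: "L \<in> mass_cone q" and min: "\<And>R. R \<in> mass_cone q \<Longrightarrow> J L \<le> J R"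
  shows "AE x in L. U L x \<le> up x"
proof (rule ccontr)
  assume neg: "\<not> ?thesis"
  have LA: "L \<in> EA" and Lq: "mass L \<le> ennreal q" using L by (auto simp: mass_cone_def)
  note rL = cone_radon[OF LA]
  note [measurable] = potential_measurable[OF rL]
  define B where "B = {x. up x < U L x}"
  have B: "B \<in> sets borel" "- B \<in> sets borel" unfolding B_def by measurable
  define b where "b = restr L B"
  define N where "N = restr L (- B)"
  have split: "L = add_measure b N" unfolding b_def N_def by (rule restrict_split[OF rL B(1)])
  have bA: "b \<in> EA" and NA: "N \<in> EA"
    unfolding b_def N_def by (auto intro!: cone_restrict[OF LA] B)
  have le: "mass b \<le> mass L" "mass N \<le> mass L"
    unfolding b_def N_def using rL B by (auto simp: emeasure_restrict intro!: emeasure_mono)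
  have bq: "mass b \<le> ennreal q" and Nq: "mass N \<le> ennreal q" using le Lq by auto
  have Nm: "N \<in> mass_cone q" using NA Nq by (simp add: mass_cone_def)
  note fb = finite_mass_integrals[OF bA bq q] and fN = finite_mass_integrals[OF NA Nq q]
  have "e L L + l L \<le> e L N + l N"
  proof (rule first_variation[OF cone_E[OF LA] cone_E[OF NA]])
    show "l (mix t L N) = (1 - t) * l L + t * l N" if "0 \<le> t" "t \<le> 1" for t
      by (rule field_cone_mix(2)[OF mass_cone_field[OF L q] mass_cone_field[OF Nm q] that])
    show "e L L + 2 * l L \<le> e (mix t L N) (mix t L N) + 2 * l (mix t L N)" if "0 \<le> t" "t \<le> 1" for t
      using min[OF mass_cone_mix[OF L Nm that]] by (simp add: J_eq)
  qed
  moreover have "e L L = e L b + e L N"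
    using e_add(2)[OF cone_E[OF bA] cone_E[OF NA] cone_E[OF LA]] split by simp
  moreover have "l L = l b + l N"
    using integral_add_measure(2)[OF _ _ field_measurable, of b N] fb(1) fN(1) cone_radon[OF bA] cone_radon[OF NA] split
    by (simp add: l_def field_cone_iff)
  ultimately have "e L b + l b \<le> 0" by linarith
  then have "e L b + enn2real (\<integral>\<^sup>+x. un x \<partial>b) \<le> enn2real (\<integral>\<^sup>+x. up x \<partial>b)" unfolding fb(4) by linarith
  then have "e L b \<le> enn2real (\<integral>\<^sup>+x. up x \<partial>b)"
    using enn2real_nonneg[of "\<integral>\<^sup>+x. un x \<partial>b"] by linarith
  then have "ennreal (e L b) \<le> ennreal (enn2real (\<integral>\<^sup>+x. up x \<partial>b))" by (rule ennreal_leI)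
  also have fin: "(\<integral>\<^sup>+x. up x \<partial>b) < \<infinity>" by (rule order.strict_trans1[OF fb(2)]) simp
  then have "ennreal (enn2real (\<integral>\<^sup>+x. up x \<partial>b)) = (\<integral>\<^sup>+x. up x \<partial>b)" by simp
  also have "ennreal (e L b) = I b L"
    unfolding e_commute[OF cone_E[OF LA] cone_E[OF bA]] by (rule ennreal_e[OF cone_E[OF bA] cone_E[OF LA]])
  also have "\<dots> = (\<integral>\<^sup>+x. U L x \<partial>b)"
    by (rule mutual_energy_potential[OF cone_radon[OF bA] rL])
  finally have key: "(\<integral>\<^sup>+x. U L x \<partial>b) \<le> (\<integral>\<^sup>+x. up x \<partial>b)" .
  have bB: "AE x in b. x \<in> B"
    unfolding b_def using rL B by (subst AE_density) (auto simp: radon_measurable_cong intro!: AE_I2 split: split_indicator)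
  have "(\<integral>\<^sup>+x. up x \<partial>b) < (\<integral>\<^sup>+x. U L x \<partial>b)"
  proof (rule nn_integral_less)
    show "AE x in b. up x \<le> U L x"
      using bB by eventually_elim (auto simp: B_def)
    show "\<not> (AE x in b. U L x \<le> up x)"
    proof
      assume "AE x in b. U L x \<le> up x"
      then have "AE x in L. x \<in> B \<longrightarrow> U L x \<le> up x"
        unfolding b_def using rL B by (subst (asm) AE_density) (auto simp: radon_measurable_cong split: split_indicator_asm)
      then have "AE x in L. U L x \<le> up x"
        by eventually_elim (auto simp: B_def not_less)
      with neg show False by simp
    qed
    show "(\<integral>\<^sup>+x. up x \<partial>b) \<noteq> \<infinity>" using fin by simp
  qed (use cone_radon[OF bA] in \<open>auto simp: radon_measurable_cong\<close>)
  with key show False by simp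
qed

text \<open>The bound on the mass of constrained minimizers does not depend on the constraint; hence a
  constraint chosen beyond it is inactive, and by convexity the minimizer is a global one.\<close>

lemma global_minimizer_exists:
  obtains L where "L \<in> fcone" "mass L < \<infinity>"
    "\<And>R. R \<in> fcone \<Longrightarrow> J L \<le> J R"
proof -
  define m where "m = h * enn2real (mass (pos_part \<omega>))"
  have m: "0 \<le> m" using ugaheri by (simp add: m_def)
  have mP: "ennreal h * mass (pos_part \<omega>) = ennreal m"
    using support_null(3) ugaheri(1) by (simp add: m_def ennreal_mult)
  obtain L where L: "L \<in> mass_cone (m + 1)" "\<And>R. R \<in> mass_cone (m + 1) \<Longrightarrow> J L \<le> J R"
    using mass_cone_minimizer[of "m + 1"] m by auto
  have m1: "0 \<le> m + 1" using m by simp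
  have LA: "L \<in> EA" using L(1) by (simp add: mass_cone_def)
  have Lf: "L \<in> fcone" by (rule mass_cone_field[OF L(1) m1])
  have Lm: "mass L \<le> ennreal m"
    using positivity_of_mass[OF ugaheri(2) cone_E[OF LA] omega(1) minimizer_potential_le[OF m1 L]] mP by simp
  have fin: "J L \<le> J R" if RA: "R \<in> EA" and Rf: "mass R < \<infinity>" for R
  proof -
    obtain r where r: "0 \<le> r" "mass R = ennreal r" using Rf by (cases "mass R") auto
    \<comment> \<open>so close to \<open>L\<close> that the mass does not exceed \<open>m + 1\<close>\<close>
    define t where "t = 1 / (r + 1)"
    have t: "0 < t" "t \<le> 1" "t * r \<le> 1" using r by (auto simp: t_def field_simps)
    have Rc: "R \<in> fcone" using finite_mass_integrals(1)[OF RA _ r(1)] r(2) by simp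
    have "mass (mix t L R) \<le> ennreal (1 - t) * ennreal m + ennreal t * ennreal r"
      using Lm r(2) cone_radon[OF LA] cone_radon[OF RA] by (simp add: emeasure_mix mult_left_mono)
    also have "\<dots> = ennreal ((1 - t) * m + t * r)" using t m r by (simp add: ennreal_mult)
    also have "\<dots> \<le> ennreal (m + 1)"
    proof (rule ennreal_leI)
      have "(1 - t) * m \<le> m" using t m by (simp add: mult_left_le_one_le)
      then show "(1 - t) * m + t * r \<le> m + 1" using t(3) by linarith
    qed
    finally have "mix t L R \<in> mass_cone (m + 1)" using mix_cone[OF LA RA] by (simp add: mass_cone_def)
    then have "J L \<le> J (mix t L R)" by (rule L(2))
    also have "\<dots> \<le> (1 - t) * J L + t * J R" by (rule J_mix_le[OF Lf Rc]) (use t in auto)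
    finally have "t * J L \<le> t * J R" by (simp add: algebra_simps)
    then show ?thesis using t(1) by simp
  qed
  \<comment> \<open>a measure of infinite mass is approximated by its restrictions to compact sets\<close>
  have glob: "J L \<le> J R" if R: "R \<in> fcone" for R
  proof -
    have RA: "R \<in> EA" and i: "integrable R rfield"
      using R by (auto simp: field_cone_iff)
    note rR = cone_radon[OF RA]
    obtain Q :: "nat \<Rightarrow> 'a set" where Q: "\<And>n. compact (Q n)" "incseq Q" "(\<Union>n. Q n) = UNIV"
      using compact_exhaustion by metis
    have Qb: "Q n \<in> sets borel" for n using Q(1)[of n] by simp
    define T where "T n = restr R (Q n)" for n
    have TA: "T n \<in> EA" for n unfolding T_def by (rule cone_restrict[OF RA Qb])
    have Tf: "mass (T n) < \<infinity>" for n
      unfolding T_def using radon_compact_finite[OF rR Q(1)[of n]] rR Qb by (simp add: emeasure_restrict)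
    have Te: "e (T n) (T n) \<le> e R R" for n unfolding T_def by (rule e_restrict_le[OF cone_E[OF RA] Qb])
    have Tl: "l (T n) = (LINT x|R. indicator (Q n) x * rfield x)" for n
    proof -
      have "(LINT x|density R (\<lambda>x. ennreal (indicator (Q n) x)). rfield x) =
          (LINT x|R. indicator (Q n) x *\<^sub>R rfield x)"
        using rR Qb field_measurable by (intro integral_density) (auto simp: radon_measurable_cong)
      then show ?thesis by (simp add: l_def T_def ennreal_indicator)
    qed
    have "(\<lambda>n. l (T n)) \<longlonglongrightarrow> l R"
      unfolding Tl unfolding l_def
    proof (rule integral_dominated_convergence[where w = "\<lambda>x. norm (rfield x)"])
      show "AE x in R. (\<lambda>n. indicator (Q n) x * rfield x) \<longlonglongrightarrow> rfield x"
      proof (rule AE_I2)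
        fix x
        obtain n0 where "x \<in> Q n0" using Q(3) by auto
        then have "eventually (\<lambda>n. indicator (Q n) x * rfield x = rfield x) sequentially"
          using Q(2) by (auto simp: eventually_sequentially incseq_def subset_iff intro!: exI[of _ n0])
        then show "(\<lambda>n. indicator (Q n) x * rfield x) \<longlonglongrightarrow> rfield x"
          by (rule tendsto_eventually)
      qed
      show "integrable R (\<lambda>x. norm (rfield x))" using i by (rule integrable_norm)
      show "AE x in R. norm (indicator (Q n) x * rfield x) \<le> norm (rfield x)" for n
        by (intro AE_I2) (simp add: indicator_def real_of_ereal_pos)
    qed (use rR Qb field_measurable in \<open>auto simp: radon_measurable_cong\<close>)
    then have "(\<lambda>n. e R R + 2 * l (T n)) \<longlonglongrightarrow> e R R + 2 * l R" by (intro tendsto_intros)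
    moreover have "J L \<le> e R R + 2 * l (T n)" for n
      using fin[OF TA Tf, of n] Te[of n] unfolding J_eq by linarith
    ultimately show ?thesis unfolding J_eq[of R] by (intro LIMSEQ_le_const) auto
  qed
  have "mass L < \<infinity>" by (rule order.strict_trans1[OF Lm]) simp
  with Lf glob that show thesis by blast
qed

lemma pseudo_balayage_minimizer:
  shows "bal \<in> fcone" "mass (bal) < \<infinity>"
    "\<And>R. R \<in> fcone \<Longrightarrow> J (bal) \<le> J R"
proof -
  obtain L where L: "L \<in> fcone" "mass L < \<infinity>"
    "\<And>R. R \<in> fcone \<Longrightarrow> J L \<le> J R" using global_minimizer_exists by blast
  have f: "(\<lambda>x. - signed_potential \<kappa> \<omega> x) = field" by (simp add: fun_eq_iff field_def)
  have "bal = L"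
    unfolding pseudo_balayage_def Let_def f
  proof (rule the_equality)
    fix N assume N: "N \<in> fcone \<and> (\<forall>R\<in>fcone. J N \<le> J R)"
    then show "N = L" using minimizer_unique[of N L] L field_cone_mix(1)[of N L "1/2"] by auto
  qed (use L in auto)
  with L show "bal \<in> fcone" "mass (bal) < \<infinity>"
    "\<And>R. R \<in> fcone \<Longrightarrow> J (bal) \<le> J R" by auto
qed

lemma pseudo_balayage_unique:
  assumes "R \<in> fcone" "J R \<le> J (bal)"
  shows "R = bal"
proof (rule minimizer_unique[OF assms(1) pseudo_balayage_minimizer(1)])
  have m: "mix (1/2) R (bal) \<in> fcone"
    by (rule field_cone_mix(1)[OF assms(1) pseudo_balayage_minimizer(1)]) auto
  show "J (bal) \<le> J (mix (1/2) R (bal))"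
    by (rule pseudo_balayage_minimizer(3)[OF m])
  then show "J R \<le> J (mix (1/2) R (bal))" using assms(2) by simp
qed

section \<open>Solvability of the Gauss problem\<close>

lemma unit_field_cone_iff:
  "M \<in> unit_cone \<longleftrightarrow> M \<in> EA \<and> mass M = 1"
  using finite_mass_integrals(1)[of M 1] by (auto simp: unit_field_cone_def field_cone_iff)

lemma gauss_solution_iff:
  "gauss_solution \<kappa> field A L \<longleftrightarrow>
    L \<in> unit_cone \<and> (\<forall>R\<in>unit_cone. J L \<le> J R)" (is "?lhs \<longleftrightarrow> ?rhs")
proof
  assume L: ?lhs
  have "ereal (J L) \<le> ereal (J R)" if "R \<in> unit_cone" for R
  proof -
    have "ereal (J L) = gauss_inf \<kappa> field A" using L by (simp add: gauss_solution_def)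
    also have "\<dots> \<le> ereal (J R)" unfolding gauss_inf_def by (rule INF_lower[OF that])
    finally show ?thesis .
  qed
  then show ?rhs using L by (simp add: gauss_solution_def)
next
  assume R: ?rhs
  then have "ereal (J L) = gauss_inf \<kappa> field A"
    unfolding gauss_inf_def by (intro antisym INF_greatest) (auto intro: INF_lower)
  with R show ?lhs by (simp add: gauss_solution_def)
qed

text \<open>Tightness keeps the total mass of unit measures in the limit, so that they form a strongly closed
  set.\<close>

lemma solution_if_finite_capacity:
  assumes cap: "inner_capacity \<kappa> A < \<infinity>" "0 < inner_capacity \<kappa> A"
  shows "\<exists>L. gauss_solution \<kappa> field A L"
proof -
  let ?G = "unit_cone"
  obtain L where L: "L \<in> ?G" "\<And>R. R \<in> ?G \<Longrightarrow> J L \<le> J R"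
  proof (rule gauss_minimizer_exists[of ?G 1])
    show "?G \<subseteq> {M \<in> EA. mass M \<le> ennreal 1}" by (auto simp: unit_field_cone_iff)
    show "?G \<noteq> {}" using unit_measure_exists[OF cap(2)] by (metis unit_field_cone_iff empty_iff)
    show "mix (1/2) M N \<in> ?G" if "M \<in> ?G" "N \<in> ?G" for M N
      using that by (auto simp: unit_field_cone_iff cone_radon intro!: mix_cone order.antisym mix_mass_le mix_mass_ge)
    show "N \<in> ?G" if MG: "\<And>n. M n \<in> ?G" and s: "strong_limit M N" for M N
    proof -
      have MA: "M n \<in> EA" and M1: "mass (M n) = 1" for n
        using MG[of n] by (auto simp: unit_field_cone_iff)
      have NA: "N \<in> EA" by (rule strong_closed[OF strongly_closed s MA])
      note rM = cone_radon[OF MA] and rN = cone_radon[OF NA]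
      have le1: "mass N \<le> 1" by (rule strong_limit_mass_le[OF s]) (simp add: M1)
      have "\<not> mass N < 1"
      proof
        assume lt: "mass N < 1"
        then obtain m where m: "0 \<le> m" "mass N = ennreal m" "m < 1"
          by (cases "mass N") (auto simp: ennreal_less_one_iff)
        define \<delta> where "\<delta> = (1 - m) / 2"
        have \<delta>: "0 < \<delta>" using m by (simp add: \<delta>_def)
        have ub: "eventually (\<lambda>n. e (M n) (M n) \<le> e N N + 1) sequentially"
          using order_tendstoD(2)[OF strong_limit_energy[OF s], of "e N N + 1"]
          by (auto elim: eventually_mono)
        obtain Q where Q: "compact Q" "\<And>M. M \<in> EA \<Longrightarrow> e M M \<le> e N N + 1 \<Longrightarrow> emeasure M (- Q) \<le> ennreal \<delta>"
          using finite_capacity_tightness[OF cap(1) \<delta>] by metis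
        have "emeasure N Q \<le> mass N" by (rule emeasure_mono) (use rN in auto)
        also have "\<dots> < ennreal (1 - \<delta>)"
        proof -
          have "m < 1 - \<delta>" using m(3) by (simp add: \<delta>_def field_simps)
          then show ?thesis using m by (simp add: ennreal_less_iff)
        qed
        finally have "eventually (\<lambda>n. emeasure (M n) Q < ennreal (1 - \<delta>)) sequentially"
          by (rule vague_limit_compact[OF rM rN strong_vague[OF s] Q(1)])
        from eventually_happens[OF eventually_conj[OF ub this]]
        obtain n where n: "e (M n) (M n) \<le> e N N + 1" "emeasure (M n) Q < ennreal (1 - \<delta>)" by auto
        have Qb: "Q \<in> sets borel" using Q(1) by simp
        have "1 = emeasure (M n) (Q \<union> - Q)" using M1[of n] by simp
        also have "\<dots> \<le> emeasure (M n) Q + emeasure (M n) (- Q)"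
          by (rule emeasure_subadditive) (use rM Qb in auto)
        also have "\<dots> \<le> emeasure (M n) Q + ennreal \<delta>" by (intro add_left_mono Q(2) MA n)
        also have "\<dots> < ennreal (1 - \<delta>) + ennreal \<delta>" using n(2) by (simp add: add.commute[of _ "ennreal \<delta>"] ennreal_add_left_cancel_less)
        also have "\<dots> = 1" using \<delta> m by (simp add: \<delta>_def flip: ennreal_plus)
        finally show False by simp
      qed
      with le1 NA show ?thesis by (simp add: unit_field_cone_iff order.antisym not_less)
    qed
  qed (use that in auto)
  then show ?thesis by (auto simp: gauss_solution_iff)
qed

text \<open>Among measures of mass at most one a minimizer always exists. If it is not a unit measure, the
  segment joining it to the pseudo-balayage contains one, whose Gauss functional is not larger.\<close>

lemma solution_if_large_balayage:
  assumes big: "1 \<le> mass (bal)"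
  shows "\<exists>L. gauss_solution \<kappa> field A L"
proof -
    note p = pseudo_balayage_minimizer
  obtain L where L: "L \<in> mass_cone 1" "\<And>R. R \<in> mass_cone 1 \<Longrightarrow> J L \<le> J R"
    using mass_cone_minimizer[of 1] by auto
  have Lf: "L \<in> fcone" by (rule mass_cone_field[OF L(1)]) simp
  have LA: "L \<in> EA" and pA: "bal \<in> EA" using Lf p(1) by (auto simp: field_cone_iff)
  have L1: "mass L \<le> 1" using L(1) by (simp add: mass_cone_def)
  obtain s where s: "0 \<le> s" "mass L = ennreal s" using L1 by (cases "mass L") (auto simp: top_unique)
  obtain r where r: "0 \<le> r" "mass bal = ennreal r" using p(2) by (cases "mass bal") auto
  have s1: "s \<le> 1" and r1: "1 \<le> r" using L1 s big r by (auto simp: ennreal_le_1 ennreal_ge_1)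
  \<comment> \<open>the point of the segment with unit mass; \<open>s = r\<close> is possible only if both are \<open>1\<close>\<close>
  define t where "t = (if s = 1 then 0 else (1 - s) / (r - s))"
  have t: "0 \<le> t" "t \<le> 1" and mass: "(1 - t) * s + t * r = 1"
  proof -
    show "0 \<le> t" "t \<le> 1" using s1 r1 by (auto simp: t_def field_simps)
    show "(1 - t) * s + t * r = 1"
    proof (cases "s = 1")
      case False
      then have "r - s \<noteq> 0" using s1 r1 by simp
      then have "t * (r - s) = 1 - s" using False by (simp add: t_def)
      then show ?thesis by (simp add: algebra_simps)
    qed (simp add: t_def)
  qed
  let ?m = "mix t L bal"
  have "mass ?m = ennreal ((1 - t) * s + t * r)"
    using t s r cone_radon[OF LA] cone_radon[OF pA] by (simp add: emeasure_mix ennreal_mult)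
  then have m1: "mass ?m = 1" unfolding mass by simp
  have "J ?m \<le> (1 - t) * J L + t * J bal" by (rule J_mix_le[OF Lf p(1) t])
  also have "\<dots> \<le> (1 - t) * J L + t * J L" using p(3)[OF Lf] t by (intro add_left_mono mult_left_mono)
  also have "\<dots> = J L" by (simp add: algebra_simps)
  finally have mL: "J ?m \<le> J L" .
  have "J ?m \<le> J R" if "R \<in> unit_cone" for R
  proof -
    have "R \<in> mass_cone 1" using that by (simp add: unit_field_cone_iff mass_cone_def)
    then show ?thesis using L(2) mL by fastforce
  qed
  moreover have "?m \<in> unit_cone" using m1 mix_cone[OF LA pA] by (simp add: unit_field_cone_iff)
  ultimately show ?thesis by (auto simp: gauss_solution_iff)
qed

text \<open>Measures of vanishing energy converge vaguely to zero, and the potentials are small far away.\<close>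

lemma vanishing_energy_potentials:
  assumes M: "\<And>n. M n \<in> EA" "\<And>n. mass (M n) = 1"
    and lim: "(\<lambda>n. e (M n) (M n)) \<longlonglongrightarrow> 0" and \<epsilon>: "0 < \<epsilon>"
  shows "eventually (\<lambda>n. l (M n) \<le> \<epsilon>) sequentially"
proof -
  have "strong_limit M (null_measure borel)"
    using cone_E[OF M(1)] lim by (auto simp: strong_limit_def cone_null D2_def e_null)
  note v = strong_vague[OF this]
  have "eventually (\<lambda>n. (\<integral>\<^sup>+x. un x \<partial>M n) \<le> (\<integral>\<^sup>+x. un x \<partial>null_measure borel) + ennreal \<epsilon>) sequentially"
  proof (rule layer_comparison[where M = "\<lambda>_. null_measure borel" and S = "\<lambda>t. {x. ennreal t \<le> un x}"
        and A = A and C = C and q = 1])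
    fix t \<eta> :: real assume t: "0 < t" and \<eta>: "0 < \<eta>"
    obtain Q where Q: "compact Q" "{x. ennreal t \<le> un x} \<subseteq> Q" using potentials_vanish[OF t] by metis
    have "eventually (\<lambda>n. emeasure (M n) Q < ennreal \<eta>) sequentially"
      by (rule vague_limit_compact[OF cone_radon[OF M(1)] radon_null_measure v Q(1)]) (simp add: \<eta>)
    then show "eventually (\<lambda>n. emeasure (M n) {x. ennreal t \<le> un x} \<le>
        emeasure (null_measure borel) {x. ennreal t \<le> un x} + ennreal \<eta>) sequentially"
    proof eventually_elim
      case (elim n)
      have "emeasure (M n) {x. ennreal t \<le> un x} \<le> emeasure (M n) Q"
        by (rule emeasure_mono[OF Q(2)]) (use Q(1) cone_radon[OF M(1)] in simp)
      with elim show ?case by simp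
    qed
  qed (use cone_radon[OF M(1)] cone_concentrated[OF M(1)] M(2) \<epsilon> potentials_le_C radon_null_measure in auto)
  then show ?thesis
  proof eventually_elim
    case (elim n)
    then have "enn2real (\<integral>\<^sup>+x. un x \<partial>M n) \<le> \<epsilon>"
      using \<epsilon> enn2real_mono[of "\<integral>\<^sup>+x. un x \<partial>M n" "ennreal \<epsilon>"] by (simp add: nn_integral_null_measure)
    moreover have "l (M n) = enn2real (\<integral>\<^sup>+x. un x \<partial>M n) - enn2real (\<integral>\<^sup>+x. up x \<partial>M n)"
      using finite_mass_integrals(4)[OF M(1), of n 1] M(2) by simp
    ultimately show ?case using enn2real_nonneg[of "\<integral>\<^sup>+x. up x \<partial>M n"] by linarith
  qed
qed

text \<open>If the capacity is infinite, the mass missing in the pseudo-balayage can be added in the form of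
  unit measures of vanishing energy, which escape to infinity, where the external field is negligible.
  So the infimum over unit measures equals the infimum over the cone, and only the pseudo-balayage
  itself could attain it.\<close>

lemma no_solution:
  assumes cap: "inner_capacity \<kappa> A = \<infinity>" and small: "mass (bal) < 1"
  shows "\<not> gauss_solution \<kappa> field A L"
proof
  assume L: "gauss_solution \<kappa> field A L"
    note p = pseudo_balayage_minimizer
  have pA: "bal \<in> EA" using p(1) by (simp add: field_cone_iff)
  obtain s where s: "0 \<le> s" "mass bal = ennreal s" "s < 1"
    using small by (cases "mass bal") (auto simp: ennreal_less_one_iff)
  have "\<exists>\<tau>. \<tau> \<in> EA \<and> mass \<tau> = 1 \<and> e \<tau> \<tau> < 1 / Suc n" for n
    using infinite_capacity_small_energy[OF cap, of "1 / Suc n"] by (metis of_nat_0_less_iff zero_less_Suc zero_less_divide_1_iff)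
  then obtain M where M: "\<And>n. M n \<in> EA" "\<And>n. mass (M n) = 1" "\<And>n. e (M n) (M n) < 1 / Suc n"
    by metis
  have lim: "(\<lambda>n. e (M n) (M n)) \<longlonglongrightarrow> 0"
    by (rule tendsto_sandwich[OF _ _ tendsto_const LIMSEQ_Suc[OF lim_1_over_n]])
       (use M(3) in \<open>auto intro!: always_eventually less_imp_le\<close>)
  have Mf: "M n \<in> fcone" for n
    using finite_mass_integrals(1)[OF M(1), of n 1] M(2) by simp
  have limn: "(\<lambda>n. sqrt (e bal bal) * sqrt (e (M n) (M n))) \<longlonglongrightarrow> sqrt (e bal bal) * sqrt 0"
    by (intro tendsto_intros lim)
  have "J L \<le> J bal + \<epsilon>" if \<epsilon>: "0 < \<epsilon>" for \<epsilon>
  proof -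
    have 1: "eventually (\<lambda>n. l (M n) \<le> \<epsilon> / 8) sequentially"
      using vanishing_energy_potentials[OF M(1,2) lim, of "\<epsilon> / 8"] \<epsilon> by simp
    have 2: "eventually (\<lambda>n. e (M n) (M n) < \<epsilon> / 4) sequentially"
      using order_tendstoD(2)[OF lim, of "\<epsilon> / 4"] \<epsilon> by simp
    have 3: "eventually (\<lambda>n. sqrt (e bal bal) * sqrt (e (M n) (M n)) < \<epsilon> / 8) sequentially"
      using order_tendstoD(2)[OF limn, of "\<epsilon> / 8"] \<epsilon> by simp
    from eventually_happens[OF eventually_conj[OF 1 eventually_conj[OF 2 3]]]
    obtain n where n: "l (M n) \<le> \<epsilon> / 8" "e (M n) (M n) < \<epsilon> / 4" "sqrt (e bal bal) * sqrt (e (M n) (M n)) < \<epsilon> / 8"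
      by auto
    let ?t = "scale_measure (ennreal (1 - s)) (M n)"
    let ?R = "add_measure bal ?t"
    have tA: "?t \<in> EA" by (rule cone_scale[OF M(1)]) simp
    have RA: "?R \<in> EA" by (rule cone_add[OF pA tA])
    have "mass ?R = ennreal (s + (1 - s))"
      using s M(2) cone_radon[OF pA] cone_radon[OF M(1)]
      by (subst emeasure_add_measure) (auto simp flip: ennreal_plus)
    then have "?R \<in> unit_cone" using RA by (simp add: unit_field_cone_iff)
    then have JL: "J L \<le> J ?R" using L by (simp add: gauss_solution_iff)
    have iM: "integrable (M n) rfield" and ip: "integrable bal rfield"
      using Mf[of n] p(1) by (auto simp: field_cone_iff)
    have s0: "0 \<le> 1 - s" using s by simp
    have lR: "l ?R = l bal + (1 - s) * l (M n)"
      unfolding l_def using cone_radon[OF pA] cone_radon[OF M(1)]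
      by (simp add: integral_add_measure(2)[OF _ _ field_measurable ip integral_scale_measure(1)[OF iM s0]]
          integral_scale_measure(2)[OF iM s0])
    have eR: "e ?R ?R = e bal bal + 2 * (1 - s) * e bal (M n) + (1 - s)\<^sup>2 * e (M n) (M n)"
      using cone_E[OF pA] cone_E[OF tA] cone_E[OF M(1)] s0
      by (simp add: e_add cone_add e_scale e_commute[OF cone_E[OF M(1)] cone_E[OF pA]] power2_eq_square algebra_simps)
    have b1: "(1 - s) * l (M n) \<le> \<epsilon> / 8"
    proof -
      have "(1 - s) * l (M n) \<le> (1 - s) * (\<epsilon> / 8)" using n(1) s0 by (rule mult_left_mono)
      also have "\<dots> \<le> 1 * (\<epsilon> / 8)" using s \<epsilon> by (intro mult_right_mono) auto
      finally show ?thesis by simp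
    qed
    have b2: "(1 - s) * e bal (M n) \<le> \<epsilon> / 8"
    proof -
      have "e bal (M n) \<le> \<epsilon> / 8" using e_le_norms[OF cone_E[OF pA] cone_E[OF M(1)[of n]]] n(3) by linarith
      moreover have "(1 - s) * e bal (M n) \<le> 1 * e bal (M n)" using s by (intro mult_right_mono) auto
      ultimately show ?thesis by simp
    qed
    have b3: "(1 - s)\<^sup>2 * e (M n) (M n) \<le> \<epsilon> / 4"
    proof -
      have "(1 - s)\<^sup>2 \<le> 1" using s by (simp add: power_le_one)
      then have "(1 - s)\<^sup>2 * e (M n) (M n) \<le> 1 * e (M n) (M n)" by (intro mult_right_mono) auto
      then show ?thesis using n(2) by linarith
    qed
    have "J ?R = J bal + 2 * ((1 - s) * e bal (M n)) + (1 - s)\<^sup>2 * e (M n) (M n) + 2 * ((1 - s) * l (M n))"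
      unfolding J_eq lR eR by (simp add: algebra_simps)
    also have "\<dots> \<le> J bal + 2 * (\<epsilon> / 8) + \<epsilon> / 4 + 2 * (\<epsilon> / 8)"
      by (intro add_mono mult_left_mono order_refl b1 b2 b3) auto
    also have "\<dots> \<le> J bal + \<epsilon>" using \<epsilon> by simp
    finally show ?thesis using JL by linarith
  qed
  then have "J L \<le> J bal" by (rule field_le_epsilon)
  moreover have "L \<in> fcone" "mass L = 1"
    using L by (auto simp: gauss_solution_iff unit_field_cone_def)
  ultimately have "mass bal = 1" using pseudo_balayage_unique by metis
  with small show False by simp
qed

end

theorem theorem5p1:
  fixes \<kappa> :: "'a::{t2_space, second_countable_topology} \<times> 'a \<Rightarrow> ennreal"
    and A :: "'a set"
    and \<omega> :: "'a signed_measure"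
    and h :: real
    and f :: "'a \<Rightarrow> ereal"
  assumes X_locally_compact: "locally_compact_space (euclidean :: 'a topology)"
    and perfect: "perfect_kernel \<kappa>"
    and capacity_pos: "inner_capacity \<kappa> A > 0"
    and strongly_closed: "closedin (strong_topology \<kappa>) (of_positive ` energy_cone \<kappa> A)"
    and omega_radon: "signed_radon \<omega>"
    and omega_nonzero: "\<omega> \<noteq> zero_signed"
    and a: "emeasure (pos_part \<omega>) UNIV < \<infinity>"
    and b_usc: "\<And>K. compact K \<Longrightarrow> K \<subseteq> A \<Longrightarrow>
                  upper_semicontinuous_on K (potential \<kappa> (pos_part \<omega>))"
    and b_bounded: "(SUP x\<in>A. potential \<kappa> (total_variation \<omega>) x) < \<infinity>"
    and c: "h \<ge> 1" "ugaheri_maximum_principle h \<kappa>"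
    and d: "continuous_on {p. fst p \<noteq> snd p} \<kappa>"
    and e: "\<And>Q \<epsilon>. compact Q \<Longrightarrow> \<epsilon> > 0 \<Longrightarrow>
              \<exists>Q'. compact Q' \<and> (\<forall>x\<in>Q. \<forall>y. y \<notin> Q' \<longrightarrow> \<kappa> (x, y) < ennreal \<epsilon>)"
    and f_supp: "compact (measure_support (total_variation \<omega>))"
                "measure_support (total_variation \<omega>) \<subseteq> - closure A"
    and f_def: "f = (\<lambda>x. - signed_potential \<kappa> \<omega> x)"
  shows "((\<exists>l. gauss_solution \<kappa> f A l) \<longleftrightarrow>
            inner_capacity \<kappa> A < \<infinity> \<or> emeasure (pseudo_balayage \<kappa> \<omega> A) UNIV \<ge> 1) \<and>
         (emeasure (pseudo_balayage \<kappa> \<omega> A) UNIV = 1 \<longrightarrow>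
            (\<forall>l. gauss_solution \<kappa> f A l \<longleftrightarrow> l = pseudo_balayage \<kappa> \<omega> A))"
proof -
  interpret gauss_problem \<kappa> A \<omega> h
    by unfold_locales (fact X_locally_compact perfect strongly_closed omega_radon b_usc b_bounded c e f_supp)+
  have f: "f = field" by (simp add: fun_eq_iff field_def f_def)
  let ?p = "pseudo_balayage \<kappa> \<omega> A"
  have "(\<exists>l. gauss_solution \<kappa> f A l) \<longleftrightarrow> inner_capacity \<kappa> A < \<infinity> \<or> emeasure ?p UNIV \<ge> 1"
    unfolding f using solution_if_finite_capacity[OF _ capacity_pos] solution_if_large_balayage no_solution
    by (metis infinity_ennreal_def top.not_eq_extremum not_le)
  moreover have "gauss_solution \<kappa> f A l \<longleftrightarrow> l = ?p" if p1: "emeasure ?p UNIV = 1" for l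
  proof -
    have pu: "?p \<in> unit_field_cone \<kappa> field A"
      using pseudo_balayage_minimizer(1) p1 by (simp add: unit_field_cone_def)
    have sub: "R \<in> field_cone \<kappa> field A" if "R \<in> unit_field_cone \<kappa> field A" for R
      using that by (simp add: unit_field_cone_def)
    show ?thesis unfolding f gauss_solution_iff
      using pu sub pseudo_balayage_minimizer(3) pseudo_balayage_unique by blast
  qed
  ultimately show ?thesis by blast
qed

end
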